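(* Let $n\in\mathbb{N}$ ($n\ge 1$), let $f\in\mathscr{D}_e(\mathbb{R}^{n+1})$ and let $g=Rf$. Then $$f=c_n\,H_y\,\triangle^{\frac{n-1}{2}}\,R^{\ast}_{\partial}\,g ,\qquad c_n:=\frac{1}{(2\pi)^n}\,\frac{|S^n|}{2}.$$
   Context: Points of $\mathbb{R}^{n+1}$ are written $(x,y)$ with $x\in\mathbb{R}^n$, $y\in\mathbb{R}$. $\mathscr{D}_e(\mathbb{R}^{n+1})=\{\varphi\in C_0^\infty(\mathbb{R}^{n+1}):\varphi(x,-y)=\varphi(x,y)\ \forall x\in\mathbb{R}^n,y\in\mathbb{R}\}$. $S^n$ is the unit sphere in $\mathbb{R}^{n+1}$, $S_n$ its canonical surface measure, $|S^n|$ its total surface measure. The spherical mean operator is $$Rf(x,r)=\frac{1}{|S^n|}\int_{S^n} f(x+r\xi,r\eta)\,dS_n(\xi,\eta),\qquad x\in\mathbb{R}^n,\ r\ge 0,\ (\xi,\eta)\in S^n\subset\mathbb{R}^n\times\mathbb{R}.$$ For $g=Rf$, $$(R^{\ast}_{\partial}g)(x,y)=\int_{\mathbb{R}^n}\frac{\partial}{\partial y}\Big[g\big(z,\sqrt{\|x-z\|^2+y^2}\big)\Big]\,dz .$$ $H_y$ is the Hilbert transform in the variable $y$, $(Hu)(x)=\frac1\pi\,\mathrm{p.v.}\!\int_{\mathbb{R}}\frac{u(y)}{x-y}\,dy$, i.e. the Fourier multiplier $-i\,\mathrm{sgn}(\eta)$. With $\triangle=\triangle_x+\partial^2/\partial y^2$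 the Laplacian on $\mathbb{R}^{n+1}$, $\triangle^{\frac{n-1}{2}}$ denotes the operator with Fourier multiplier $(\|\xi\|^2+\eta^2)^{\frac{n-1}{2}}$, where $(\xi,\eta)\in\mathbb{R}^n\times\mathbb{R}$ is dual to $(x,y)$ (the identity for $n=1$). Both operators are understood via the Fourier transform of tempered distributions; $R^{\ast}_\partial g$ is a bounded function and hence a tempered distribution. *)

theory Defs
  imports "HOL-Analysis.Analysis"
begin

text \<open>The list \<open>[v\<^sub>1, ..., v\<^sub>k]\<close> stands for the iterated derivative
  \<open>\<partial>\<^bsub>v\<^sub>1\<^esub> ... \<partial>\<^bsub>v\<^sub>k\<^esub> f\<close>. Lists of basis vectors play the role of multi-indices.\<close>

fun iter_deriv :: "'a list \<Rightarrow> ('a::real_normed_vector \<Rightarrow> 'b::real_normed_vector) \<Rightarrow> 'a \<Rightarrow> 'b" where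
  "iter_deriv [] f = f"
| "iter_deriv (v # vs) f = (\<lambda>x. frechet_derivative (iter_deriv vs f) (at x) v)"

definition smooth :: "('a::euclidean_space \<Rightarrow> 'b::real_normed_vector) \<Rightarrow> bool" where
  "smooth f \<longleftrightarrow> (\<forall>vs. set vs \<subseteq> Basis \<longrightarrow> (\<forall>x. iter_deriv vs f differentiable (at x)))"

definition even_test_functions :: "('a::euclidean_space \<times> real \<Rightarrow> complex) set" where
  "even_test_functions =
     {\<phi>. smooth \<phi> \<and> compact (closure {p. \<phi> p \<noteq> 0}) \<and> (\<forall>x y. \<phi> (x, - y) = \<phi> (x, y))}"

definition schwartz :: "('a::euclidean_space \<Rightarrow> complex) set" where
  "schwartz = {\<phi>. smooth \<phi> \<and>
     (\<forall>vs N. set vs \<subseteq> Basis \<longrightarrow>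
        bounded (range (\<lambda>x. (1 + norm x) ^ N * norm (iter_deriv vs \<phi> x))))}"

text \<open>For Schwartz functions the supremum is over a set that is bounded above; these norms
  generate the usual topology of the Schwartz space.\<close>

definition schwartz_norm :: "nat \<Rightarrow> ('a::euclidean_space \<Rightarrow> complex) \<Rightarrow> real" where
  "schwartz_norm N \<phi> =
     (SUP (vs, x) \<in> {vs. set vs \<subseteq> Basis \<and> length vs \<le> N} \<times> UNIV.
        (1 + norm x) ^ N * norm (iter_deriv vs \<phi> x))"

text \<open>A distribution is a functional on functions of which only the values on Schwartz functions
  are meaningful; accordingly equality of distributions is always stated on \<open>schwartz\<close>.\<close>

definition tempered_distribution :: "(('a::euclidean_space \<Rightarrow> complex) \<Rightarrow> complex) \<Rightarrow> bool" where
  "tempered_distribution T \<longleftrightarrow>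
     (\<forall>\<phi>\<in>schwartz. \<forall>\<psi>\<in>schwartz. T (\<lambda>x. \<phi> x + \<psi> x) = T \<phi> + T \<psi>) \<and>
     (\<forall>c. \<forall>\<phi>\<in>schwartz. T (\<lambda>x. c * \<phi> x) = c * T \<phi>) \<and>
     (\<exists>C N. \<forall>\<phi>\<in>schwartz. norm (T \<phi>) \<le> C * schwartz_norm N \<phi>)"

text \<open>The functions that are absolutely integrable against every Schwartz function.\<close>

definition tempered_function :: "('a::euclidean_space \<Rightarrow> complex) \<Rightarrow> bool" where
  "tempered_function F \<longleftrightarrow>
     F \<in> borel_measurable lborel \<and> (\<exists>N::nat. integrable lborel (\<lambda>x. F x / of_real ((1 + norm x) ^ N)))"

definition distr_of_fun :: "('a::euclidean_space \<Rightarrow> complex) \<Rightarrow> ('a \<Rightarrow> complex) \<Rightarrow> complex" where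
  "distr_of_fun F \<phi> = (\<integral>x. F x * \<phi> x \<partial>lborel)"

text \<open>The normalisation without \<open>2 * pi\<close> in the exponent: \<open>\<partial>\<^bsub>b\<^esub>\<close> corresponds to
  multiplication by \<open>\<i> * (\<xi> \<bullet> b)\<close>, and \<open>p.v. 1 / (pi * x)\<close> has transform \<open>- \<i> * sgn \<xi>\<close>.\<close>

definition fourier :: "('a::euclidean_space \<Rightarrow> complex) \<Rightarrow> 'a \<Rightarrow> complex" where
  "fourier \<phi> \<xi> = (\<integral>x. cis (- (x \<bullet> \<xi>)) * \<phi> x \<partial>lborel)"

definition fourier_distr ::
    "(('a::euclidean_space \<Rightarrow> complex) \<Rightarrow> complex) \<Rightarrow> ('a \<Rightarrow> complex) \<Rightarrow> complex" where
  "fourier_distr T \<phi> = T (fourier \<phi>)"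

text \<open>\<open>has_multiplier_image m T U\<close>: the operator with multiplier \<open>m\<close> is applicable to \<open>T\<close> and
  yields \<open>U\<close>. The multipliers below are not smooth, so that their product with an arbitrary
  tempered distribution is undefined. The operator is therefore applied to those \<open>T\<close> whose
  Fourier transform is a function \<open>F\<close> for which \<open>F\<close> and \<open>m * F\<close> are tempered functions.
  Since \<open>F\<close> is determined almost everywhere by \<open>T\<close>, the distribution \<open>U\<close> is unique.\<close>

definition has_multiplier_image ::
    "('a::euclidean_space \<Rightarrow> complex) \<Rightarrow> (('a \<Rightarrow> complex) \<Rightarrow> complex) \<Rightarrow>
     (('a \<Rightarrow> complex) \<Rightarrow> complex) \<Rightarrow> bool" where
  "has_multiplier_image m T U \<longleftrightarrow>
     tempered_distribution T \<and> tempered_distribution U \<and>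
     (\<exists>F. tempered_function F \<and> tempered_function (\<lambda>\<zeta>. m \<zeta> * F \<zeta>) \<and>
        (\<forall>\<phi>\<in>schwartz. fourier_distr T \<phi> = distr_of_fun F \<phi>) \<and>
        (\<forall>\<phi>\<in>schwartz. fourier_distr U \<phi> = distr_of_fun (\<lambda>\<zeta>. m \<zeta> * F \<zeta>) \<phi>))"

definition hilbert_y_multiplier :: "'a \<times> real \<Rightarrow> complex" where
  "hilbert_y_multiplier = (\<lambda>(\<xi>, \<eta>). - \<i> * of_real (sgn \<eta>))"

text \<open>\<open>(\<parallel>\<xi>\<parallel>\<^sup>2 + \<eta>\<^sup>2) powr ((n - 1) / 2)\<close>, written as a natural power of the square root so that it
  is identically 1 for \<open>n = 1\<close>, also at the origin, where \<open>0 powr 0 = 0\<close>.\<close>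

definition laplacian_power_multiplier :: "(real ^ 'n) \<times> real \<Rightarrow> complex" where
  "laplacian_power_multiplier =
     (\<lambda>(\<xi>, \<eta>). of_real (sqrt ((norm \<xi>)\<^sup>2 + \<eta>\<^sup>2) ^ (CARD('n) - 1)))"

text \<open>The surface measure of \<open>A \<subseteq> sphere 0 1\<close> is \<open>DIM('a)\<close> times the volume of the cone
  \<open>{t *\<^sub>R a | t a. 0 < t \<and> t < 1 \<and> a \<in> A}\<close>; note \<open>sgn x = x /\<^sub>R norm x\<close>.\<close>

definition sphere_measure :: "'a::euclidean_space measure" where
  "sphere_measure =
     distr (density lborel (\<lambda>x. of_nat DIM('a) * indicator (ball 0 1 - {0}) x)) borel sgn"

definition sphere_area :: "'a::euclidean_space itself \<Rightarrow> real" where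
  "sphere_area _ = measure (sphere_measure :: 'a measure) (sphere 0 1)"

definition spherical_mean ::
    "((real ^ 'n) \<times> real \<Rightarrow> complex) \<Rightarrow> real ^ 'n \<Rightarrow> real \<Rightarrow> complex" where
  "spherical_mean f x r =
     (\<integral>(\<xi>, \<eta>). f (x + r *\<^sub>R \<xi>, r * \<eta>) \<partial>sphere_measure) /
     of_real (sphere_area TYPE((real ^ 'n) \<times> real))"

definition backprojection_deriv ::
    "(real ^ 'n \<Rightarrow> real \<Rightarrow> complex) \<Rightarrow> (real ^ 'n) \<times> real \<Rightarrow> complex" where
  "backprojection_deriv g = (\<lambda>(x, y).
     \<integral>z. vector_derivative (\<lambda>t. g z (sqrt ((norm (x - z))\<^sup>2 + t\<^sup>2))) (at y) \<partial>lborel)"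

end

theory Submission
  imports Defs "HOL-Probability.Characteristic_Functions"
begin

text \<open>Write \<open>h\<close> for the backprojection, \<open>n\<close> for the dimension of the \<open>x\<close>-space and \<open>\<zeta> = (\<xi>, \<eta>)\<close>. For fixed
  \<open>z\<close> the integrand of \<open>h\<close> is the \<open>y\<close>-derivative of the radialization of \<open>f\<close> about \<open>(z, 0)\<close>. The
  Fourier transform commutes with radialization, so its transform at \<open>\<zeta>\<close> is \<open>\<i> * \<eta>\<close> times the mean
  over \<open>\<theta> \<in> sphere 0 1\<close> of \<open>cis (z \<bullet> (norm \<zeta> *\<^sub>R fst \<theta> - \<xi>)) * fourier f (norm \<zeta> *\<^sub>R \<theta>)\<close>. Integrating
  over \<open>z\<close> with a Gaussian cutoff replaces \<open>cis\<close> by an approximation of \<open>(2 * pi) ^ n\<close> times a Dirac mass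
  at \<open>\<xi> = norm \<zeta> *\<^sub>R fst \<theta>\<close>. The factor \<open>\<eta>\<close> is the Jacobian of \<open>\<eta> \<mapsto> s = norm (\<xi>, \<eta>)\<close>, that is
  \<open>\<eta> d\<eta> = s ds\<close>, and the Dirac mass selects the two points \<open>(\<xi>, \<plusminus> \<eta>)\<close> of the sphere of radius \<open>s\<close>.
  Together with the evenness of \<open>f\<close> this shows that \<open>h\<close> has the Fourier transform
  \<open>\<i> / c * sgn \<eta> * norm \<zeta> powi (1 - n) * fourier f \<zeta>\<close>, which the two multipliers turn into
  \<open>fourier f \<zeta> / c\<close>.\<close>

section \<open>Polar coordinates and rotation invariance\<close>

text \<open>Two convergence problems shape the proof. The spherical mean about \<open>(z, 0)\<close>
  over the sphere through a fixed point can only be expected to decay like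
  \<open>norm z powi (- n)\<close>, which is borderline for integration over the n-dimensional
  z-space; the derivative in y contributes a further factor of order \<open>y / r\<close> and makes
  the z-integral absolutely convergent, with at most linear growth in the point. As only growth is
  controlled, the transform of \<open>h\<close> is computed by pairing with a Schwartz function.
  Once the transform has been moved onto the means, z occurs only in a phase of modulus 1 and cannot
  be integrated first; the Gaussian cutoff restores absolute convergence, and dominated convergence
  removes it on both sides. The weight \<open>norm \<zeta> powi (1 - n)\<close> is integrable near
  the origin of the (n + 1)-dimensional space, so the transform of \<open>h\<close> is an integrable
  function and the multipliers can act on it. In the constant, \<open>(2 * pi) ^ n\<close> is the
  mass of the Gaussian kernel, 2 counts the two equal contributions of \<open>\<eta>\<close> and
  \<open>- \<eta>\<close>, and the sphere area is the normalisation of the mean.\<close>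

lemma ball_borel [measurable]: "ball (a :: 'a::metric_space) r \<in> sets borel"
  by (rule borel_open) simp

lemma emeasure_lborel_unit_ball_pos: "0 < emeasure lborel (ball (0::'a::euclidean_space) 1)"
  by (metis Sigma_Algebra.measure_def content_ball_pos enn2real_0 less_numeral_extra(1) linorder_not_less not_gr_zero order_refl zero_less_measure_iff)

lemma integrable_of_norm_le:
  fixes f :: "'a \<Rightarrow> 'b::{banach, second_countable_topology}" and g :: "'a \<Rightarrow> real"
  assumes "integrable M g" "f \<in> borel_measurable M" and le: "\<And>x. norm (f x) \<le> g x"
  shows "integrable M f"
  using assms(1,2) by (rule Bochner_Integration.integrable_bound) (simp add: order_trans[OF le abs_ge_self])

lemma nn_integral_lborel_translate:
  fixes F :: "'a::euclidean_space \<Rightarrow> ennreal"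
  assumes [measurable]: "F \<in> borel_measurable borel"
  shows "(\<integral>\<^sup>+x. F (a + x) \<partial>lborel) = (\<integral>\<^sup>+x. F x \<partial>lborel)"
proof -
  have "(\<integral>\<^sup>+x. F x \<partial>lborel) = (\<integral>\<^sup>+x. F x \<partial>distr lborel borel ((+) a))"
    by (simp add: lborel_distr_plus)
  also have "\<dots> = (\<integral>\<^sup>+x. F (a + x) \<partial>lborel)"
    by (subst nn_integral_distr) auto
  finally show ?thesis ..
qed

lemma nn_integral_lborel_scale:
  fixes F :: "'a::euclidean_space \<Rightarrow> ennreal"
  assumes [measurable]: "F \<in> borel_measurable borel" and "c \<noteq> 0"
  shows "(\<integral>\<^sup>+x. F x \<partial>lborel) = ennreal (\<bar>c\<bar> ^ DIM('a)) * (\<integral>\<^sup>+x. F (c *\<^sub>R x) \<partial>lborel)"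
proof -
  have "(\<integral>\<^sup>+x. F x \<partial>lborel) =
      (\<integral>\<^sup>+x. F x \<partial>density (distr lborel borel (\<lambda>x. 0 + c *\<^sub>R x)) (\<lambda>_. \<bar>c\<bar> ^ DIM('a)))"
    by (subst lborel_affine[OF \<open>c \<noteq> 0\<close>, of 0]) simp
  also have "\<dots> = ennreal (\<bar>c\<bar> ^ DIM('a)) * (\<integral>\<^sup>+x. F (c *\<^sub>R x) \<partial>lborel)"
    by (simp add: nn_integral_density nn_integral_distr nn_integral_cmult)
  finally show ?thesis .
qed

lemma integral_lborel_translate:
  fixes F :: "'a::euclidean_space \<Rightarrow> 'b::{banach, second_countable_topology}"
  assumes [measurable]: "F \<in> borel_measurable borel"
  shows "(\<integral>x. F (a + x) \<partial>lborel) = (\<integral>x. F x \<partial>lborel)"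
proof -
  have "(\<integral>x. F x \<partial>lborel) = (\<integral>x. F x \<partial>distr lborel borel ((+) a))"
    by (simp add: lborel_distr_plus)
  also have "\<dots> = (\<integral>x. F (a + x) \<partial>lborel)"
    by (subst integral_distr) auto
  finally show ?thesis ..
qed

lemma integrable_lborel_translate:
  fixes F :: "'a::euclidean_space \<Rightarrow> 'b::{banach, second_countable_topology}"
  assumes "integrable lborel F"
  shows "integrable lborel (\<lambda>x. F (a + x))"
proof -
  have [measurable]: "F \<in> borel_measurable borel" using assms by auto
  have "integrable (distr lborel borel ((+) a)) F"
    using assms by (simp add: lborel_distr_plus)
  then show ?thesis
    by (subst (asm) integrable_distr_eq) auto
qed

lemma integral_lborel_scale:
  fixes F :: "'a::euclidean_space \<Rightarrow> 'b::{banach, second_countable_topology}"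
  assumes [measurable]: "F \<in> borel_measurable borel" and "c \<noteq> 0"
  shows "(\<integral>x. F x \<partial>lborel) = (\<bar>c\<bar> ^ DIM('a)) *\<^sub>R (\<integral>x. F (c *\<^sub>R x) \<partial>lborel)"
proof -
  have "(\<integral>x. F x \<partial>lborel) =
      (\<integral>x. F x \<partial>density (distr lborel borel (\<lambda>x. 0 + c *\<^sub>R x)) (\<lambda>_. \<bar>c\<bar> ^ DIM('a)))"
    by (subst lborel_affine[OF \<open>c \<noteq> 0\<close>, of 0]) simp
  also have "\<dots> = (\<bar>c\<bar> ^ DIM('a)) *\<^sub>R (\<integral>x. F (c *\<^sub>R x) \<partial>lborel)"
    by (simp add: integral_density integral_distr)
  finally show ?thesis .
qed

text \<open>Uniqueness of Haar measure: the image measure is translation invariant, and both measures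
  agree on the unit ball.\<close>

lemma nn_integral_lborel_isometry:
  fixes T :: "'a::euclidean_space \<Rightarrow> 'a"
  assumes T: "linear T" and norm_T: "\<And>x. norm (T x) = norm x" and inv: "\<And>x. T (T x) = x"
    and [measurable]: "F \<in> borel_measurable borel"
  shows "(\<integral>\<^sup>+x. F (T x) \<partial>lborel) = (\<integral>\<^sup>+x. F x \<partial>lborel)"
proof -
  have [measurable]: "T \<in> borel_measurable borel"
    using T by (intro borel_measurable_continuous_onI linear_continuous_on) (simp add: linear_conv_bounded_linear)
  have add: "T (x + y) = T x + T y" for x y using T by (simp add: linear_add)
  \<comment> \<open>A test weight of finite positive integral \<open>c\<close> that is invariant
    under \<open>T\<close> and under \<open>x \<mapsto> - x\<close>. Multiplying by \<open>c\<close>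
    inserts a second variable, so that translations can be exchanged between the two
    integrals.\<close>
  define h :: "'a \<Rightarrow> ennreal" where "h = indicator (ball 0 1)"
  have [measurable]: "h \<in> borel_measurable borel" by (simp add: h_def)
  have h_T: "h (T x) = h x" for x by (simp add: h_def indicator_def norm_T)
  have h_minus: "h (- x) = h x" for x by (simp add: h_def indicator_def)
  define c where "c = (\<integral>\<^sup>+x. h x \<partial>lborel)"
  have c: "c = emeasure lborel (ball (0::'a) 1)" by (simp add: c_def h_def)
  then have "c \<noteq> \<infinity>" using emeasure_lborel_ball_finite[of "0::'a" 1] by simp
  have "c \<noteq> 0" unfolding c using emeasure_lborel_unit_ball_pos[where 'a='a] by simp
  have "(\<integral>\<^sup>+x. F (T x) \<partial>lborel) * c = (\<integral>\<^sup>+x. (\<integral>\<^sup>+y. F (T x) * h y \<partial>lborel) \<partial>lborel)"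
    by (simp add: nn_integral_cmult nn_integral_multc c_def)
  also have "\<dots> = (\<integral>\<^sup>+x. (\<integral>\<^sup>+y. F (T x) * h (- T x + y) \<partial>lborel) \<partial>lborel)"
    by (intro nn_integral_cong nn_integral_lborel_translate[symmetric]) measurable
  also have "\<dots> = (\<integral>\<^sup>+y. (\<integral>\<^sup>+x. F (T x) * h (- T x + y) \<partial>lborel) \<partial>lborel)"
    by (rule lborel_pair.Fubini') simp
  also have "\<dots> = (\<integral>\<^sup>+y. (\<integral>\<^sup>+x. F (T (T y + x)) * h (- T (T y + x) + y) \<partial>lborel) \<partial>lborel)"
    by (intro nn_integral_cong nn_integral_lborel_translate[symmetric]) measurable
  \<comment> \<open>Here \<open>T (T y + x) = y + T x\<close>, so the argument of \<open>h\<close>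
    becomes \<open>- T x\<close>, and both invariances of the ball reduce it to
    \<open>x\<close>.\<close>
  also have "\<dots> = (\<integral>\<^sup>+y. (\<integral>\<^sup>+x. F (T x + y) * h x \<partial>lborel) \<partial>lborel)"
    by (simp add: add inv h_T h_minus add.commute)
  also have "\<dots> = (\<integral>\<^sup>+x. (\<integral>\<^sup>+y. F (T x + y) * h x \<partial>lborel) \<partial>lborel)"
    by (rule lborel_pair.Fubini') simp
  also have "\<dots> = (\<integral>\<^sup>+x. (\<integral>\<^sup>+y. F y * h x \<partial>lborel) \<partial>lborel)"
    by (intro nn_integral_cong nn_integral_lborel_translate) measurable
  also have "\<dots> = (\<integral>\<^sup>+x. F x \<partial>lborel) * c"
    by (simp add: nn_integral_cmult nn_integral_multc c_def)
  finally show ?thesis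
    using \<open>c \<noteq> \<infinity>\<close> \<open>c \<noteq> 0\<close>
    by (simp add: mult.commute[of _ c] ennreal_mult_cancel_left)
qed

lemma sets_sphere_measure [simp, measurable_cong]: "sets sphere_measure = sets borel"
  by (simp add: sphere_measure_def)

lemma space_sphere_measure [simp]: "space sphere_measure = UNIV"
  by (simp add: sphere_measure_def)

lemma sgn_borel_measurable [measurable]: "(sgn :: 'a::euclidean_space \<Rightarrow> 'a) \<in> borel_measurable borel"
  unfolding sgn_div_norm by measurable

lemma nn_integral_sphere_measure:
  fixes F :: "'a::euclidean_space \<Rightarrow> ennreal"
  assumes [measurable]: "F \<in> borel_measurable borel"
  shows "(\<integral>\<^sup>+\<omega>. F \<omega> \<partial>sphere_measure) =
    (\<integral>\<^sup>+x. of_nat DIM('a) * indicator (ball 0 1 - {0}) x * F (sgn x) \<partial>lborel)"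
  by (simp add: sphere_measure_def nn_integral_distr nn_integral_density)

lemma emeasure_sphere_measure_UNIV:
  "emeasure (sphere_measure :: 'a::euclidean_space measure) UNIV = of_nat DIM('a) * emeasure lborel (ball (0::'a) 1)"
proof -
  have "emeasure (sphere_measure :: 'a measure) UNIV = (\<integral>\<^sup>+\<omega>. 1 \<partial>(sphere_measure :: 'a measure))"
    by simp
  also have "\<dots> = of_nat DIM('a) * emeasure lborel (ball (0::'a) 1 - {0})"
    by (subst nn_integral_sphere_measure) (auto simp: nn_integral_cmult)
  also have "emeasure lborel (ball (0::'a) 1 - {0}) = emeasure lborel (ball (0::'a) 1)"
    by (rule emeasure_Diff_null_set) auto
  finally show ?thesis .
qed

interpretation sphere_measure: finite_measure "sphere_measure :: 'a::euclidean_space measure"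
  by standard (use emeasure_lborel_ball_finite[of "0::'a" 1] in \<open>auto simp: emeasure_sphere_measure_UNIV ennreal_mult_eq_top_iff\<close>)

lemma AE_sphere_measure_norm: "AE \<omega> in sphere_measure. norm (\<omega> :: 'a::euclidean_space) = 1"
  unfolding sphere_measure_def
  by (subst AE_distr_iff, simp_all, subst AE_density, auto simp: indicator_def norm_sgn)

lemma sphere_area_eq: "sphere_area TYPE('a::euclidean_space) = measure (sphere_measure :: 'a measure) UNIV"
  unfolding sphere_area_def
  by (rule sphere_measure.finite_measure_eq_AE) (use AE_sphere_measure_norm in auto)

lemma sphere_area_pos: "sphere_area TYPE('a::euclidean_space) > 0"
  unfolding sphere_area_eq measure_def emeasure_sphere_measure_UNIV
  using emeasure_lborel_unit_ball_pos[where 'a='a] emeasure_lborel_ball_finite[of "0::'a" 1]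
  by (simp add: enn2real_mult enn2real_positive_iff less_top[symmetric] zero_less_iff_neq_zero)

text \<open>Since the sphere measure is defined by cones, the right-hand side is a double integral
  over \<open>s\<close> and over \<open>x\<close> in the unit ball. Rescaling \<open>s\<close> by
  \<open>norm x\<close> replaces \<open>sgn x\<close> by \<open>x\<close>, and rescaling
  \<open>x\<close> by \<open>1 / t\<close> isolates \<open>F y\<close>. What remains in front of
  \<open>F y\<close> is a one-dimensional integral over \<open>t > norm y\<close> whose value is
  1.\<close>

lemma nn_integral_polar:
  fixes F :: "'a::euclidean_space \<Rightarrow> ennreal"
  assumes [measurable]: "F \<in> borel_measurable borel"
  shows "(\<integral>\<^sup>+x. F x \<partial>lborel) = (\<integral>\<^sup>+s. ennreal (s ^ (DIM('a) - 1)) * indicator {0<..} s *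
    (\<integral>\<^sup>+\<omega>. F (s *\<^sub>R \<omega>) \<partial>sphere_measure) \<partial>lborel)"
proof -
  define N where "N = DIM('a)"
  have N: "N > 0" by (simp add: N_def)
  define w where "w = (\<lambda>s::real. ennreal (s ^ (N - 1)) * indicator {0<..} s)"
  define B :: "'a \<Rightarrow> ennreal" where "B = (\<lambda>x. of_nat N * indicator (ball 0 1 - {0}) x)"
  have [measurable]: "w \<in> borel_measurable borel" by (simp add: w_def)
  have [measurable]: "B \<in> borel_measurable borel" by (simp add: B_def)
  \<comment> \<open>The substitution \<open>s = norm x * t\<close>: one factor \<open>norm x\<close>
    is the Jacobian, the others come from \<open>s ^ (N - 1)\<close>.\<close>
  have radial: "(\<integral>\<^sup>+s. w s * F (s *\<^sub>R sgn x) \<partial>lborel) =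
      ennreal (norm x ^ N) * (\<integral>\<^sup>+t. w t * F (t *\<^sub>R x) \<partial>lborel)" if "x \<noteq> 0" for x
  proof -
    have "(\<integral>\<^sup>+s. w s * F (s *\<^sub>R sgn x) \<partial>lborel) =
        ennreal (norm x) * (\<integral>\<^sup>+t. w (norm x * t) * F ((norm x * t) *\<^sub>R sgn x) \<partial>lborel)"
      using that by (subst nn_integral_lborel_scale[where c = "norm x"]) simp_all
    also have "\<dots> = ennreal (norm x) * (\<integral>\<^sup>+t. ennreal (norm x ^ (N - 1)) * (w t * F (t *\<^sub>R x)) \<partial>lborel)"
    proof -
      have "w (norm x * t) * F ((norm x * t) *\<^sub>R sgn x) = ennreal (norm x ^ (N - 1)) * (w t * F (t *\<^sub>R x))" for t
      proof (cases "t > 0")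
        case True
        have "(norm x * t) *\<^sub>R sgn x = t *\<^sub>R x" using that by (simp add: sgn_div_norm)
        then show ?thesis using True that
          by (simp add: w_def power_mult_distrib ennreal_mult mult.assoc del: scaleR_scaleR)
      qed (use that in \<open>simp add: w_def zero_less_mult_iff\<close>)
      then show ?thesis by simp
    qed
    also have "\<dots> = ennreal (norm x ^ N) * (\<integral>\<^sup>+t. w t * F (t *\<^sub>R x) \<partial>lborel)"
    proof -
      have "ennreal (norm x) * ennreal (norm x ^ (N - 1)) = ennreal (norm x ^ N)"
        using N by (simp add: ennreal_mult'[symmetric] power_Suc[symmetric] del: power_Suc)
      then show ?thesis by (subst nn_integral_cmult) (simp_all add: mult.assoc[symmetric])
    qed
    finally show ?thesis .
  qed
  \<comment> \<open>The substitution \<open>y = t *\<^sub>R x\<close>: the condition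
    \<open>norm x < 1\<close> becomes \<open>norm y < t\<close>, and the Jacobian
    \<open>1 / t ^ N\<close> joins \<open>norm x ^ N = norm y ^ N / t ^ N\<close>.\<close>
  have scale: "(\<integral>\<^sup>+x. B x * ennreal (norm x ^ N) * F (t *\<^sub>R x) \<partial>lborel) =
      (\<integral>\<^sup>+y. of_nat N * indicator {norm y<..} t * ennreal (norm y ^ N / t ^ (2 * N)) * F y \<partial>lborel)" if "t > 0" for t
  proof -
    have eq: "indicator {norm (t *\<^sub>R y)<..} t = (indicator (ball 0 1) y :: ennreal)" for y :: 'a
      using that by (auto simp: indicator_def)
    have [measurable]: "(\<lambda>y::'a. indicator {norm y<..} t :: ennreal) \<in> borel_measurable borel"
    proof -
      have "(\<lambda>y::'a. indicator {norm y<..} t :: ennreal) = indicator (ball 0 t)"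
        by (auto simp: indicator_def fun_eq_iff)
      then show ?thesis by simp
    qed
    have "AE y in lborel. y \<noteq> (0::'a)" by (rule AE_lborel_singleton)
    then have ae: "AE y in lborel. B y = of_nat N * indicator (ball 0 1) y"
      by eventually_elim (auto simp: B_def indicator_def)
    have "(\<integral>\<^sup>+y. of_nat N * indicator {norm y<..} t * ennreal (norm y ^ N / t ^ (2 * N)) * F y \<partial>lborel) =
       ennreal (t ^ N) * (\<integral>\<^sup>+y. of_nat N * indicator (ball 0 1) y * ennreal (norm (t *\<^sub>R y) ^ N / t ^ (2 * N)) * F (t *\<^sub>R y) \<partial>lborel)"
      using that by (subst nn_integral_lborel_scale[where c = t])
        (simp_all add: N_def eq del: norm_scaleR)
    also have "\<dots> = (\<integral>\<^sup>+y. ennreal (t ^ N) * (of_nat N * indicator (ball 0 1) y * ennreal (norm (t *\<^sub>R y) ^ N / t ^ (2 * N)) * F (t *\<^sub>R y)) \<partial>lborel)"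
      by (subst nn_integral_cmult) auto
    also have "\<dots> = (\<integral>\<^sup>+y. of_nat N * indicator (ball 0 1) y * ennreal (norm y ^ N) * F (t *\<^sub>R y) \<partial>lborel)"
    proof (rule nn_integral_cong)
      fix y :: 'a
      have "t ^ N * (norm (t *\<^sub>R y) ^ N / t ^ (2 * N)) = norm y ^ N"
        using that by (simp add: power_mult_distrib mult_2 power_add)
      then have eq: "ennreal (t ^ N) * ennreal (norm (t *\<^sub>R y) ^ N / t ^ (2 * N)) = ennreal (norm y ^ N)"
        using that by (simp only: ennreal_mult'[symmetric] zero_le_power less_imp_le)
      show "ennreal (t ^ N) * (of_nat N * indicator (ball 0 1) y * ennreal (norm (t *\<^sub>R y) ^ N / t ^ (2 * N)) * F (t *\<^sub>R y))
          = of_nat N * indicator (ball 0 1) y * ennreal (norm y ^ N) * F (t *\<^sub>R y)"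
        unfolding eq[symmetric] by (simp only: mult_ac)
    qed
    also have "\<dots> = (\<integral>\<^sup>+x. B x * ennreal (norm x ^ N) * F (t *\<^sub>R x) \<partial>lborel)"
      by (rule nn_integral_cong_AE) (use ae in eventually_elim, simp)
    finally show ?thesis ..
  qed
  \<comment> \<open>With \<open>w t\<close> the integrand is
    \<open>N * norm y ^ N / t ^ (N + 1)\<close>, the derivative of
    \<open>- (norm y / t) ^ N\<close>.\<close>
  have tail: "(\<integral>\<^sup>+t. w t * (of_nat N * indicator {norm y<..} t * ennreal (norm y ^ N / t ^ (2 * N))) \<partial>lborel) = 1"
    if "y \<noteq> 0" for y :: 'a
  proof -
    define a where "a = norm y"
    have a: "a > 0" using that by (simp add: a_def)
    have fin: "(\<integral>\<^sup>+t. ennreal (real N * a ^ N / t ^ (N + 1)) * indicator {a..} t \<partial>lborel) = ennreal (0 - (- (a ^ N / a ^ N)))"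
    proof (rule nn_integral_FTC_atLeast[where F = "\<lambda>t. - (a ^ N / t ^ N)" and T = 0])
      show "((\<lambda>t. - (a ^ N / t ^ N)) has_real_derivative real N * a ^ N / t ^ (N + 1)) (at t)" (is ?thesis) if "a \<le> t" for t
      proof -
        have "t > 0" using that a by simp
        moreover obtain M where "N = Suc M" using N gr0_conv_Suc by blast
        moreover have "((\<lambda>t. t ^ Suc M) has_real_derivative real (Suc M) * t ^ M) (at t)"
          using DERIV_pow[of "Suc M" t] by simp
        ultimately have "((\<lambda>t. - (a ^ N) * inverse (t ^ N)) has_real_derivative
            - (a ^ N) * - (inverse (t ^ N) * (real N * t ^ M) * inverse (t ^ N))) (at t)"
          by (intro DERIV_cmult DERIV_inverse') simp_all
        moreover have "- (a ^ N) * - (inverse (t ^ N) * (real N * t ^ M) * inverse (t ^ N)) = real N * a ^ N / t ^ (N + 1)"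
          using \<open>t > 0\<close> by (simp add: \<open>N = Suc M\<close> divide_simps)
        ultimately have "((\<lambda>t. - (a ^ N) * inverse (t ^ N)) has_real_derivative real N * a ^ N / t ^ (N + 1)) (at t)"
          by (simp only:)
        then show ?thesis
          by (simp only: divide_inverse mult_minus_left)
      qed
      show "((\<lambda>t. - (a ^ N / t ^ N)) \<longlongrightarrow> 0) at_top"
        using tendsto_minus[OF tendsto_divide_0[OF tendsto_const[of "a ^ N"]
            filterlim_at_top_imp_at_infinity[OF filterlim_pow_at_top[OF N filterlim_ident]]]] by simp
    qed (use a in auto)
    have "(\<integral>\<^sup>+t. w t * (of_nat N * indicator {norm y<..} t * ennreal (norm y ^ N / t ^ (2 * N))) \<partial>lborel) =
        (\<integral>\<^sup>+t. ennreal (real N * a ^ N / t ^ (N + 1)) * indicator {a..} t \<partial>lborel)"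
    proof (rule nn_integral_cong_AE)
      have "AE t in lborel. t \<noteq> a" by (rule AE_lborel_singleton)
      then show "AE t in lborel. w t * (of_nat N * indicator {norm y<..} t * ennreal (norm y ^ N / t ^ (2 * N))) =
          ennreal (real N * a ^ N / t ^ (N + 1)) * indicator {a..} t"
      proof eventually_elim
        case (elim t)
        have "t ^ (N - 1) * (real N * (a ^ N / t ^ (2 * N))) = real N * a ^ N / t ^ (N + 1)" if "a < t"
        proof -
          have "t ^ (2 * N) = t ^ (N - 1) * t ^ (N + 1)" using N by (simp only: power_add[symmetric]) (simp add: mult_2)
          then show ?thesis using that a by simp
        qed
        then show ?case using elim a
          by (auto simp: w_def indicator_def a_def[symmetric] ennreal_of_nat_eq_real_of_nat ennreal_mult'[symmetric])
      qed
    qed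
    with fin a show ?thesis by simp
  qed
  have "(\<integral>\<^sup>+s. w s * (\<integral>\<^sup>+\<omega>. F (s *\<^sub>R \<omega>) \<partial>sphere_measure) \<partial>lborel) =
      (\<integral>\<^sup>+s. (\<integral>\<^sup>+x. w s * (B x * F (s *\<^sub>R sgn x)) \<partial>lborel) \<partial>lborel)"
    by (simp add: nn_integral_sphere_measure nn_integral_cmult B_def N_def)
  also have "\<dots> = (\<integral>\<^sup>+x. (\<integral>\<^sup>+s. w s * (B x * F (s *\<^sub>R sgn x)) \<partial>lborel) \<partial>lborel)"
    by (rule lborel_pair.Fubini') measurable
  also have "\<dots> = (\<integral>\<^sup>+x. B x * (\<integral>\<^sup>+s. w s * F (s *\<^sub>R sgn x) \<partial>lborel) \<partial>lborel)"
    by (subst nn_integral_cmult[symmetric]) (auto simp: mult_ac)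
  also have "\<dots> = (\<integral>\<^sup>+x. B x * (ennreal (norm x ^ N) * (\<integral>\<^sup>+t. w t * F (t *\<^sub>R x) \<partial>lborel)) \<partial>lborel)"
  proof (rule nn_integral_cong)
    fix x :: 'a
    show "B x * (\<integral>\<^sup>+s. w s * F (s *\<^sub>R sgn x) \<partial>lborel) = B x * (ennreal (norm x ^ N) * (\<integral>\<^sup>+t. w t * F (t *\<^sub>R x) \<partial>lborel))"
      by (cases "x = 0") (simp_all add: B_def radial)
  qed
  also have "\<dots> = (\<integral>\<^sup>+x. (\<integral>\<^sup>+t. w t * (B x * ennreal (norm x ^ N) * F (t *\<^sub>R x)) \<partial>lborel) \<partial>lborel)"
    by (subst mult.assoc[symmetric], subst nn_integral_cmult[symmetric]) (auto simp: mult_ac)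
  also have "\<dots> = (\<integral>\<^sup>+t. (\<integral>\<^sup>+x. w t * (B x * ennreal (norm x ^ N) * F (t *\<^sub>R x)) \<partial>lborel) \<partial>lborel)"
    by (rule lborel_pair.Fubini') measurable
  also have "\<dots> = (\<integral>\<^sup>+t. w t * (\<integral>\<^sup>+x. B x * ennreal (norm x ^ N) * F (t *\<^sub>R x) \<partial>lborel) \<partial>lborel)"
    by (subst nn_integral_cmult) auto
  also have "\<dots> = (\<integral>\<^sup>+t. w t * (\<integral>\<^sup>+y. of_nat N * indicator {norm y<..} t * ennreal (norm y ^ N / t ^ (2 * N)) * F y \<partial>lborel) \<partial>lborel)"
    (is "(\<integral>\<^sup>+t. ?l t \<partial>lborel) = (\<integral>\<^sup>+t. ?r t \<partial>lborel)")
  proof (rule nn_integral_cong)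
    fix t :: real
    show "?l t = ?r t" by (cases "t > 0") (simp_all add: scale, simp add: w_def)
  qed
  also have "\<dots> = (\<integral>\<^sup>+t. (\<integral>\<^sup>+y. w t * (of_nat N * indicator {norm y<..} t * ennreal (norm y ^ N / t ^ (2 * N))) * F y \<partial>lborel) \<partial>lborel)"
    by (subst nn_integral_cmult[symmetric]) (auto simp: mult_ac indicator_def)
  also have "\<dots> = (\<integral>\<^sup>+y. (\<integral>\<^sup>+t. w t * (of_nat N * indicator {norm y<..} t * ennreal (norm y ^ N / t ^ (2 * N))) * F y \<partial>lborel) \<partial>lborel)"
    by (rule lborel_pair.Fubini') (auto simp: indicator_def)
  also have "\<dots> = (\<integral>\<^sup>+y. (\<integral>\<^sup>+t. w t * (of_nat N * indicator {norm y<..} t * ennreal (norm y ^ N / t ^ (2 * N))) \<partial>lborel) * F y \<partial>lborel)"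
    by (subst nn_integral_multc) (auto simp: indicator_def)
  also have "\<dots> = (\<integral>\<^sup>+y. F y \<partial>lborel)"
  proof (rule nn_integral_cong_AE)
    have "AE y in lborel. y \<noteq> (0::'a)" by (rule AE_lborel_singleton)
    then show "AE y in lborel. (\<integral>\<^sup>+t. w t * (of_nat N * indicator {norm y<..} t * ennreal (norm y ^ N / t ^ (2 * N))) \<partial>lborel) * F y = F y"
      by eventually_elim (simp add: tail)
  qed
  finally show ?thesis by (simp add: w_def N_def)
qed

text \<open>The usual justification of Fubini below: domination by a product of integrable functions
  of one variable each.\<close>

lemma (in pair_sigma_finite) integrable_pair_bound:
  fixes f :: "'a \<Rightarrow> real" and g :: "'b \<Rightarrow> real" and k :: "'a \<Rightarrow> 'b \<Rightarrow> 'c::{banach, second_countable_topology}"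
  assumes f: "integrable M1 f" and g: "integrable M2 g"
    and [measurable]: "(\<lambda>(x, y). k x y) \<in> borel_measurable (M1 \<Otimes>\<^sub>M M2)"
    and bound: "AE x in M1. AE y in M2. norm (k x y) \<le> \<bar>f x\<bar> * \<bar>g y\<bar>"
  shows "integrable (M1 \<Otimes>\<^sub>M M2) (\<lambda>(x, y). k x y)"
proof (rule integrableI_bounded)
  have [measurable]: "f \<in> borel_measurable M1" "g \<in> borel_measurable M2" using f g by auto
  have "(\<integral>\<^sup>+p. ennreal (norm (case p of (x, y) \<Rightarrow> k x y)) \<partial>(M1 \<Otimes>\<^sub>M M2)) =
      (\<integral>\<^sup>+x. (\<integral>\<^sup>+y. ennreal (norm (k x y)) \<partial>M2) \<partial>M1)"
    by (subst M2.nn_integral_fst[symmetric]) (auto simp: split_beta')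
  also have "\<dots> \<le> (\<integral>\<^sup>+x. (\<integral>\<^sup>+y. ennreal \<bar>f x\<bar> * ennreal \<bar>g y\<bar> \<partial>M2) \<partial>M1)"
    by (intro nn_integral_mono_AE) (use bound in eventually_elim,
      intro nn_integral_mono_AE, auto elim!: eventually_mono simp: ennreal_mult[symmetric])
  also have "\<dots> = (\<integral>\<^sup>+x. ennreal \<bar>f x\<bar> \<partial>M1) * (\<integral>\<^sup>+y. ennreal \<bar>g y\<bar> \<partial>M2)"
    by (simp add: nn_integral_cmult nn_integral_multc)
  also have "\<dots> < \<infinity>"
    using f g by (auto simp: integrable_iff_bounded ennreal_mult_less_top)
  finally show "(\<integral>\<^sup>+p. ennreal (norm (case p of (x, y) \<Rightarrow> k x y)) \<partial>(M1 \<Otimes>\<^sub>M M2)) < \<infinity>" .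
qed simp

lemma nn_integral_polar_norm:
  fixes h :: "real \<Rightarrow> ennreal"
  assumes [measurable]: "h \<in> borel_measurable borel"
  shows "(\<integral>\<^sup>+x. h (norm x) \<partial>(lborel :: 'a::euclidean_space measure)) =
    emeasure (sphere_measure :: 'a measure) UNIV * (\<integral>\<^sup>+s. ennreal (s ^ (DIM('a) - 1)) * indicator {0<..} s * h s \<partial>lborel)"
proof -
  have "(\<integral>\<^sup>+x. h (norm x) \<partial>(lborel :: 'a measure)) = (\<integral>\<^sup>+s. ennreal (s ^ (DIM('a) - 1)) * indicator {0<..} s *
    (\<integral>\<^sup>+\<omega>. h (norm (s *\<^sub>R \<omega>)) \<partial>(sphere_measure :: 'a measure)) \<partial>lborel)"
    by (rule nn_integral_polar) simp
  also have "\<dots> = (\<integral>\<^sup>+s. emeasure (sphere_measure :: 'a measure) UNIV * (ennreal (s ^ (DIM('a) - 1)) * indicator {0<..} s * h s) \<partial>lborel)"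
  proof (rule nn_integral_cong)
    fix s :: real
    have "(\<integral>\<^sup>+\<omega>. h (norm (s *\<^sub>R \<omega>)) \<partial>(sphere_measure :: 'a measure)) = (\<integral>\<^sup>+\<omega>. h \<bar>s\<bar> \<partial>(sphere_measure :: 'a measure))"
      by (rule nn_integral_cong_AE) (use AE_sphere_measure_norm in eventually_elim, simp)
    then show "ennreal (s ^ (DIM('a) - 1)) * indicator {0<..} s * (\<integral>\<^sup>+\<omega>. h (norm (s *\<^sub>R \<omega>)) \<partial>(sphere_measure :: 'a measure)) =
       emeasure (sphere_measure :: 'a measure) UNIV * (ennreal (s ^ (DIM('a) - 1)) * indicator {0<..} s * h s)"
      by (auto simp: indicator_def mult_ac)
  qed
  finally show ?thesis by (simp add: nn_integral_cmult)
qed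

text \<open>In polar coordinates the integrand is \<open>(s / (1 + s)) ^ m / (1 + s)\<^sup>2\<close>
  with \<open>m = DIM('a) - 1 - k\<close>, hence at most \<open>1 / (1 + s)\<^sup>2\<close>. The
  case \<open>k = 0\<close> gives the standard integrable decay; \<open>k = n - 1\<close> handles
  the singular weight left by the backprojection.\<close>

lemma integrable_norm_power_decay:
  assumes "k < DIM('a::euclidean_space)"
  shows "integrable lborel (\<lambda>x::'a. 1 / (norm x ^ k * (1 + norm x) ^ (DIM('a) + 1 - k)))"
proof (rule integrableI_nonneg)
  define m where "m = DIM('a) - 1 - k"
  have m: "DIM('a) - 1 = m + k" "DIM('a) + 1 - k = m + 2" using assms by (auto simp: m_def)
  have "(\<integral>\<^sup>+s. ennreal (s ^ (DIM('a) - 1)) * indicator {0<..} s * ennreal (1 / (s ^ k * (1 + s) ^ (DIM('a) + 1 - k))) \<partial>lborel) \<le>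
      (\<integral>\<^sup>+s. ennreal (1 / (1 + s)\<^sup>2) * indicator {0..} s \<partial>lborel)"
  proof (rule nn_integral_mono)
    fix s :: real
    have "s ^ (DIM('a) - 1) * (1 / (s ^ k * (1 + s) ^ (DIM('a) + 1 - k))) \<le> 1 / (1 + s)\<^sup>2" if "s > 0"
    proof -
      have "s ^ (DIM('a) - 1) * (1 / (s ^ k * (1 + s) ^ (DIM('a) + 1 - k))) = (s / (1 + s)) ^ m * (1 / (1 + s)\<^sup>2)"
        using that unfolding m by (simp only: power_add power_divide times_divide_times_eq mult_1_right) (simp add: mult_ac)
      also have "\<dots> \<le> 1 * (1 / (1 + s)\<^sup>2)"
        using that by (intro mult_right_mono power_le_one) auto
      finally show ?thesis by simp
    qed
    then show "ennreal (s ^ (DIM('a) - 1)) * indicator {0<..} s * ennreal (1 / (s ^ k * (1 + s) ^ (DIM('a) + 1 - k))) \<le>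
        ennreal (1 / (1 + s)\<^sup>2) * indicator {0..} s"
      by (auto simp: indicator_def ennreal_mult'[symmetric] intro!: ennreal_leI)
  qed
  also have "\<dots> = ennreal (0 - (- (1 / (1 + 0))))"
  proof (rule nn_integral_FTC_atLeast[where F = "\<lambda>s. - (1 / (1 + s))" and T = 0])
    show "((\<lambda>s. - (1 / (1 + s))) has_real_derivative 1 / (1 + x)\<^sup>2) (at x)" if "0 \<le> x" for x :: real
      using that by (auto intro!: derivative_eq_intros simp: power2_eq_square)
    have "filterlim (\<lambda>s::real. 1 + s) at_top at_top"
      by (rule filterlim_tendsto_add_at_top[OF tendsto_const filterlim_ident])
    then show "((\<lambda>s::real. - (1 / (1 + s))) \<longlongrightarrow> 0) at_top"
      using tendsto_minus[OF tendsto_divide_0[OF tendsto_const[of "1"] filterlim_at_top_imp_at_infinity]] by force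
  qed auto
  finally have "(\<integral>\<^sup>+s. ennreal (s ^ (DIM('a) - 1)) * indicator {0<..} s * ennreal (1 / (s ^ k * (1 + s) ^ (DIM('a) + 1 - k))) \<partial>lborel) < \<infinity>"
    by (simp add: le_less_trans)
  then show "(\<integral>\<^sup>+x. ennreal (1 / (norm x ^ k * (1 + norm x) ^ (DIM('a) + 1 - k))) \<partial>(lborel :: 'a measure)) < \<infinity>"
    by (subst nn_integral_polar_norm) (auto simp: ennreal_mult_less_top ennreal_mult_eq_top_iff sphere_measure.emeasure_finite top.not_eq_extremum[symmetric])
qed auto

section \<open>Polar coordinates as the image of a product measure\<close>

definition radial_measure :: "nat \<Rightarrow> real measure" where
  "radial_measure N = density lborel (\<lambda>s. ennreal (s ^ (N - 1)) * indicator {0<..} s)"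

lemma sets_radial_measure [simp, measurable_cong]: "sets (radial_measure N) = sets borel"
  by (simp add: radial_measure_def)

lemma space_radial_measure [simp]: "space (radial_measure N) = UNIV"
  by (simp add: radial_measure_def)

lemma AE_radial_measure_pos: "AE s in radial_measure N. s > 0"
  unfolding radial_measure_def by (subst AE_density) (auto simp: indicator_def)

interpretation radial_measure: sigma_finite_measure "radial_measure N"
  unfolding radial_measure_def
  by (subst sigma_finite_measure.sigma_finite_iff_density_finite[OF lborel.sigma_finite_measure_axioms]) (auto simp: indicator_def)

interpretation polar_pair: pair_sigma_finite "radial_measure N" "sphere_measure :: 'a::euclidean_space measure" ..

text \<open>The formula for nonnegative functions, applied to indicators. In this form integrability
  and complex integrals transfer by change of variables and Fubini, with no further
  approximation.\<close>

lemma lborel_polar: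
  "(lborel :: 'a::euclidean_space measure) =
    distr (radial_measure DIM('a) \<Otimes>\<^sub>M sphere_measure) borel (\<lambda>(s, \<omega>). s *\<^sub>R \<omega>)"
proof (rule measure_eqI)
  fix A :: "'a set" assume "A \<in> sets lborel"
  then have [measurable]: "A \<in> sets borel" by simp
  have "emeasure lborel A = (\<integral>\<^sup>+x. indicator A x \<partial>lborel)" by simp
  also have "\<dots> = (\<integral>\<^sup>+s. ennreal (s ^ (DIM('a) - 1)) * indicator {0<..} s *
    (\<integral>\<^sup>+\<omega>. indicator A (s *\<^sub>R \<omega>) \<partial>sphere_measure) \<partial>lborel)"
    by (rule nn_integral_polar) simp
  also have "\<dots> = (\<integral>\<^sup>+s. (\<integral>\<^sup>+\<omega>. indicator A (s *\<^sub>R \<omega>) \<partial>sphere_measure) \<partial>radial_measure DIM('a))"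
    by (simp add: radial_measure_def nn_integral_density)
  also have "\<dots> = (\<integral>\<^sup>+p. indicator A (case p of (s, \<omega>) \<Rightarrow> s *\<^sub>R \<omega>) \<partial>(radial_measure DIM('a) \<Otimes>\<^sub>M sphere_measure))"
    by (subst sphere_measure.nn_integral_fst[symmetric]) simp_all
  also have "\<dots> = (\<integral>\<^sup>+x. indicator A x \<partial>distr (radial_measure DIM('a) \<Otimes>\<^sub>M sphere_measure) borel (\<lambda>(s, \<omega>). s *\<^sub>R \<omega>))"
    by (subst nn_integral_distr) simp_all
  also have "\<dots> = emeasure (distr (radial_measure DIM('a) \<Otimes>\<^sub>M sphere_measure) borel (\<lambda>(s, \<omega>). s *\<^sub>R \<omega>)) A"
    by simp
  finally show "emeasure lborel A = \<dots>" .
qed simp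

lemma integrable_polar_iff:
  fixes F :: "'a::euclidean_space \<Rightarrow> 'b::{banach, second_countable_topology}"
  assumes [measurable]: "F \<in> borel_measurable borel"
  shows "integrable lborel F \<longleftrightarrow>
    integrable (radial_measure DIM('a) \<Otimes>\<^sub>M sphere_measure) (\<lambda>(s, \<omega>). F (s *\<^sub>R \<omega>))"
  by (subst lborel_polar, subst integrable_distr_eq) (auto simp: split_beta')

lemma integral_polar:
  fixes F :: "'a::euclidean_space \<Rightarrow> 'b::{banach, second_countable_topology}"
  assumes "integrable lborel F"
  shows "(\<integral>x. F x \<partial>lborel) = (\<integral>s. (\<integral>\<omega>. F (s *\<^sub>R \<omega>) \<partial>sphere_measure) \<partial>radial_measure DIM('a))"
proof -
  have [measurable]: "F \<in> borel_measurable borel" using assms by auto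
  have "(\<integral>x. F x \<partial>lborel) = (\<integral>p. F (case p of (s, \<omega>) \<Rightarrow> s *\<^sub>R \<omega>) \<partial>(radial_measure DIM('a) \<Otimes>\<^sub>M sphere_measure))"
    by (subst lborel_polar, subst integral_distr) (auto simp: split_beta')
  also have "\<dots> = (\<integral>s. (\<integral>\<omega>. F (s *\<^sub>R \<omega>) \<partial>sphere_measure) \<partial>radial_measure DIM('a))"
    using assms by (subst polar_pair.integral_fst'[symmetric]) (auto simp: integrable_polar_iff split_beta')
  finally show ?thesis .
qed

text \<open>One reflection suffices: as \<open>norm v = norm w\<close>, the reflection in the
  hyperplane orthogonal to \<open>v - w\<close> takes \<open>v\<close> to \<open>w\<close>. It is an
  involutive isometry, so it preserves Lebesgue measure, and it commutes with \<open>sgn\<close>, so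
  it preserves the sphere measure.\<close>

lemma integral_sphere_measure_rotate:
  fixes h :: "real \<Rightarrow> complex" and v w :: "'a::euclidean_space"
  assumes [measurable]: "h \<in> borel_measurable borel" and vw: "norm v = norm w"
  shows "(\<integral>\<theta>. h (\<theta> \<bullet> v) \<partial>sphere_measure) = (\<integral>\<theta>. h (\<theta> \<bullet> w) \<partial>sphere_measure)"
proof (cases "v = w")
  case False
  define u where "u = v - w"
  have u: "u \<bullet> u \<noteq> 0" using False by (simp add: u_def)
  have vw2: "v \<bullet> v = w \<bullet> w" using vw by (simp add: dot_square_norm)
  define T where "T = (\<lambda>x. x - (2 * (x \<bullet> u) / (u \<bullet> u)) *\<^sub>R u)"
  have lin: "linear T"
    unfolding T_def by (rule linearI) (simp_all add: inner_add_left algebra_simps add_divide_distrib)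
  have adj: "T x \<bullet> y = x \<bullet> T y" for x y
    by (simp add: T_def inner_diff_left inner_diff_right inner_commute)
  have inv: "T (T x) = x" for x
  proof -
    have Tu: "T x \<bullet> u = - (x \<bullet> u)" using u by (simp add: T_def inner_diff_left)
    have "T (T x) = T x - (2 * (T x \<bullet> u) / (u \<bullet> u)) *\<^sub>R u" by (simp only: T_def)
    also have "\<dots> = T x + (2 * (x \<bullet> u) / (u \<bullet> u)) *\<^sub>R u" unfolding Tu by simp
    also have "\<dots> = x" by (simp add: T_def)
    finally show ?thesis .
  qed
  have norm: "norm (T x) = norm x" for x
    by (simp add: norm_eq_sqrt_inner adj inv)
  have Tv: "T v = w"
  proof -
    have "2 * (v \<bullet> u) = u \<bullet> u"
      by (simp add: u_def inner_diff_left inner_diff_right vw2 inner_commute)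
    then show ?thesis using u by (simp add: T_def) (simp add: u_def)
  qed
  have [measurable]: "T \<in> borel_measurable borel"
    using lin by (intro borel_measurable_continuous_onI linear_continuous_on) (simp add: linear_conv_bounded_linear)
  have sgn_T: "T (sgn x) = sgn (T x)" for x
    using lin by (simp add: sgn_div_norm norm linear_cmul)
  have T0: "T x = 0 \<longleftrightarrow> x = 0" for x using norm[of x] by (metis norm_eq_zero)
  have "(sphere_measure :: 'a measure) = distr sphere_measure borel T"
  proof (rule measure_eqI)
    fix A :: "'a set" assume "A \<in> sets sphere_measure"
    then have [measurable]: "A \<in> sets borel" by simp
    have "emeasure sphere_measure A = (\<integral>\<^sup>+\<omega>. indicator A \<omega> \<partial>sphere_measure)" by simp
    also have "\<dots> = (\<integral>\<^sup>+x. of_nat DIM('a) * indicator (ball 0 1 - {0}) x * indicator A (sgn x) \<partial>lborel)"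
      by (rule nn_integral_sphere_measure) simp
    also have "\<dots> = (\<integral>\<^sup>+x. of_nat DIM('a) * indicator (ball 0 1 - {0}) (T x) * indicator A (sgn (T x)) \<partial>lborel)"
      by (rule nn_integral_lborel_isometry[OF lin norm inv, symmetric]) simp
    also have "\<dots> = (\<integral>\<^sup>+x. of_nat DIM('a) * indicator (ball 0 1 - {0}) x * indicator A (T (sgn x)) \<partial>lborel)"
      by (simp add: indicator_def norm T0 sgn_T)
    also have "\<dots> = (\<integral>\<^sup>+\<omega>. indicator A (T \<omega>) \<partial>sphere_measure)"
      by (rule nn_integral_sphere_measure[symmetric]) simp
    also have "\<dots> = (\<integral>\<^sup>+\<omega>. indicator A \<omega> \<partial>distr sphere_measure borel T)"
      by (subst nn_integral_distr) auto
    also have "\<dots> = emeasure (distr sphere_measure borel T) A" by simp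
    finally show "emeasure sphere_measure A = emeasure (distr sphere_measure borel T) A" .
  qed simp
  then have "(\<integral>\<theta>. h (\<theta> \<bullet> v) \<partial>sphere_measure) = (\<integral>\<theta>. h (\<theta> \<bullet> v) \<partial>distr sphere_measure borel T)"
    by simp
  also have "\<dots> = (\<integral>\<theta>. h (\<theta> \<bullet> w) \<partial>sphere_measure)"
    by (subst integral_distr) (simp_all add: adj Tv)
  finally show ?thesis .
qed simp

lemma cis_borel_measurable [measurable]: "cis \<in> borel_measurable borel"
  by (intro borel_measurable_continuous_onI continuous_intros)

text \<open>In polar coordinates the radialization is a function of \<open>s\<close> alone,
  integrable by Fubini, and the remaining variable ranges over a finite measure space.\<close>

lemma integrable_radialization:
  fixes F :: "'a::euclidean_space \<Rightarrow> complex"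
  assumes F: "integrable lborel F"
  shows "integrable lborel (\<lambda>q::'a. \<integral>\<omega>. F (norm q *\<^sub>R \<omega>) \<partial>sphere_measure)"
proof -
  have [measurable]: "F \<in> borel_measurable borel" using F by auto
  let ?A = "\<lambda>q::'a. \<integral>\<omega>. F (norm q *\<^sub>R \<omega>) \<partial>sphere_measure"
  have P: "integrable (radial_measure DIM('a) \<Otimes>\<^sub>M (sphere_measure :: 'a measure)) (\<lambda>(s, \<omega>). F (s *\<^sub>R \<omega>))"
    using F by (simp add: integrable_polar_iff)
  then have 1: "integrable (radial_measure DIM('a)) (\<lambda>s. \<integral>\<omega>. F (s *\<^sub>R \<omega>) \<partial>(sphere_measure :: 'a measure))"
    using polar_pair.integrable_fst'[OF P] by simp
  have "integrable (radial_measure DIM('a) \<Otimes>\<^sub>M (sphere_measure :: 'a measure)) (\<lambda>(s, \<theta>). \<integral>\<omega>. F (s *\<^sub>R \<omega>) \<partial>(sphere_measure :: 'a measure))"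
    by (rule polar_pair.Fubini_integrable)
       (use 1 in \<open>auto intro!: sphere_measure.integrable_const\<close>)
  \<comment> \<open>\<open>norm (s *\<^sub>R \<theta>) = s\<close> holds only for
    \<open>s > 0\<close> and \<open>norm \<theta> = 1\<close>, which is why the identity is stated
    almost everywhere.\<close>
  moreover have "AE p in radial_measure DIM('a) \<Otimes>\<^sub>M (sphere_measure :: 'a measure).
      (case p of (s, \<theta>) \<Rightarrow> \<integral>\<omega>. F (s *\<^sub>R \<omega>) \<partial>(sphere_measure :: 'a measure)) = (case p of (s, \<theta>) \<Rightarrow> ?A (s *\<^sub>R \<theta>))"
  proof (rule polar_pair.AE_pair_measure)
    show "AE s in radial_measure DIM('a). AE \<theta> in (sphere_measure :: 'a measure).
        (case (s, \<theta>) of (s, \<theta>) \<Rightarrow> \<integral>\<omega>. F (s *\<^sub>R \<omega>) \<partial>(sphere_measure :: 'a measure)) = (case (s, \<theta>) of (s, \<theta>) \<Rightarrow> ?A (s *\<^sub>R \<theta>))"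
      using AE_radial_measure_pos
    proof eventually_elim
      case (elim s)
      show ?case using AE_sphere_measure_norm by eventually_elim (use elim in simp)
    qed
  qed measurable
  ultimately have "integrable (radial_measure DIM('a) \<Otimes>\<^sub>M (sphere_measure :: 'a measure)) (\<lambda>(s, \<theta>). ?A (s *\<^sub>R \<theta>))"
    by (subst (asm) integrable_cong_AE) auto
  then show ?thesis by (subst integrable_polar_iff) auto
qed

text \<open>The spherical integral \<open>K\<close> of the exponential depends only on the norm of
  its argument, so \<open>K (s *\<^sub>R \<zeta>)\<close> may be replaced by
  \<open>K ((s * norm \<zeta>) *\<^sub>R \<omega>)\<close>. This exchanges the roles of the two
  sphere variables: \<open>s *\<^sub>R \<omega>\<close> becomes the integration variable of a
  Fourier integral and \<open>norm \<zeta> *\<^sub>R \<theta>\<close> its frequency.\<close>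

lemma fourier_radialization:
  fixes F :: "'a::euclidean_space \<Rightarrow> complex" and \<zeta> :: 'a
  assumes F: "integrable lborel F"
  shows "fourier (\<lambda>q. \<integral>\<omega>. F (norm q *\<^sub>R \<omega>) \<partial>sphere_measure) \<zeta> =
    (\<integral>\<theta>. fourier F (norm \<zeta> *\<^sub>R \<theta>) \<partial>sphere_measure)"
proof -
  have [measurable]: "F \<in> borel_measurable borel" using F by auto
  let ?\<sigma> = "sphere_measure :: 'a measure" and ?\<rho> = "radial_measure DIM('a)"
  let ?A = "\<lambda>q::'a. \<integral>\<omega>. F (norm q *\<^sub>R \<omega>) \<partial>?\<sigma>"
  define K where "K = (\<lambda>v::'a. \<integral>\<theta>. cis (- (\<theta> \<bullet> v)) \<partial>?\<sigma>)"
  have K_cong: "K v = K w" if "norm v = norm w" for v w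
    unfolding K_def using that by (intro integral_sphere_measure_rotate[of "\<lambda>t. cis (- t)"]) auto
  have int_cis: "integrable lborel (\<lambda>q. cis (- (q \<bullet> \<xi>)) * G q)" if "integrable lborel G" for G :: "'a \<Rightarrow> complex" and \<xi>
    using that by (rule Bochner_Integration.integrable_bound) (use that in \<open>auto simp: norm_mult\<close>)
  have P: "integrable (?\<rho> \<Otimes>\<^sub>M ?\<sigma>) (\<lambda>(s, \<omega>). F (s *\<^sub>R \<omega>))"
    using F by (simp add: integrable_polar_iff)
  interpret PS: pair_sigma_finite "?\<rho> \<Otimes>\<^sub>M ?\<sigma>" ?\<sigma> ..
  have int3: "integrable ((?\<rho> \<Otimes>\<^sub>M ?\<sigma>) \<Otimes>\<^sub>M ?\<sigma>)
      (\<lambda>(p, \<theta>). F (fst p *\<^sub>R snd p) * cis (- (fst p * norm \<zeta>) * (snd p \<bullet> \<theta>)))"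
    by (rule PS.integrable_pair_bound[where f = "\<lambda>p. norm (F (fst p *\<^sub>R snd p))" and g = "\<lambda>_. 1"])
       (use integrable_norm[OF P] in \<open>auto simp: norm_mult split_beta' sphere_measure.integrable_const\<close>)
  have "fourier ?A \<zeta> = (\<integral>s. (\<integral>\<theta>. cis (- ((s *\<^sub>R \<theta>) \<bullet> \<zeta>)) * ?A (s *\<^sub>R \<theta>) \<partial>?\<sigma>) \<partial>?\<rho>)"
    unfolding fourier_def by (rule integral_polar) (rule int_cis[OF integrable_radialization[OF F]])
  also have "\<dots> = (\<integral>s. (\<integral>\<omega>. F (s *\<^sub>R \<omega>) * K (s *\<^sub>R \<zeta>) \<partial>?\<sigma>) \<partial>?\<rho>)"
  proof (rule integral_cong_AE)
    show "AE s in ?\<rho>. (\<integral>\<theta>. cis (- ((s *\<^sub>R \<theta>) \<bullet> \<zeta>)) * ?A (s *\<^sub>R \<theta>) \<partial>?\<sigma>) = (\<integral>\<omega>. F (s *\<^sub>R \<omega>) * K (s *\<^sub>R \<zeta>) \<partial>?\<sigma>)"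
      using AE_radial_measure_pos
    proof eventually_elim
      case (elim s)
      have "(\<integral>\<theta>. cis (- ((s *\<^sub>R \<theta>) \<bullet> \<zeta>)) * ?A (s *\<^sub>R \<theta>) \<partial>?\<sigma>) = (\<integral>\<theta>. cis (- (\<theta> \<bullet> (s *\<^sub>R \<zeta>))) * (\<integral>\<omega>. F (s *\<^sub>R \<omega>) \<partial>?\<sigma>) \<partial>?\<sigma>)"
        by (rule integral_cong_AE) (measurable, use AE_sphere_measure_norm in eventually_elim, use elim in simp)
      then show ?case by (simp add: K_def)
    qed
  qed (simp_all add: K_def)
  also have "\<dots> = (\<integral>s. (\<integral>\<omega>. (\<integral>\<theta>. F (s *\<^sub>R \<omega>) * cis (- (s * norm \<zeta>) * (\<omega> \<bullet> \<theta>)) \<partial>?\<sigma>) \<partial>?\<sigma>) \<partial>?\<rho>)"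
  proof (rule integral_cong_AE)
    show "AE s in ?\<rho>. (\<integral>\<omega>. F (s *\<^sub>R \<omega>) * K (s *\<^sub>R \<zeta>) \<partial>?\<sigma>) = (\<integral>\<omega>. (\<integral>\<theta>. F (s *\<^sub>R \<omega>) * cis (- (s * norm \<zeta>) * (\<omega> \<bullet> \<theta>)) \<partial>?\<sigma>) \<partial>?\<sigma>)"
      using AE_radial_measure_pos
    proof eventually_elim
      case (elim s)
      show ?case
      proof (rule integral_cong_AE)
        show "AE \<omega> in ?\<sigma>. F (s *\<^sub>R \<omega>) * K (s *\<^sub>R \<zeta>) = (\<integral>\<theta>. F (s *\<^sub>R \<omega>) * cis (- (s * norm \<zeta>) * (\<omega> \<bullet> \<theta>)) \<partial>?\<sigma>)"
          using AE_sphere_measure_norm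
        proof eventually_elim
          case (elim \<omega>)
          have "K (s *\<^sub>R \<zeta>) = K ((s * norm \<zeta>) *\<^sub>R \<omega>)"
            by (rule K_cong) (use elim in \<open>simp add: abs_mult\<close>)
          then show ?case by (simp add: K_def inner_commute)
        qed
      qed (simp_all add: K_def)
    qed
  qed (simp_all add: K_def)
  also have "\<dots> = (\<integral>p. (\<integral>\<theta>. F (fst p *\<^sub>R snd p) * cis (- (fst p * norm \<zeta>) * (snd p \<bullet> \<theta>)) \<partial>?\<sigma>) \<partial>(?\<rho> \<Otimes>\<^sub>M ?\<sigma>))"
    using PS.integrable_fst'[OF int3]
    by (subst polar_pair.integral_fst'[symmetric]) auto
  also have "\<dots> = (\<integral>\<theta>. (\<integral>p. F (fst p *\<^sub>R snd p) * cis (- (fst p * norm \<zeta>) * (snd p \<bullet> \<theta>)) \<partial>(?\<rho> \<Otimes>\<^sub>M ?\<sigma>)) \<partial>?\<sigma>)"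
    using int3 by (subst PS.Fubini_integral[symmetric]) auto
  also have "\<dots> = (\<integral>\<theta>. fourier F (norm \<zeta> *\<^sub>R \<theta>) \<partial>?\<sigma>)"
  proof (rule Bochner_Integration.integral_cong[OF refl])
    fix \<theta> :: 'a
    have "fourier F (norm \<zeta> *\<^sub>R \<theta>) = (\<integral>p. (\<lambda>q. cis (- (q \<bullet> (norm \<zeta> *\<^sub>R \<theta>))) * F q) (case p of (s, \<omega>) \<Rightarrow> s *\<^sub>R \<omega>) \<partial>(?\<rho> \<Otimes>\<^sub>M ?\<sigma>))"
      unfolding fourier_def by (subst lborel_polar, subst integral_distr) auto
    then show "(\<integral>p. F (fst p *\<^sub>R snd p) * cis (- (fst p * norm \<zeta>) * (snd p \<bullet> \<theta>)) \<partial>(?\<rho> \<Otimes>\<^sub>M ?\<sigma>)) = fourier F (norm \<zeta> *\<^sub>R \<theta>)"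
      by (simp add: split_beta' mult_ac)
  qed
  finally show ?thesis .
qed

section \<open>Gaussian kernels\<close>

text \<open>Up to normalisation this is the characteristic function of the standard normal
  distribution.\<close>

lemma integral_gauss_cis_real:
  fixes t :: real
  shows "(\<integral>x. of_real (exp (- x\<^sup>2 / 2)) * cis (x * t) \<partial>lborel) = of_real (sqrt (2 * pi) * exp (- t\<^sup>2 / 2))"
proof -
  have "of_real (exp (- t\<^sup>2 / 2)) = (\<integral>x. iexp (t * x) \<partial>std_normal_distribution)"
    using fun_cong[OF char_std_normal_distribution, of t] by (simp add: char_def)
  also have "\<dots> = (\<integral>x. std_normal_density x *\<^sub>R iexp (t * x) \<partial>lborel)"
    by (subst integral_density) auto
  also have "\<dots> = (\<integral>x. of_real (1 / sqrt (2 * pi)) * (of_real (exp (- x\<^sup>2 / 2)) * cis (x * t)) \<partial>lborel)"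
    by (simp add: std_normal_density_def scaleR_conv_of_real cis_conv_exp mult_ac)
  also have "\<dots> = of_real (1 / sqrt (2 * pi)) * (\<integral>x. of_real (exp (- x\<^sup>2 / 2)) * cis (x * t) \<partial>lborel)"
    by (rule integral_mult_right_zero)
  finally show ?thesis by (simp add: field_simps)
qed

lemma integrable_gauss_real: "integrable lborel (\<lambda>x::real. exp (- x\<^sup>2 / 2))"
proof -
  have "integrable lborel (\<lambda>x. sqrt (2 * pi) * std_normal_density x)"
    by (intro integrable_mult_right integrable_normal_density) auto
  then show ?thesis by (simp add: std_normal_density_def)
qed

lemma prod_cis: "(\<Prod>b\<in>A. cis (f b)) = cis (\<Sum>b\<in>A. f b)"
  by (induction A rule: infinite_finite_induct) (auto simp: cis_mult)

lemma prod_exp_gauss: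
  "(\<Prod>b\<in>Basis. exp (- (x \<bullet> b)\<^sup>2 / 2)) = exp (- (norm (x :: 'a::euclidean_space))\<^sup>2 / 2)"
proof -
  have "(norm x)\<^sup>2 = (\<Sum>b\<in>Basis. (x \<bullet> b)\<^sup>2)"
    unfolding power2_norm_eq_inner euclidean_inner[of x x] by (simp add: power2_eq_square)
  then have "- (norm x)\<^sup>2 / 2 = (\<Sum>b\<in>Basis. - (x \<bullet> b)\<^sup>2 / 2)"
    by (simp only: sum_negf sum_divide_distrib[symmetric])
  then show ?thesis by (simp only: exp_sum[OF finite_Basis])
qed

interpretation lborel_prod_real: product_sigma_finite "\<lambda>_. lborel :: real measure" ..

text \<open>Both the Gaussian and the exponential factor over the coordinates, and
  \<open>lborel\<close> is the image of a product of one-dimensional Lebesgue measures.\<close>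

lemma
  fixes v :: "'a::euclidean_space"
  shows integral_gauss_cis:
      "(\<integral>x. of_real (exp (- (norm x)\<^sup>2 / 2)) * cis (x \<bullet> v) \<partial>lborel) =
        of_real (sqrt (2 * pi) ^ DIM('a) * exp (- (norm v)\<^sup>2 / 2))"
    and integrable_gauss_cis: "integrable lborel (\<lambda>x. of_real (exp (- (norm x)\<^sup>2 / 2)) * cis (x \<bullet> v))"
proof -
  define h where "h = (\<lambda>(b::'a) (x::real). of_real (exp (- x\<^sup>2 / 2)) * cis (x * (v \<bullet> b)))"
  have prod: "(\<Prod>b\<in>Basis. h b (x \<bullet> b)) = of_real (exp (- (norm x)\<^sup>2 / 2)) * cis (x \<bullet> v)" for x
  proof -
    have "(\<Prod>b\<in>Basis. cis ((x \<bullet> b) * (v \<bullet> b))) = cis (x \<bullet> v)"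
      by (subst euclidean_inner[of x v]) (rule prod_cis)
    moreover have "(\<Prod>b\<in>Basis. complex_of_real (exp (- (x \<bullet> b)\<^sup>2 / 2))) = of_real (exp (- (norm x)\<^sup>2 / 2))"
      by (simp only: of_real_prod[symmetric] prod_exp_gauss)
    ultimately show ?thesis by (simp add: h_def prod.distrib)
  qed
  have [measurable]: "h b \<in> borel_measurable borel" for b unfolding h_def by measurable
  have int: "integrable lborel (h b)" for b
    by (rule Bochner_Integration.integrable_bound[OF integrable_gauss_real]) (auto simp: h_def norm_mult)
  have coord: "(\<Sum>b'\<in>Basis. f b' *\<^sub>R b') \<bullet> b = f b" if "b \<in> Basis" for f :: "'a \<Rightarrow> real" and b
    using that by simp
  have *: "(\<Prod>b\<in>Basis. h b ((\<Sum>b'\<in>Basis. f b' *\<^sub>R b') \<bullet> b)) = (\<Prod>b\<in>Basis. h b (f b))" for f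
    by (rule prod.cong) (simp_all del: inner_sum_left add: coord)
  have "integrable (Pi\<^sub>M Basis (\<lambda>_::'a. lborel)) (\<lambda>f. \<Prod>b\<in>Basis. h b (f b))"
    by (rule lborel_prod_real.product_integrable_prod) (auto intro: int)
  then have "integrable (lborel :: 'a measure) (\<lambda>x. \<Prod>b\<in>Basis. h b (x \<bullet> b))"
    by (subst lborel_eq, subst integrable_distr_eq) (simp_all add: * del: inner_sum_left)
  then show "integrable lborel (\<lambda>x. of_real (exp (- (norm x)\<^sup>2 / 2)) * cis (x \<bullet> v))"
    by (simp add: prod)
  have "(\<integral>x. (\<Prod>b\<in>Basis. h b (x \<bullet> b)) \<partial>(lborel :: 'a measure)) = (\<integral>f. (\<Prod>b\<in>Basis. h b (f b)) \<partial>Pi\<^sub>M Basis (\<lambda>_::'a. lborel))"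
    by (subst lborel_eq, subst integral_distr) (simp_all add: * del: inner_sum_left)
  also have "\<dots> = (\<Prod>b\<in>Basis. integral\<^sup>L lborel (h b))"
    by (rule lborel_prod_real.product_integral_prod) (auto intro: int)
  also have "\<dots> = (\<Prod>b\<in>Basis. of_real (sqrt (2 * pi) * exp (- (v \<bullet> b)\<^sup>2 / 2)))"
    by (simp only: h_def integral_gauss_cis_real)
  also have "\<dots> = of_real (sqrt (2 * pi) ^ DIM('a) * exp (- (norm v)\<^sup>2 / 2))"
    by (simp only: of_real_prod[symmetric] prod.distrib prod_exp_gauss prod_constant)
  finally show "(\<integral>x. of_real (exp (- (norm x)\<^sup>2 / 2)) * cis (x \<bullet> v) \<partial>lborel) =
      of_real (sqrt (2 * pi) ^ DIM('a) * exp (- (norm v)\<^sup>2 / 2))"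
    by (simp add: prod)
qed

lemma integrable_gauss: "integrable lborel (\<lambda>x::'a::euclidean_space. exp (- (norm x)\<^sup>2 / 2))"
  using integrable_norm[OF integrable_gauss_cis[of "0::'a"]] by simp

lemma integral_gauss: "(\<integral>x. exp (- (norm x)\<^sup>2 / 2) \<partial>(lborel :: 'a::euclidean_space measure)) = sqrt (2 * pi) ^ DIM('a)"
proof -
  have "complex_of_real (\<integral>x. exp (- (norm x)\<^sup>2 / 2) \<partial>(lborel :: 'a measure)) = of_real (sqrt (2 * pi) ^ DIM('a))"
    using integral_gauss_cis[of "0::'a"] by simp
  then show ?thesis by (simp only: of_real_eq_iff)
qed

text \<open>The transform of the cutoff \<open>exp (- (\<epsilon> * norm z)\<^sup>2 / 2)\<close>.
  Its total mass is \<open>(2 * pi) ^ DIM('a)\<close> for every positive \<open>\<epsilon>\<close>,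
  so it approximates that multiple of a Dirac mass.\<close>

definition gauss_kernel :: "real \<Rightarrow> 'a::euclidean_space \<Rightarrow> real" where
  "gauss_kernel \<epsilon> v = (sqrt (2 * pi) / \<epsilon>) ^ DIM('a) * exp (- (norm v / \<epsilon>)\<^sup>2 / 2)"

lemma gauss_kernel_measurable [measurable]: "gauss_kernel \<epsilon> \<in> borel_measurable borel"
  unfolding gauss_kernel_def by measurable

lemma gauss_kernel_nonneg: "0 < \<epsilon> \<Longrightarrow> 0 \<le> gauss_kernel \<epsilon> v"
  by (simp add: gauss_kernel_def)

lemma gauss_kernel_le: "0 < \<epsilon> \<Longrightarrow> gauss_kernel \<epsilon> (v :: 'a::euclidean_space) \<le> (sqrt (2 * pi) / \<epsilon>) ^ DIM('a)"
  by (simp add: gauss_kernel_def mult_left_le)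

lemma integral_gauss_kernel_cis:
  fixes v :: "'a::euclidean_space"
  assumes "\<epsilon> > 0"
  shows "(\<integral>z. of_real (exp (- (\<epsilon> * norm z)\<^sup>2 / 2)) * cis (z \<bullet> v) \<partial>lborel) = of_real (gauss_kernel \<epsilon> v)"
proof -
  have "(\<integral>z. of_real (exp (- (\<epsilon> * norm z)\<^sup>2 / 2)) * cis (z \<bullet> v) \<partial>lborel) =
     (\<bar>1 / \<epsilon>\<bar> ^ DIM('a)) *\<^sub>R (\<integral>z. of_real (exp (- (\<epsilon> * norm ((1 / \<epsilon>) *\<^sub>R z))\<^sup>2 / 2)) * cis (((1 / \<epsilon>) *\<^sub>R z) \<bullet> v) \<partial>lborel)"
    by (rule integral_lborel_scale) (use assms in auto)
  also have "\<dots> = (\<bar>1 / \<epsilon>\<bar> ^ DIM('a)) *\<^sub>R (\<integral>z. of_real (exp (- (norm z)\<^sup>2 / 2)) * cis (z \<bullet> (v /\<^sub>R \<epsilon>)) \<partial>lborel)"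
    using assms by (simp add: inverse_eq_divide)
  also have "\<dots> = of_real (gauss_kernel \<epsilon> v)"
  proof -
    have norm: "norm (v /\<^sub>R \<epsilon>) = norm v / \<epsilon>" using assms by (simp add: inverse_eq_divide)
    show ?thesis
      unfolding integral_gauss_cis norm gauss_kernel_def scaleR_conv_of_real of_real_mult[symmetric]
      using assms by (simp add: power_divide)
  qed
  finally show ?thesis .
qed

lemma integrable_gauss_scaled:
  assumes "\<epsilon> > 0"
  shows "integrable lborel (\<lambda>x::'a::euclidean_space. exp (- (\<epsilon> * norm x)\<^sup>2 / 2))"
proof -
  have "integrable (density (distr lborel borel (\<lambda>x. 0 + (1 / \<epsilon>) *\<^sub>R x)) (\<lambda>_. \<bar>1 / \<epsilon>\<bar> ^ DIM('a))) (\<lambda>x::'a. exp (- (\<epsilon> * norm x)\<^sup>2 / 2))"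
    using assms integrable_gauss[where 'a='a]
    by (subst integrable_density) (auto simp: integrable_distr_eq)
  then show ?thesis
    by (subst lborel_affine[of "1 / \<epsilon>" 0]) (use assms in simp_all)
qed

lemma integral_times_gauss_kernel:
  fixes H :: "'a::euclidean_space \<Rightarrow> complex"
  assumes [measurable]: "H \<in> borel_measurable borel" and "\<epsilon> > 0"
  shows "(\<integral>x. H x * of_real (gauss_kernel \<epsilon> (a - x)) \<partial>lborel) =
    (\<integral>u. H (a + \<epsilon> *\<^sub>R u) * of_real (gauss_kernel 1 u) \<partial>lborel)"
proof -
  have "(\<integral>x. H x * of_real (gauss_kernel \<epsilon> (a - x)) \<partial>lborel) = (\<integral>x. H (a + x) * of_real (gauss_kernel \<epsilon> (a - (a + x))) \<partial>lborel)"
    by (rule integral_lborel_translate[symmetric]) simp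
  also have "\<dots> = (\<bar>\<epsilon>\<bar> ^ DIM('a)) *\<^sub>R (\<integral>u. H (a + \<epsilon> *\<^sub>R u) * of_real (gauss_kernel \<epsilon> (a - (a + \<epsilon> *\<^sub>R u))) \<partial>lborel)"
    using assms(2) by (intro integral_lborel_scale) auto
  also have "\<dots> = (\<integral>u. (\<bar>\<epsilon>\<bar> ^ DIM('a)) *\<^sub>R (H (a + \<epsilon> *\<^sub>R u) * of_real (gauss_kernel \<epsilon> (a - (a + \<epsilon> *\<^sub>R u)))) \<partial>lborel)"
    by simp
  also have "\<dots> = (\<integral>u. H (a + \<epsilon> *\<^sub>R u) * of_real (gauss_kernel 1 u) \<partial>lborel)"
    using assms(2) by (intro Bochner_Integration.integral_cong refl)
      (simp add: gauss_kernel_def scaleR_conv_of_real power_divide)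
  finally show ?thesis .
qed

lemma
  shows integrable_gauss_kernel_1: "integrable lborel (gauss_kernel 1 :: 'a::euclidean_space \<Rightarrow> real)"
    and integral_gauss_kernel_1: "(\<integral>u. gauss_kernel 1 u \<partial>(lborel :: 'a measure)) = (2 * pi) ^ DIM('a)"
proof -
  have eq: "gauss_kernel 1 = (\<lambda>u::'a. sqrt (2 * pi) ^ DIM('a) * exp (- (norm u)\<^sup>2 / 2))"
    by (auto simp: gauss_kernel_def)
  show "integrable lborel (gauss_kernel 1 :: 'a \<Rightarrow> real)"
    unfolding eq by (intro integrable_mult_right integrable_gauss)
  show "(\<integral>u. gauss_kernel 1 u \<partial>(lborel :: 'a measure)) = (2 * pi) ^ DIM('a)"
  proof -
    have "(sqrt (2 * pi) * sqrt (2 * pi)) ^ DIM('a) = (2 * pi) ^ DIM('a)"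
      unfolding real_sqrt_mult_self by simp
    then show ?thesis
      unfolding eq by (simp only: integral_mult_right_zero integral_gauss power_mult_distrib)
  qed
qed

text \<open>After rescaling, the kernel is fixed and only the argument of \<open>H\<close> moves, so
  \<open>B * gauss_kernel 1\<close> dominates for all \<open>k\<close>. It serves both Fourier
  inversion and the concentration of the cut-off z-integral.\<close>

lemma gauss_kernel_approx_identity:
  fixes H :: "'a::euclidean_space \<Rightarrow> complex"
  assumes [measurable]: "H \<in> borel_measurable borel" and B: "\<And>x. norm (H x) \<le> B" and cont: "isCont H a"
  shows "(\<lambda>k. \<integral>x. H x * of_real (gauss_kernel (inverse (real (Suc k))) (a - x)) \<partial>lborel)
      \<longlonglongrightarrow> of_real ((2 * pi) ^ DIM('a)) * H a"
proof -
  have "(\<lambda>k. \<integral>u. H (a + inverse (real (Suc k)) *\<^sub>R u) * of_real (gauss_kernel 1 u) \<partial>lborel) \<longlonglongrightarrow>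
      (\<integral>u. H a * of_real (gauss_kernel 1 (u::'a)) \<partial>lborel)"
  proof (rule integral_dominated_convergence[where w = "\<lambda>u. B * gauss_kernel 1 u"])
    show "integrable lborel (\<lambda>u::'a. B * gauss_kernel 1 u)"
      by (intro integrable_mult_right integrable_gauss_kernel_1)
    show "AE u in lborel. (\<lambda>k. H (a + inverse (real (Suc k)) *\<^sub>R u) * of_real (gauss_kernel 1 u)) \<longlonglongrightarrow> H a * of_real (gauss_kernel 1 u)"
    proof (rule AE_I2)
      fix u :: 'a
      have "(\<lambda>k. a + inverse (real (Suc k)) *\<^sub>R u) \<longlonglongrightarrow> a + 0 *\<^sub>R u"
        by (intro tendsto_intros LIMSEQ_inverse_real_of_nat)
      then have "(\<lambda>k. H (a + inverse (real (Suc k)) *\<^sub>R u)) \<longlonglongrightarrow> H a"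
        using isCont_tendsto_compose[OF cont] by simp
      then show "(\<lambda>k. H (a + inverse (real (Suc k)) *\<^sub>R u) * of_real (gauss_kernel 1 u)) \<longlonglongrightarrow> H a * of_real (gauss_kernel 1 u)"
        by (intro tendsto_intros)
    qed
    show "AE u in lborel. norm (H (a + inverse (real (Suc k)) *\<^sub>R u) * of_real (gauss_kernel 1 u)) \<le> B * gauss_kernel 1 u" for k
      by (auto simp: norm_mult gauss_kernel_nonneg intro!: mult_right_mono B)
  qed measurable
  moreover have "(\<integral>u. H a * of_real (gauss_kernel 1 (u::'a)) \<partial>lborel) = of_real ((2 * pi) ^ DIM('a)) * H a"
    by (simp add: integral_gauss_kernel_1 mult.commute)
  moreover have "(\<integral>x. H x * of_real (gauss_kernel (inverse (real (Suc k))) (a - x)) \<partial>lborel) =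
      (\<integral>u. H (a + inverse (real (Suc k)) *\<^sub>R u) * of_real (gauss_kernel 1 u) \<partial>lborel)" for k
    by (rule integral_times_gauss_kernel) simp_all
  ultimately show ?thesis by (simp only:)
qed

text \<open>The bound is uniform in \<open>\<epsilon>\<close> and in the centre; it supplies the
  dominating function when the cutoff is removed at the end.\<close>

lemma norm_integral_times_gauss_kernel_le:
  fixes H :: "'a::euclidean_space \<Rightarrow> complex"
  assumes [measurable]: "H \<in> borel_measurable borel" and B: "\<And>x. norm (H x) \<le> B" and "\<epsilon> > 0"
  shows "norm (\<integral>x. H x * of_real (gauss_kernel \<epsilon> (a - x)) \<partial>lborel) \<le> B * (2 * pi) ^ DIM('a)"
proof -
  have le: "norm (H (a + \<epsilon> *\<^sub>R u) * of_real (gauss_kernel 1 u)) \<le> B * gauss_kernel 1 u" for u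
    by (auto simp: norm_mult gauss_kernel_nonneg intro!: mult_right_mono B)
  have int: "integrable lborel (\<lambda>u::'a. B * gauss_kernel 1 u)"
    by (intro integrable_mult_right integrable_gauss_kernel_1)
  have "norm (\<integral>u. H (a + \<epsilon> *\<^sub>R u) * of_real (gauss_kernel 1 u) \<partial>lborel) \<le> (\<integral>u. B * gauss_kernel 1 (u::'a) \<partial>lborel)"
    using le by (intro Bochner_Integration.integral_norm_bound_integral int
      Bochner_Integration.integrable_bound[OF int]) (auto intro: order_trans[OF le abs_ge_self])
  then show ?thesis using assms(3) by (simp add: integral_times_gauss_kernel integral_gauss_kernel_1)
qed

section \<open>The Fourier transform\<close>

lemma fourier_measurable [measurable]:
  fixes \<phi> :: "'a::euclidean_space \<Rightarrow> complex"
  assumes [measurable]: "\<phi> \<in> borel_measurable borel"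
  shows "fourier \<phi> \<in> borel_measurable borel"
  unfolding fourier_def[abs_def] by measurable

lemma integrable_cis_mult:
  fixes G :: "'a::euclidean_space \<Rightarrow> complex"
  assumes "integrable lborel G"
  shows "integrable lborel (\<lambda>q. cis (- (q \<bullet> \<xi>)) * G q)"
  using assms by (rule Bochner_Integration.integrable_bound) (use assms in \<open>auto simp: norm_mult\<close>)

lemma norm_fourier_le:
  fixes G :: "'a::euclidean_space \<Rightarrow> complex"
  assumes "integrable lborel G"
  shows "norm (fourier G \<xi>) \<le> (\<integral>x. norm (G x) \<partial>lborel)"
  unfolding fourier_def
  by (rule order_trans[OF integral_norm_bound]) (simp add: norm_mult)

lemma fourier_translate:
  fixes G :: "'a::euclidean_space \<Rightarrow> complex"
  assumes [measurable]: "G \<in> borel_measurable borel"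
  shows "fourier (\<lambda>x. G (x + a)) \<xi> = cis (a \<bullet> \<xi>) * fourier G \<xi>"
proof -
  have "fourier G \<xi> = (\<integral>x. cis (- ((a + x) \<bullet> \<xi>)) * G (a + x) \<partial>lborel)"
    unfolding fourier_def by (rule integral_lborel_translate[symmetric]) measurable
  also have "\<dots> = (\<integral>x. cis (- (a \<bullet> \<xi>)) * (cis (- (x \<bullet> \<xi>)) * G (x + a)) \<partial>lborel)"
  proof (rule Bochner_Integration.integral_cong[OF refl])
    fix x
    have "cis (- ((a + x) \<bullet> \<xi>)) = cis (- (a \<bullet> \<xi>)) * cis (- (x \<bullet> \<xi>))"
      by (simp add: inner_add_left cis_mult)
    then show "cis (- ((a + x) \<bullet> \<xi>)) * G (a + x) = cis (- (a \<bullet> \<xi>)) * (cis (- (x \<bullet> \<xi>)) * G (x + a))"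
      by (simp add: add.commute)
  qed
  also have "\<dots> = cis (- (a \<bullet> \<xi>)) * fourier (\<lambda>x. G (x + a)) \<xi>"
    unfolding fourier_def by (rule integral_mult_right_zero)
  finally show ?thesis by (simp add: mult.assoc[symmetric] cis_mult)
qed

lemma fourier_multiplication_formula:
  fixes f g :: "'a::euclidean_space \<Rightarrow> complex"
  assumes f: "integrable lborel f" and g: "integrable lborel g"
  shows "(\<integral>x. f x * fourier g x \<partial>lborel) = (\<integral>x. fourier f x * g x \<partial>lborel)"
proof -
  have [measurable]: "f \<in> borel_measurable borel" "g \<in> borel_measurable borel" using f g by auto
  have "integrable (lborel \<Otimes>\<^sub>M lborel) (\<lambda>(x, y). f x * g y * cis (- (x \<bullet> y)))"
    by (rule lborel_pair.integrable_pair_bound[OF integrable_norm[OF f] integrable_norm[OF g]]) (auto simp: norm_mult)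
  then have "(\<integral>y. (\<integral>x. f x * g y * cis (- (x \<bullet> y)) \<partial>lborel) \<partial>lborel) = (\<integral>x. (\<integral>y. f x * g y * cis (- (x \<bullet> y)) \<partial>lborel) \<partial>lborel)"
    by (rule lborel_pair.Fubini_integral)
  moreover have "(\<integral>y. f x * g y * cis (- (x \<bullet> y)) \<partial>lborel) = f x * fourier g x" for x
    unfolding fourier_def by (subst integral_mult_right_zero[symmetric]) (simp add: mult_ac inner_commute)
  moreover have "(\<integral>x. f x * g y * cis (- (x \<bullet> y)) \<partial>lborel) = fourier f y * g y" for y
    unfolding fourier_def by (subst integral_mult_left_zero[symmetric]) (simp add: mult_ac inner_commute)
  ultimately show ?thesis by simp
qed

lemma gauss_cutoff_LIMSEQ:
  fixes h :: "'a::euclidean_space \<Rightarrow> complex"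
  assumes h: "integrable lborel h"
  shows "(\<lambda>k. \<integral>z. of_real (exp (- (inverse (real (Suc k)) * norm z)\<^sup>2 / 2)) * h z \<partial>lborel) \<longlonglongrightarrow> (\<integral>z. h z \<partial>lborel)"
proof (rule integral_dominated_convergence[OF _ _ integrable_norm[OF h]])
  have [measurable]: "h \<in> borel_measurable borel" using h by auto
  show "AE z in lborel. (\<lambda>k. of_real (exp (- (inverse (real (Suc k)) * norm z)\<^sup>2 / 2)) * h z) \<longlonglongrightarrow> h z"
  proof (rule AE_I2)
    fix z :: 'a
    have "(\<lambda>k. of_real (exp (- (inverse (real (Suc k)) * norm z)\<^sup>2 / 2)) * h z) \<longlonglongrightarrow>
        of_real (exp (- (0 * norm z)\<^sup>2 / 2)) * h z"
      by (intro tendsto_intros LIMSEQ_inverse_real_of_nat) auto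
    then show "(\<lambda>k. of_real (exp (- (inverse (real (Suc k)) * norm z)\<^sup>2 / 2)) * h z) \<longlonglongrightarrow> h z" by simp
  qed
qed (use h in \<open>auto simp: norm_mult mult_left_le_one_le\<close>)

text \<open>The cut-off integral has two limits. Directly, dominated convergence removes the cutoff;
  alternatively, the multiplication formula moves the transform from \<open>\<phi>\<close> onto the
  cutoff and yields a Gaussian kernel concentrating at \<open>\<zeta>\<close>.\<close>

lemma fourier_inversion:
  fixes \<phi> :: "'a::euclidean_space \<Rightarrow> complex"
  assumes \<phi>: "integrable lborel \<phi>" and B: "\<And>x. norm (\<phi> x) \<le> B" and cont: "isCont \<phi> \<zeta>"
    and \<phi>': "integrable lborel (fourier \<phi>)"
  shows "(\<integral>p. cis (p \<bullet> \<zeta>) * fourier \<phi> p \<partial>lborel) = of_real ((2 * pi) ^ DIM('a)) * \<phi> \<zeta>"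
proof (rule LIMSEQ_unique)
  have [measurable]: "\<phi> \<in> borel_measurable borel" using \<phi> by auto
  define e where "e = (\<lambda>k::nat. \<lambda>p::'a. complex_of_real (exp (- (inverse (real (Suc k)) * norm p)\<^sup>2 / 2)))"
  have [measurable]: "e k \<in> borel_measurable borel" for k unfolding e_def by measurable
  have "integrable lborel (\<lambda>p. cis (p \<bullet> \<zeta>) * fourier \<phi> p)"
    using integrable_cis_mult[OF \<phi>', of "- \<zeta>"] by simp
  from gauss_cutoff_LIMSEQ[OF this]
  show "(\<lambda>k. \<integral>p. e k p * cis (p \<bullet> \<zeta>) * fourier \<phi> p \<partial>lborel) \<longlonglongrightarrow> (\<integral>p. cis (p \<bullet> \<zeta>) * fourier \<phi> p \<partial>lborel)"
    by (simp only: e_def mult.assoc)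
  have "(\<integral>p. e k p * cis (p \<bullet> \<zeta>) * fourier \<phi> p \<partial>lborel) =
      (\<integral>x. \<phi> x * of_real (gauss_kernel (inverse (real (Suc k))) (\<zeta> - x)) \<partial>lborel)" for k
  proof -
    have e: "integrable lborel (\<lambda>p. e k p * cis (p \<bullet> \<zeta>))"
      by (rule Bochner_Integration.integrable_bound[OF integrable_gauss_scaled[of "inverse (real (Suc k))"]])
         (auto simp: e_def norm_mult)
    have "fourier (\<lambda>p. e k p * cis (p \<bullet> \<zeta>)) x = of_real (gauss_kernel (inverse (real (Suc k))) (\<zeta> - x))" for x
    proof -
      have "fourier (\<lambda>p. e k p * cis (p \<bullet> \<zeta>)) x = (\<integral>p. e k p * cis (p \<bullet> (\<zeta> - x)) \<partial>lborel)"
        unfolding fourier_def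
        by (simp add: inner_diff_right mult.left_commute cis_mult)
      also have "\<dots> = of_real (gauss_kernel (inverse (real (Suc k))) (\<zeta> - x))"
        unfolding e_def by (rule integral_gauss_kernel_cis) simp
      finally show ?thesis .
    qed
    with fourier_multiplication_formula[OF e \<phi>] show ?thesis by (simp add: mult.commute)
  qed
  moreover have "(\<lambda>k. \<integral>x. \<phi> x * of_real (gauss_kernel (inverse (real (Suc k))) (\<zeta> - x)) \<partial>lborel)
      \<longlonglongrightarrow> of_real ((2 * pi) ^ DIM('a)) * \<phi> \<zeta>"
    by (rule gauss_kernel_approx_identity[OF _ B cont]) simp
  ultimately show "(\<lambda>k. \<integral>p. e k p * cis (p \<bullet> \<zeta>) * fourier \<phi> p \<partial>lborel) \<longlonglongrightarrow> of_real ((2 * pi) ^ DIM('a)) * \<phi> \<zeta>"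
    by simp
qed

text \<open>Derivatives are turned into limits along a sequence, the form in which dominated
  convergence applies.\<close>

lemma has_vector_derivative_LIMSEQ:
  fixes g :: "real \<Rightarrow> 'b::real_normed_vector"
  assumes "(g has_vector_derivative g') (at 0)"
  shows "(\<lambda>k. (g (inverse (real (Suc k))) - g 0) /\<^sub>R inverse (real (Suc k))) \<longlonglongrightarrow> g'"
proof -
  define t where "t = (\<lambda>k. inverse (real (Suc k)))"
  have t: "t k > 0" for k by (simp add: t_def)
  have "((\<lambda>h. norm (g (0 + h) - g 0 - h *\<^sub>R g') / norm h) \<longlongrightarrow> 0) (at 0)"
    using assms by (simp add: has_vector_derivative_def has_derivative_at)
  moreover have "filterlim t (at 0) sequentially"
    unfolding t_def by (rule filterlim_atI[OF LIMSEQ_inverse_real_of_nat]) simp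
  ultimately have "(\<lambda>k. norm (g (0 + t k) - g 0 - t k *\<^sub>R g') / norm (t k)) \<longlonglongrightarrow> 0"
    by (rule filterlim_compose)
  moreover have "norm (g (0 + t k) - g 0 - t k *\<^sub>R g') / norm (t k) = norm ((g (t k) - g 0) /\<^sub>R t k - g')" for k
  proof -
    have "(g (t k) - g 0) /\<^sub>R t k - g' = (g (0 + t k) - g 0 - t k *\<^sub>R g') /\<^sub>R t k"
      using t[of k] by (simp add: scaleR_diff_right)
    then show ?thesis by (simp only: norm_scaleR real_norm_def abs_inverse divide_inverse_commute)
  qed
  ultimately have "(\<lambda>k. (g (t k) - g 0) /\<^sub>R t k - g') \<longlonglongrightarrow> 0"
    by (simp only: tendsto_norm_zero_iff)
  then show ?thesis unfolding t_def by (rule LIM_zero_cancel)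
qed

text \<open>Difference quotients are dominated by \<open>D\<close>, so integrability and transforms
  pass to the limit; the transform of a difference quotient is
  \<open>(cis (t * (\<zeta> \<bullet> b)) - 1) / t\<close> times that of \<open>u\<close>. The
  derivative is required only almost everywhere because the lemma is applied to a function radial
  about a centre, where it need not be differentiable.\<close>

lemma
  fixes u u' :: "'a::euclidean_space \<Rightarrow> complex"
  assumes u: "integrable lborel u" and [measurable]: "u' \<in> borel_measurable borel"
    and D: "integrable lborel D"
    and bound: "\<And>p t. 0 \<le> t \<Longrightarrow> t \<le> 1 \<Longrightarrow> norm (u (p + t *\<^sub>R b) - u p) \<le> t * D p"
    and deriv: "AE p in lborel. ((\<lambda>t. u (p + t *\<^sub>R b)) has_vector_derivative u' p) (at 0)"
  shows integrable_directional_derivative: "integrable lborel u'"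
    and fourier_directional_derivative: "fourier u' \<zeta> = \<i> * of_real (\<zeta> \<bullet> b) * fourier u \<zeta>"
proof -
  have [measurable]: "u \<in> borel_measurable borel" "D \<in> borel_measurable borel" using u D by auto
  define t where "t = (\<lambda>k. inverse (real (Suc k)))"
  have t: "0 < t k" "t k \<le> 1" for k by (auto simp: t_def field_simps)
  define q where "q = (\<lambda>k p. (u (p + t k *\<^sub>R b) - u p) /\<^sub>R t k)"
  have [measurable]: "q k \<in> borel_measurable borel" for k unfolding q_def by measurable
  have q: "AE p in lborel. (\<lambda>k. q k p) \<longlonglongrightarrow> u' p"
    using deriv
  proof eventually_elim
    case (elim p)
    show ?case using has_vector_derivative_LIMSEQ[OF elim] by (simp add: q_def t_def)
  qed
  have q_le: "norm (q k p) \<le> D p" for k p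
  proof -
    have "norm (q k p) = norm (u (p + t k *\<^sub>R b) - u p) / t k"
      using t(1)[of k] by (simp add: q_def divide_inverse_commute)
    then show ?thesis using bound[of "t k" p] t[of k] by (simp add: pos_divide_le_eq mult.commute)
  qed
  show "integrable lborel u'"
    by (rule integrable_dominated_convergence[OF _ _ D q]) (simp_all add: q_le)
  have "(\<lambda>k. fourier (q k) \<zeta>) \<longlonglongrightarrow> fourier u' \<zeta>"
    unfolding fourier_def
  proof (rule integral_dominated_convergence[OF _ _ D])
    show "AE p in lborel. (\<lambda>k. cis (- (p \<bullet> \<zeta>)) * q k p) \<longlonglongrightarrow> cis (- (p \<bullet> \<zeta>)) * u' p"
      using q by eventually_elim (intro tendsto_intros)
  qed (simp_all add: norm_mult q_le)
  moreover have "fourier (q k) \<zeta> = ((cis (t k * (\<zeta> \<bullet> b)) - cis (0 * (\<zeta> \<bullet> b))) /\<^sub>R t k) * fourier u \<zeta>" for k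
  proof -
    have ut: "integrable lborel (\<lambda>p. u (p + t k *\<^sub>R b))"
      using integrable_lborel_translate[OF u, of "t k *\<^sub>R b"] by (simp add: add.commute)
    have "fourier (q k) \<zeta> = (\<integral>p. (cis (- (p \<bullet> \<zeta>)) * u (p + t k *\<^sub>R b) - cis (- (p \<bullet> \<zeta>)) * u p) /\<^sub>R t k \<partial>lborel)"
      by (simp add: fourier_def q_def algebra_simps)
    also have "\<dots> = (fourier (\<lambda>p. u (p + t k *\<^sub>R b)) \<zeta> - fourier u \<zeta>) /\<^sub>R t k"
      unfolding fourier_def integral_scaleR_right
      by (subst Bochner_Integration.integral_diff[OF integrable_cis_mult[OF ut] integrable_cis_mult[OF u]]) simp
    also have "\<dots> = ((cis (t k * (\<zeta> \<bullet> b)) - cis (0 * (\<zeta> \<bullet> b))) /\<^sub>R t k) * fourier u \<zeta>"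
      by (simp add: fourier_translate inner_commute scaleR_conv_of_real algebra_simps)
    finally show ?thesis .
  qed
  moreover have "(\<lambda>k. ((cis (t k * (\<zeta> \<bullet> b)) - cis (0 * (\<zeta> \<bullet> b))) /\<^sub>R t k) * fourier u \<zeta>) \<longlonglongrightarrow> (\<i> * of_real (\<zeta> \<bullet> b)) * fourier u \<zeta>"
  proof (intro tendsto_mult tendsto_const)
    have "((\<lambda>t. cis (t * (\<zeta> \<bullet> b))) has_vector_derivative (\<zeta> \<bullet> b) *\<^sub>R (\<i> * cis (0 * (\<zeta> \<bullet> b)))) (at 0)"
      by (auto intro!: derivative_eq_intros simp: has_vector_derivative_def)
    from has_vector_derivative_LIMSEQ[OF this]
    show "(\<lambda>k. (cis (t k * (\<zeta> \<bullet> b)) - cis (0 * (\<zeta> \<bullet> b))) /\<^sub>R t k) \<longlonglongrightarrow> \<i> * of_real (\<zeta> \<bullet> b)"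
      by (simp add: t_def scaleR_conv_of_real mult.commute)
  qed
  ultimately show "fourier u' \<zeta> = \<i> * of_real (\<zeta> \<bullet> b) * fourier u \<zeta>"
    by (simp add: LIMSEQ_unique)
qed

section \<open>Schwartz functions and tempered distributions\<close>

lemma norm_diff_le_of_vector_derivative_bound:
  fixes g :: "real \<Rightarrow> 'b::real_normed_vector"
  assumes "\<And>s. 0 \<le> s \<Longrightarrow> s \<le> t \<Longrightarrow> (g has_vector_derivative g' s) (at s)"
    and "\<And>s. 0 \<le> s \<Longrightarrow> s \<le> t \<Longrightarrow> norm (g' s) \<le> B" and "0 \<le> t"
  shows "norm (g t - g 0) \<le> t * B"
proof -
  have "norm (g t - g 0) \<le> B * norm (t - 0)"
  proof (rule differentiable_bound[where S = "{0..t}" and f' = "\<lambda>s h. h *\<^sub>R g' s"])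
    show "(g has_derivative (\<lambda>h. h *\<^sub>R g' s)) (at s within {0..t})" if "s \<in> {0..t}" for s
      using assms(1)[of s] that by (auto simp: has_vector_derivative_def has_derivative_at_withinI)
    show "onorm (\<lambda>h. h *\<^sub>R g' s) \<le> B" if "s \<in> {0..t}" for s
      using assms(2)[of s] that by (intro onorm_le) (auto simp: mult.commute[of B] intro!: mult_left_mono)
  qed (use assms(3) in auto)
  then show ?thesis using assms(3) by (simp add: mult.commute)
qed

lemma smooth_continuous_on:
  fixes \<phi> :: "'a::euclidean_space \<Rightarrow> 'b::real_normed_vector"
  assumes "smooth \<phi>" "set vs \<subseteq> Basis"
  shows "continuous_on A (iter_deriv vs \<phi>)"
  using assms unfolding smooth_def
  by (intro continuous_at_imp_continuous_on ballI differentiable_imp_continuous_within) auto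

lemma smooth_measurable:
  fixes \<phi> :: "'a::euclidean_space \<Rightarrow> complex"
  assumes "smooth \<phi>" "set vs \<subseteq> Basis"
  shows "iter_deriv vs \<phi> \<in> borel_measurable borel"
  by (intro borel_measurable_continuous_onI smooth_continuous_on assms)

lemma smooth_has_derivative:
  fixes \<phi> :: "'a::euclidean_space \<Rightarrow> 'b::real_normed_vector"
  assumes "smooth \<phi>" "set vs \<subseteq> Basis"
  shows "(iter_deriv vs \<phi> has_derivative (\<lambda>v. \<Sum>b\<in>Basis. (v \<bullet> b) *\<^sub>R iter_deriv (b # vs) \<phi> x)) (at x)"
proof -
  have d: "(iter_deriv vs \<phi> has_derivative frechet_derivative (iter_deriv vs \<phi>) (at x)) (at x)"
    using assms by (simp add: smooth_def frechet_derivative_works[symmetric])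
  then interpret bounded_linear "frechet_derivative (iter_deriv vs \<phi>) (at x)"
    by (rule has_derivative_bounded_linear)
  have "frechet_derivative (iter_deriv vs \<phi>) (at x) v = (\<Sum>b\<in>Basis. (v \<bullet> b) *\<^sub>R iter_deriv (b # vs) \<phi> x)" for v
  proof -
    have "frechet_derivative (iter_deriv vs \<phi>) (at x) v =
        frechet_derivative (iter_deriv vs \<phi>) (at x) (\<Sum>b\<in>Basis. (v \<bullet> b) *\<^sub>R b)"
      by (simp only: euclidean_representation)
    also have "\<dots> = (\<Sum>b\<in>Basis. (v \<bullet> b) *\<^sub>R iter_deriv (b # vs) \<phi> x)"
      by (simp only: sum scaleR iter_deriv.simps)
    finally show ?thesis .
  qed
  with d show ?thesis by (metis (no_types, lifting) ext)
qed

lemma smooth_has_vector_derivative_line: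
  fixes \<phi> :: "'a::euclidean_space \<Rightarrow> 'b::real_normed_vector"
  assumes "smooth \<phi>" "set vs \<subseteq> Basis"
  shows "((\<lambda>t. iter_deriv vs \<phi> (p + t *\<^sub>R v)) has_vector_derivative
      (\<Sum>b\<in>Basis. (v \<bullet> b) *\<^sub>R iter_deriv (b # vs) \<phi> (p + t *\<^sub>R v))) (at t)"
proof -
  have "((\<lambda>t. p + t *\<^sub>R v) has_derivative (\<lambda>h. h *\<^sub>R v)) (at t)"
    by (auto intro!: derivative_eq_intros)
  from has_derivative_compose[OF this smooth_has_derivative[OF assms]]
  show ?thesis
    by (simp add: has_vector_derivative_def scaleR_sum_right)
qed

lemma smooth_has_vector_derivative_basis:
  fixes \<phi> :: "'a::euclidean_space \<Rightarrow> 'b::real_normed_vector"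
  assumes "smooth \<phi>" "set vs \<subseteq> Basis" "b \<in> Basis"
  shows "((\<lambda>t. iter_deriv vs \<phi> (p + t *\<^sub>R b)) has_vector_derivative iter_deriv (b # vs) \<phi> (p + t *\<^sub>R b)) (at t)"
proof -
  have "(\<Sum>b'\<in>Basis. (b \<bullet> b') *\<^sub>R iter_deriv (b' # vs) \<phi> (p + t *\<^sub>R b)) = iter_deriv (b # vs) \<phi> (p + t *\<^sub>R b)"
    using assms(3) by (simp add: inner_Basis if_distrib[of "\<lambda>x. x *\<^sub>R _"] sum.delta cong: if_cong)
  with smooth_has_vector_derivative_line[OF assms(1,2), of p b t] show ?thesis by simp
qed

lemma schwartz_smooth: "\<phi> \<in> schwartz \<Longrightarrow> smooth \<phi>"
  by (simp add: schwartz_def)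

lemma schwartz_decay:
  assumes "\<phi> \<in> schwartz" "set vs \<subseteq> Basis"
  obtains C where "C \<ge> 0" "\<And>x. norm (iter_deriv vs \<phi> x) \<le> C / (1 + norm x) ^ N"
proof -
  have "bounded (range (\<lambda>x. (1 + norm x) ^ N * norm (iter_deriv vs \<phi> x)))"
    using assms by (simp add: schwartz_def)
  then obtain C where C: "\<And>x. \<bar>(1 + norm x) ^ N * norm (iter_deriv vs \<phi> x)\<bar> \<le> C"
    by (auto simp: bounded_iff)
  have "C \<ge> 0" using C[of undefined] by linarith
  moreover have "norm (iter_deriv vs \<phi> x) \<le> C / (1 + norm x) ^ N" for x
    using C[of x] by (simp add: pos_le_divide_eq add_pos_nonneg mult.commute)
  ultimately show ?thesis using that by blast
qed

lemma integrable_decay: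
  "integrable lborel (\<lambda>x::'a::euclidean_space. C / (1 + norm x) ^ (DIM('a) + 1))"
  using integrable_mult_right[OF integrable_norm_power_decay[where k = 0 and 'a = 'a], of C] by simp

lemma integrable_of_decay:
  fixes F :: "'a::euclidean_space \<Rightarrow> complex"
  assumes "F \<in> borel_measurable borel" and F: "\<And>x. norm (F x) \<le> C / (1 + norm x) ^ (DIM('a) + 1)"
  shows "integrable lborel F"
  using assms(1) by (intro integrable_of_norm_le[OF integrable_decay[of C]] F) simp

lemma norm_of_real_weight: "norm (complex_of_real ((1 + norm x) ^ k)) = (1 + norm x) ^ k"
  by (simp only: norm_of_real abs_of_nonneg zero_le_power add_nonneg_nonneg norm_ge_zero zero_le_one)

lemma schwartz_integrable:
  fixes \<phi> :: "'a::euclidean_space \<Rightarrow> complex"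
  assumes "\<phi> \<in> schwartz" "set vs \<subseteq> Basis"
  shows "integrable lborel (iter_deriv vs \<phi>)"
proof -
  obtain C where C: "C \<ge> 0" "\<And>x. norm (iter_deriv vs \<phi> x) \<le> C / (1 + norm x) ^ (DIM('a) + 1)"
    using schwartz_decay[OF assms] by blast
  show ?thesis
    by (rule integrable_of_decay[OF smooth_measurable[OF schwartz_smooth] C(2)]) fact+
qed

lemma fourier_iter_deriv:
  fixes \<phi> :: "'a::euclidean_space \<Rightarrow> complex"
  assumes \<phi>: "\<phi> \<in> schwartz" and vs: "set vs \<subseteq> Basis" and b: "b \<in> Basis"
  shows "fourier (iter_deriv (b # vs) \<phi>) \<zeta> = \<i> * of_real (\<zeta> \<bullet> b) * fourier (iter_deriv vs \<phi>) \<zeta>"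
proof -
  let ?N = "DIM('a) + 1"
  have bvs: "set (b # vs) \<subseteq> Basis" using vs b by simp
  obtain C where C: "C \<ge> 0" "\<And>x. norm (iter_deriv (b # vs) \<phi> x) \<le> C / (1 + norm x) ^ ?N"
    using schwartz_decay[OF \<phi> bvs] by blast
  note d = smooth_has_vector_derivative_basis[OF schwartz_smooth[OF \<phi>] vs b]
  show ?thesis
  proof (rule fourier_directional_derivative[OF schwartz_integrable[OF \<phi> vs]])
    show "integrable lborel (\<lambda>x::'a. (2 ^ ?N * C) / (1 + norm x) ^ ?N)"
      by (rule integrable_decay)
    show "norm (iter_deriv vs \<phi> (p + t *\<^sub>R b) - iter_deriv vs \<phi> p) \<le> t * ((2 ^ ?N * C) / (1 + norm p) ^ ?N)"
      if t: "0 \<le> t" "t \<le> 1" for p t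
    proof -
      have "norm (iter_deriv (b # vs) \<phi> (p + s *\<^sub>R b)) \<le> (2 ^ ?N * C) / (1 + norm p) ^ ?N" if "0 \<le> s" "s \<le> t" for s
      proof -
        have "norm p \<le> norm (p + s *\<^sub>R b) + norm (s *\<^sub>R b)"
          using norm_triangle_ineq4[of "p + s *\<^sub>R b" "s *\<^sub>R b"] by simp
        moreover have "norm (s *\<^sub>R b) \<le> 1" using that t b by simp
        \<comment> \<open>A displacement of length at most 1 changes \<open>1 + norm p\<close> by a
          factor of at most 2; this is the origin of \<open>2 ^ ?N\<close> in the dominating
          function.\<close>
        ultimately have le: "1 + norm p \<le> 2 * (1 + norm (p + s *\<^sub>R b))"
          using norm_ge_zero[of "p + s *\<^sub>R b"] unfolding distrib_left by linarith
        have "(1 + norm p) ^ ?N \<le> (2 * (1 + norm (p + s *\<^sub>R b))) ^ ?N"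
          by (rule power_mono[OF le]) simp
        then have *: "C * (1 + norm p) ^ ?N \<le> C * (2 ^ ?N * (1 + norm (p + s *\<^sub>R b)) ^ ?N)"
          using C(1) by (intro mult_left_mono) (simp only: power_mult_distrib)
        have "C / (1 + norm (p + s *\<^sub>R b)) ^ ?N \<le> (2 ^ ?N * C) / (1 + norm p) ^ ?N"
        proof -
          have X: "(1 + norm (p + s *\<^sub>R b)) ^ ?N > 0" and Y: "(1 + norm p) ^ ?N > 0"
            by (intro zero_less_power add_pos_nonneg; simp)+
          have frac: "c / x \<le> d / y" if "c * y \<le> d * x" "x > 0" "y > 0" for c d x y :: real
            using that by (simp add: divide_simps)
          show ?thesis by (rule frac[OF _ X Y]) (use * in \<open>simp only: mult_ac\<close>)
        qed
        with C(2)[of "p + s *\<^sub>R b"] show ?thesis by linarith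
      qed
      from norm_diff_le_of_vector_derivative_bound[OF d this t(1)] show ?thesis by simp
    qed
    show "AE p in lborel. ((\<lambda>t. iter_deriv vs \<phi> (p + t *\<^sub>R b)) has_vector_derivative iter_deriv (b # vs) \<phi> p) (at 0)"
      using d[where t = 0] by simp
  qed (rule smooth_measurable[OF schwartz_smooth[OF \<phi>] bvs])
qed

text \<open>Differentiating \<open>M\<close> times in the direction \<open>b\<close> multiplies the
  transform by \<open>(\<i> * (\<zeta> \<bullet> b)) ^ M\<close>. At each \<open>\<zeta>\<close> the
  largest coordinate is used, which controls \<open>norm \<zeta>\<close> up to the
  dimension.\<close>

lemma fourier_schwartz_decay:
  fixes \<phi> :: "'a::euclidean_space \<Rightarrow> complex"
  assumes \<phi>: "\<phi> \<in> schwartz"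
  obtains C where "C \<ge> 0" "\<And>\<zeta>. norm (fourier \<phi> \<zeta>) \<le> C / (1 + norm \<zeta>) ^ M"
proof -
  have rep: "set (replicate k b) \<subseteq> Basis" if "b \<in> Basis" for k and b :: 'a using that by auto
  have pow: "fourier (iter_deriv (replicate k b) \<phi>) \<zeta> = (\<i> * of_real (\<zeta> \<bullet> b)) ^ k * fourier \<phi> \<zeta>" if "b \<in> Basis" for k b \<zeta>
    by (induction k) (simp_all del: iter_deriv.simps(2) add: fourier_iter_deriv[OF \<phi> rep[OF that] that])
  define A where "A = (\<lambda>b. \<integral>x. norm (iter_deriv (replicate M b) \<phi> x) \<partial>lborel)"
  define A0 where "A0 = (\<integral>x. norm (\<phi> x) \<partial>lborel)"
  have A: "\<bar>\<zeta> \<bullet> b\<bar> ^ M * norm (fourier \<phi> \<zeta>) \<le> A b" if "b \<in> Basis" for b \<zeta>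
    using norm_fourier_le[OF schwartz_integrable[OF \<phi> rep[OF that, of M]], of \<zeta>]
    by (simp add: pow[OF that] A_def norm_mult norm_power)
  have A0: "norm (fourier \<phi> \<zeta>) \<le> A0" for \<zeta>
    using norm_fourier_le[OF schwartz_integrable[OF \<phi>, of "[]"], of \<zeta>] by (simp add: A0_def)
  have nonneg: "A b \<ge> 0" "A0 \<ge> 0" for b by (simp_all add: A_def A0_def)
  \<comment> \<open>From \<open>1 + norm \<zeta> \<le> (DIM('a) + 1) * max 1 \<bar>\<zeta> \<bullet>
    b\<bar>\<close> for the largest coordinate \<open>b\<close>. The sum over the basis in
    \<open>C\<close> is there because that coordinate depends on \<open>\<zeta>\<close>.\<close>
  define K where "K = real (DIM('a) + 1) ^ M"
  define C where "C = K * (A0 + (\<Sum>b\<in>Basis. A b))"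
  have C: "C \<ge> 0" by (auto simp: C_def K_def nonneg intro!: mult_nonneg_nonneg add_nonneg_nonneg sum_nonneg)
  have "(1 + norm \<zeta>) ^ M * norm (fourier \<phi> \<zeta>) \<le> C" for \<zeta>
  proof -
    obtain b where b: "b \<in> Basis" "\<And>b'. b' \<in> Basis \<Longrightarrow> \<bar>\<zeta> \<bullet> b'\<bar> \<le> \<bar>\<zeta> \<bullet> b\<bar>"
      using Max_in[of "(\<lambda>b. \<bar>\<zeta> \<bullet> b\<bar>) ` Basis"] Max_ge[of "(\<lambda>b. \<bar>\<zeta> \<bullet> b\<bar>) ` Basis"] by fastforce
    have "norm \<zeta> \<le> (\<Sum>b\<in>Basis. \<bar>\<zeta> \<bullet> b\<bar>)" by (rule norm_le_l1)
    also have "\<dots> \<le> of_nat DIM('a) * \<bar>\<zeta> \<bullet> b\<bar>" by (rule sum_bounded_above) (use b in auto)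
    also have "\<dots> \<le> of_nat DIM('a) * max 1 \<bar>\<zeta> \<bullet> b\<bar>" by (rule mult_left_mono) auto
    finally have "1 + norm \<zeta> \<le> real (DIM('a) + 1) * max 1 \<bar>\<zeta> \<bullet> b\<bar>" by (simp add: algebra_simps)
    then have "(1 + norm \<zeta>) ^ M \<le> (real (DIM('a) + 1) * max 1 \<bar>\<zeta> \<bullet> b\<bar>) ^ M" by (rule power_mono) simp
    also have "\<dots> = K * (max 1 \<bar>\<zeta> \<bullet> b\<bar>) ^ M" unfolding K_def by (rule power_mult_distrib)
    finally have "(1 + norm \<zeta>) ^ M * norm (fourier \<phi> \<zeta>) \<le> K * (max 1 \<bar>\<zeta> \<bullet> b\<bar>) ^ M * norm (fourier \<phi> \<zeta>)"
      by (rule mult_right_mono) simp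
    also have "\<dots> = K * ((max 1 \<bar>\<zeta> \<bullet> b\<bar>) ^ M * norm (fourier \<phi> \<zeta>))" by simp
    also have "\<dots> \<le> K * (A0 + A b)"
    proof (rule mult_left_mono)
      show "(max 1 \<bar>\<zeta> \<bullet> b\<bar>) ^ M * norm (fourier \<phi> \<zeta>) \<le> A0 + A b"
        using A[OF b(1), of \<zeta>] A0[of \<zeta>] nonneg(1)[of b] nonneg(2) by (cases "\<bar>\<zeta> \<bullet> b\<bar> \<le> 1") (auto simp: max_def)
    qed (simp add: K_def)
    also have "\<dots> \<le> C"
      unfolding C_def using b(1) nonneg by (intro mult_left_mono add_left_mono member_le_sum) (auto simp: K_def)
    finally show ?thesis .
  qed
  then have "norm (fourier \<phi> \<zeta>) \<le> C / (1 + norm \<zeta>) ^ M" for \<zeta>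
    by (simp add: pos_le_divide_eq add_pos_nonneg mult.commute)
  with C show ?thesis using that by blast
qed

lemma integrable_fourier_schwartz:
  fixes \<phi> :: "'a::euclidean_space \<Rightarrow> complex"
  assumes "\<phi> \<in> schwartz"
  shows "integrable lborel (fourier \<phi>)"
proof -
  obtain C where C: "C \<ge> 0" "\<And>\<zeta>. norm (fourier \<phi> \<zeta>) \<le> C / (1 + norm \<zeta>) ^ (DIM('a) + 1)"
    using fourier_schwartz_decay[OF assms] by blast
  have "fourier \<phi> \<in> borel_measurable borel"
    using smooth_measurable[OF schwartz_smooth[OF assms], of "[]"] by simp
  then show ?thesis using C(2) by (rule integrable_of_decay)
qed

section \<open>Tempered functions as distributions\<close>

lemma tempered_functionI:
  fixes F :: "'a::euclidean_space \<Rightarrow> complex"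
  assumes [measurable]: "F \<in> borel_measurable borel" and F: "\<And>x. norm (F x) \<le> C * (1 + norm x) ^ K"
  shows "tempered_function F"
  unfolding tempered_function_def
proof (intro conjI exI)
  show "integrable lborel (\<lambda>x. F x / of_real ((1 + norm x) ^ (K + (DIM('a) + 1))))"
  proof (rule integrable_of_norm_le[OF integrable_decay[of C]])
    fix x :: 'a
    have pos: "1 + norm x > 0" by (simp add: add_pos_nonneg)
    have "norm (F x / of_real ((1 + norm x) ^ (K + (DIM('a) + 1)))) = norm (F x) / (1 + norm x) ^ (K + (DIM('a) + 1))"
      by (simp only: norm_divide norm_of_real_weight)
    also have "\<dots> \<le> C * (1 + norm x) ^ K / (1 + norm x) ^ (K + (DIM('a) + 1))"
      by (rule divide_right_mono[OF F]) (use pos in simp)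
    also have "\<dots> = C / (1 + norm x) ^ (DIM('a) + 1)"
      using pos unfolding power_add by (simp del: power_Suc add: add_nonneg_eq_0_iff)
    finally show "norm (F x / of_real ((1 + norm x) ^ (K + (DIM('a) + 1)))) \<le> C / (1 + norm x) ^ (DIM('a) + 1)" .
  qed simp
qed simp

text \<open>The supremum bounds its members only if the set is bounded above. The Schwartz condition
  gives one bound per list of directions, and there are finitely many lists of length at most
  \<open>N\<close> over the basis.\<close>

lemma norm_le_schwartz_norm:
  fixes \<phi> :: "'a::euclidean_space \<Rightarrow> complex"
  assumes \<phi>: "\<phi> \<in> schwartz"
  shows "(1 + norm x) ^ N * norm (\<phi> x) \<le> schwartz_norm N \<phi>"
proof -
  let ?I = "{vs::'a list. set vs \<subseteq> Basis \<and> length vs \<le> N}"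
  let ?h = "\<lambda>(vs, x::'a). (1 + norm x) ^ N * norm (iter_deriv vs \<phi> x)"
  have "finite ?I" by (rule finite_lists_length_le) simp
  have "\<forall>vs\<in>?I. \<exists>C. \<forall>x. (1 + norm x) ^ N * norm (iter_deriv vs \<phi> x) \<le> C"
  proof
    fix vs assume "vs \<in> ?I"
    then have "bounded (range (\<lambda>x. (1 + norm x) ^ N * norm (iter_deriv vs \<phi> x)))"
      using \<phi> by (simp add: schwartz_def)
    then show "\<exists>C. \<forall>x. (1 + norm x) ^ N * norm (iter_deriv vs \<phi> x) \<le> C"
      by (fastforce simp: bounded_iff dest: abs_le_D1)
  qed
  then obtain C where C: "\<And>vs x. vs \<in> ?I \<Longrightarrow> (1 + norm x) ^ N * norm (iter_deriv vs \<phi> x) \<le> C vs" by metis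
  have "bdd_above (?h ` (?I \<times> UNIV))"
  proof (rule bdd_aboveI2[of _ _ "Max (C ` ?I)"])
    fix p :: "'a list \<times> 'a" assume "p \<in> ?I \<times> UNIV"
    then obtain vs y where p: "p = (vs, y)" "vs \<in> ?I" by blast
    then have "?h p \<le> C vs" using C by simp
    also have "\<dots> \<le> Max (C ` ?I)" using \<open>finite ?I\<close> p(2) by (intro Max_ge) auto
    finally show "?h p \<le> Max (C ` ?I)" .
  qed
  from cSUP_upper[OF _ this, of "([], x)"] show ?thesis
    unfolding schwartz_norm_def by simp
qed

lemma tempered_function_integrable:
  fixes F :: "'a::euclidean_space \<Rightarrow> complex"
  assumes F: "tempered_function F" and [measurable]: "\<phi> \<in> borel_measurable borel"
    and \<phi>: "\<And>N. \<exists>C. \<forall>x. (1 + norm x) ^ N * norm (\<phi> x) \<le> C"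
  shows "integrable lborel (\<lambda>x. F x * \<phi> x)"
proof -
  obtain N where N: "integrable lborel (\<lambda>x. F x / of_real ((1 + norm x) ^ N))"
    using F by (auto simp: tempered_function_def)
  have [measurable]: "F \<in> borel_measurable borel" using F by (simp add: tempered_function_def)
  obtain C where C: "\<And>x. (1 + norm x) ^ N * norm (\<phi> x) \<le> C" using \<phi> by blast
  show ?thesis
  proof (rule integrable_of_norm_le[OF integrable_mult_right[OF integrable_norm[OF N], of C]])
    fix x :: 'a
    have pos: "(1 + norm x) ^ N > 0" by (simp add: add_pos_nonneg)
    then have "norm (F x * \<phi> x) = norm (F x / of_real ((1 + norm x) ^ N)) * ((1 + norm x) ^ N * norm (\<phi> x))"
      unfolding norm_divide norm_of_real_weight norm_mult by (metis less_irrefl nonzero_eq_divide_eq mult.assoc)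
    also have "\<dots> \<le> norm (F x / of_real ((1 + norm x) ^ N)) * C"
      by (intro mult_left_mono C) simp
    finally show "norm (F x * \<phi> x) \<le> C * norm (F x / of_real ((1 + norm x) ^ N))"
      by (simp only: mult.commute)
  qed simp
qed

lemma tempered_function_schwartz_integrable:
  assumes "tempered_function F" and \<phi>: "\<phi> \<in> schwartz"
  shows "integrable lborel (\<lambda>x. F x * \<phi> x)"
  using assms(1)
proof (rule tempered_function_integrable)
  show "\<phi> \<in> borel_measurable borel" using smooth_measurable[OF schwartz_smooth[OF \<phi>], of "[]"] by simp
  show "\<exists>C. \<forall>x. (1 + norm x) ^ N * norm (\<phi> x) \<le> C" for N using norm_le_schwartz_norm[OF \<phi>] by blast
qed

lemma tempered_distribution_distr_of_fun:
  assumes F: "tempered_function F"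
  shows "tempered_distribution (distr_of_fun F)"
  unfolding tempered_distribution_def
proof (intro conjI ballI allI)
  note int = tempered_function_schwartz_integrable[OF F]
  show "distr_of_fun F (\<lambda>x. \<phi> x + \<psi> x) = distr_of_fun F \<phi> + distr_of_fun F \<psi>" if "\<phi> \<in> schwartz" "\<psi> \<in> schwartz" for \<phi> \<psi>
    using int[OF that(1)] int[OF that(2)] by (simp add: distr_of_fun_def distrib_left)
  show "distr_of_fun F (\<lambda>x. c * \<phi> x) = c * distr_of_fun F \<phi>" for c \<phi>
    by (simp add: distr_of_fun_def mult.left_commute)
  obtain N where N: "integrable lborel (\<lambda>x. F x / of_real ((1 + norm x) ^ N))"
    using F by (auto simp: tempered_function_def)
  show "\<exists>C N. \<forall>\<phi>\<in>schwartz. norm (distr_of_fun F \<phi>) \<le> C * schwartz_norm N \<phi>"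
  proof (intro exI ballI)
    fix \<phi> :: "'a \<Rightarrow> complex" assume \<phi>: "\<phi> \<in> schwartz"
    have "norm (distr_of_fun F \<phi>) \<le> (\<integral>x. norm (F x / of_real ((1 + norm x) ^ N)) * schwartz_norm N \<phi> \<partial>lborel)"
      unfolding distr_of_fun_def
    proof (rule Bochner_Integration.integral_norm_bound_integral[OF int[OF \<phi>]])
      fix x :: 'a
      have pos: "(1 + norm x) ^ N > 0" by (simp add: add_pos_nonneg)
      then have "norm (F x * \<phi> x) = norm (F x / of_real ((1 + norm x) ^ N)) * ((1 + norm x) ^ N * norm (\<phi> x))"
        unfolding norm_divide norm_of_real_weight norm_mult by (metis less_irrefl nonzero_eq_divide_eq mult.assoc)
      also have "\<dots> \<le> norm (F x / of_real ((1 + norm x) ^ N)) * schwartz_norm N \<phi>"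
        by (intro mult_left_mono norm_le_schwartz_norm \<phi>) simp
      finally show "norm (F x * \<phi> x) \<le> norm (F x / of_real ((1 + norm x) ^ N)) * schwartz_norm N \<phi>" .
    qed (intro integrable_mult_left integrable_norm N)
    then show "norm (distr_of_fun F \<phi>) \<le> (\<integral>x. norm (F x / of_real ((1 + norm x) ^ N)) \<partial>lborel) * schwartz_norm N \<phi>"
      by simp
  qed
qed

lemma iter_deriv_eq_0:
  assumes "open U" "\<And>x. x \<in> U \<Longrightarrow> \<phi> x = 0" "x \<in> U"
  shows "iter_deriv vs \<phi> x = 0"
  using assms(3)
proof (induction vs arbitrary: x)
  case (Cons v vs)
  have "(iter_deriv vs \<phi> has_derivative (\<lambda>_. 0)) (at x)"
    by (rule has_derivative_transform_within_open[OF has_derivative_const assms(1) Cons.prems, of 0]) (simp add: Cons.IH)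
  then have "frechet_derivative (iter_deriv vs \<phi>) (at x) = (\<lambda>_. 0)"
    by (rule frechet_derivative_at[symmetric])
  then show ?case by simp
qed (use assms(2) in simp)

lemma smooth_compact_support_schwartz:
  fixes \<phi> :: "'a::euclidean_space \<Rightarrow> complex"
  assumes \<phi>: "smooth \<phi>" and K: "compact (closure {p. \<phi> p \<noteq> 0})"
  shows "\<phi> \<in> schwartz"
  unfolding schwartz_def
proof (intro CollectI conjI \<phi> allI impI)
  fix vs :: "'a list" and N assume vs: "set vs \<subseteq> Basis"
  let ?h = "\<lambda>x. (1 + norm x) ^ N * norm (iter_deriv vs \<phi> x)"
  let ?K = "closure {p. \<phi> p \<noteq> 0}"
  have "bounded (?h ` ?K)"
    by (intro compact_imp_bounded compact_continuous_image continuous_intros smooth_continuous_on \<phi> vs K)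
  then have "bounded (insert 0 (?h ` ?K))" by simp
  moreover have "range ?h \<subseteq> insert 0 (?h ` ?K)"
  proof
    fix y assume "y \<in> range ?h"
    then obtain x where x: "y = ?h x" by blast
    show "y \<in> insert 0 (?h ` ?K)"
    proof (cases "x \<in> ?K")
      case False
      then have "iter_deriv vs \<phi> x = 0"
        by (intro iter_deriv_eq_0[of "- ?K"]) (use closure_subset[of "{p. \<phi> p \<noteq> 0}"] in auto)
      then show ?thesis using x by simp
    qed (use x in blast)
  qed
  ultimately show "bounded (range ?h)" by (rule bounded_subset)
qed

section \<open>Spherical means of test functions\<close>

locale test_function =
  fixes f :: "'a::euclidean_space \<Rightarrow> complex" and \<rho> :: real
  assumes schwartz: "f \<in> schwartz" and support: "\<And>p. norm p > \<rho> \<Longrightarrow> f p = 0" and \<rho>_nonneg: "\<rho> \<ge> 0"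
begin

definition dir_deriv :: "'a \<Rightarrow> 'a \<Rightarrow> complex" where
  "dir_deriv p v = (\<Sum>b\<in>Basis. (v \<bullet> b) *\<^sub>R iter_deriv [b] f p)"

text \<open>Without division by the sphere area, which then enters only once, when the
  backprojection is expressed by these integrals. The centre may be any point of the space.\<close>

definition sphere_int :: "'a \<Rightarrow> real \<Rightarrow> complex" where
  "sphere_int p r = (\<integral>\<omega>. f (p + r *\<^sub>R \<omega>) \<partial>sphere_measure)"

definition sphere_int_deriv :: "'a \<Rightarrow> real \<Rightarrow> complex" where
  "sphere_int_deriv p r = (\<integral>\<omega>. dir_deriv (p + r *\<^sub>R \<omega>) \<omega> \<partial>sphere_measure)"

lemmas smooth = schwartz_smooth[OF schwartz]

lemma f_measurable [measurable]: "f \<in> borel_measurable borel"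
  using smooth_measurable[OF smooth, of "[]"] by simp

lemma dir_deriv_measurable [measurable]: "(\<lambda>x. dir_deriv (fst x) (snd x)) \<in> borel_measurable (borel \<Otimes>\<^sub>M borel)"
proof -
  have [measurable]: "iter_deriv [b] f \<in> borel_measurable borel" if "b \<in> Basis" for b
    using smooth_measurable[OF smooth, of "[b]"] that by simp
  show ?thesis unfolding dir_deriv_def by measurable
qed

lemma dir_deriv_measurable_compose [measurable (raw)]:
  assumes "u \<in> M \<rightarrow>\<^sub>M borel" "v \<in> M \<rightarrow>\<^sub>M borel"
  shows "(\<lambda>x. dir_deriv (u x) (v x)) \<in> borel_measurable M"
  using measurable_compose[OF measurable_Pair[OF assms] dir_deriv_measurable] by simp

lemma sphere_int_measurable [measurable (raw)]:
  assumes [measurable]: "u \<in> M \<rightarrow>\<^sub>M borel" "v \<in> borel_measurable M"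
  shows "(\<lambda>x. sphere_int (u x) (v x)) \<in> borel_measurable M"
  unfolding sphere_int_def by measurable

lemma sphere_int_deriv_measurable [measurable (raw)]:
  assumes [measurable]: "u \<in> M \<rightarrow>\<^sub>M borel" "v \<in> borel_measurable M"
  shows "(\<lambda>x. sphere_int_deriv (u x) (v x)) \<in> borel_measurable M"
  unfolding sphere_int_deriv_def by measurable

lemma f_integrable: "integrable lborel f"
  using schwartz_integrable[OF schwartz, of "[]"] by simp

lemma f_bounded: obtains B where "B \<ge> 0" "\<And>p. norm (f p) \<le> B"
  using schwartz_decay[OF schwartz, of "[]" 0] by auto

lemma dir_deriv_bounded: obtains L where "L \<ge> 0" "\<And>p v. norm (dir_deriv p v) \<le> L * norm v"
proof -
  have "\<forall>b\<in>Basis. \<exists>C. C \<ge> 0 \<and> (\<forall>p. norm (iter_deriv [b] f p) \<le> C)"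
  proof
    fix b :: 'a assume "b \<in> Basis"
    then obtain C where "C \<ge> 0" "\<And>p. norm (iter_deriv [b] f p) \<le> C / (1 + norm p) ^ 0"
      using schwartz_decay[OF schwartz, of "[b]" 0] by (metis empty_subsetI insert_subset list.set)
    then show "\<exists>C. C \<ge> 0 \<and> (\<forall>p. norm (iter_deriv [b] f p) \<le> C)" by auto
  qed
  then obtain C where C: "\<And>b. b \<in> Basis \<Longrightarrow> C b \<ge> 0" "\<And>b p. b \<in> Basis \<Longrightarrow> norm (iter_deriv [b] f p) \<le> C b"
    by metis
  show ?thesis
  proof
    show "(\<Sum>b\<in>Basis. C b) \<ge> 0" using C(1) by (rule sum_nonneg)
    show "norm (dir_deriv p v) \<le> (\<Sum>b\<in>Basis. C b) * norm v" for p v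
      unfolding dir_deriv_def sum_distrib_right
    proof (rule sum_norm_le)
      fix b :: 'a assume b: "b \<in> Basis"
      have "norm ((v \<bullet> b) *\<^sub>R iter_deriv [b] f p) = \<bar>v \<bullet> b\<bar> * norm (iter_deriv [b] f p)" by simp
      also have "\<dots> \<le> norm v * C b"
        using b C Basis_le_norm[OF b, of v] by (intro mult_mono) auto
      finally show "norm ((v \<bullet> b) *\<^sub>R iter_deriv [b] f p) \<le> C b * norm v" by (simp add: mult.commute)
    qed
  qed
qed

lemma dir_deriv_support:
  assumes "norm p > \<rho>"
  shows "dir_deriv p v = 0"
proof -
  have "iter_deriv [b] f p = 0" for b
    by (rule iter_deriv_eq_0[of "{p. norm p > \<rho>}"])
       (use assms support in \<open>auto intro!: open_Collect_less continuous_intros\<close>)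
  then show ?thesis unfolding dir_deriv_def by simp
qed

lemma f_line: "((\<lambda>t. f (p + t *\<^sub>R v)) has_vector_derivative dir_deriv (p + t *\<^sub>R v) v) (at t)"
  using smooth_has_vector_derivative_line[OF smooth, of "[]" p v t] by (simp add: dir_deriv_def)

lemma f_lipschitz: obtains L where "L \<ge> 0" "\<And>p v. norm (f (p + v) - f p) \<le> L * norm v"
proof -
  obtain L where L: "L \<ge> 0" "\<And>p v. norm (dir_deriv p v) \<le> L * norm v" by (rule dir_deriv_bounded) (rule that)
  have "norm (f (p + v) - f p) \<le> L * norm v" for p v
    using norm_diff_le_of_vector_derivative_bound[of 1 "\<lambda>t. f (p + t *\<^sub>R v)", OF f_line L(2)] by simp
  with L show ?thesis using that by blast
qed

lemma integrable_f_sphere: "integrable sphere_measure (\<lambda>\<omega>. f (p + r *\<^sub>R \<omega>))"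
proof -
  obtain B where "B \<ge> 0" "\<And>p. norm (f p) \<le> B" by (rule f_bounded) (rule that)
  then show ?thesis by (intro sphere_measure.integrable_const_bound[of _ B]) auto
qed

lemma integrable_dir_deriv_sphere: "integrable sphere_measure (\<lambda>\<omega>. dir_deriv (p + r *\<^sub>R \<omega>) \<omega>)"
proof -
  obtain L where L0: "L \<ge> 0" and L: "\<And>p v. norm (dir_deriv p v) \<le> L * norm v" by (rule dir_deriv_bounded) (rule that)
  show ?thesis
  proof (rule sphere_measure.integrable_const_bound[of _ L])
    show "AE \<omega> in sphere_measure. norm (dir_deriv (p + r *\<^sub>R \<omega>) \<omega>) \<le> L"
      using AE_sphere_measure_norm
    proof eventually_elim
      case (elim \<omega>)
      show ?case using L[of "p + r *\<^sub>R \<omega>" \<omega>] elim by simp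
    qed
  qed measurable
qed

text \<open>Differentiation under the integral sign: on the unit sphere the normalised remainders
  are bounded by a Lipschitz constant of \<open>f\<close> plus a bound of its directional
  derivatives.\<close>

lemma sphere_int_has_vector_derivative: "(sphere_int p has_vector_derivative sphere_int_deriv p r) (at r)"
proof -
  obtain L where L: "L \<ge> 0" "\<And>p v. norm (dir_deriv p v) \<le> L * norm v" by (rule dir_deriv_bounded) (rule that)
  obtain L' where L': "L' \<ge> 0" "\<And>p v. norm (f (p + v) - f p) \<le> L' * norm v" by (rule f_lipschitz) (rule that)
  have "(\<lambda>h. norm (sphere_int p (r + h) - sphere_int p r - h *\<^sub>R sphere_int_deriv p r) / norm h) \<midarrow>0\<rightarrow> 0"
    unfolding LIMSEQ_SEQ_conv[symmetric]
  proof (intro allI impI)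
    fix h :: "nat \<Rightarrow> real" assume h: "(\<forall>k. h k \<noteq> 0) \<and> h \<longlonglongrightarrow> 0"
    define e where "e = (\<lambda>k \<omega>. (f (p + (r + h k) *\<^sub>R \<omega>) - f (p + r *\<^sub>R \<omega>) - h k *\<^sub>R dir_deriv (p + r *\<^sub>R \<omega>) \<omega>) /\<^sub>R norm (h k))"
    have [measurable]: "e k \<in> borel_measurable borel" for k unfolding e_def by measurable
    have "(\<lambda>k. \<integral>\<omega>. e k \<omega> \<partial>sphere_measure) \<longlonglongrightarrow> (\<integral>\<omega>. 0 \<partial>(sphere_measure :: 'a measure))"
    proof (rule integral_dominated_convergence[where w = "\<lambda>_. L' + L"])
      show "AE \<omega> in sphere_measure. (\<lambda>k. e k \<omega>) \<longlonglongrightarrow> 0"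
      proof (rule AE_I2)
        fix \<omega> :: 'a
        have "(\<lambda>h. norm (f (p + (r + h) *\<^sub>R \<omega>) - f (p + r *\<^sub>R \<omega>) - h *\<^sub>R dir_deriv (p + r *\<^sub>R \<omega>) \<omega>) / norm h) \<midarrow>0\<rightarrow> 0"
          using f_line[of p \<omega> r] by (simp add: has_vector_derivative_def has_derivative_at)
        then have "(\<lambda>k. norm (f (p + (r + h k) *\<^sub>R \<omega>) - f (p + r *\<^sub>R \<omega>) - h k *\<^sub>R dir_deriv (p + r *\<^sub>R \<omega>) \<omega>) / norm (h k)) \<longlonglongrightarrow> 0"
          using h unfolding LIMSEQ_SEQ_conv[symmetric] by blast
        then have "(\<lambda>k. norm (e k \<omega>)) \<longlonglongrightarrow> 0"
          by (simp add: e_def divide_inverse_commute)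
        then show "(\<lambda>k. e k \<omega>) \<longlonglongrightarrow> 0" by (simp only: tendsto_norm_zero_iff)
      qed
      show "AE \<omega> in sphere_measure. norm (e k \<omega>) \<le> L' + L" for k
        using AE_sphere_measure_norm
      proof eventually_elim
        case (elim \<omega>)
        have hk: "\<bar>h k\<bar> > 0" using h by simp
        have "norm (f (p + (r + h k) *\<^sub>R \<omega>) - f (p + r *\<^sub>R \<omega>) - h k *\<^sub>R dir_deriv (p + r *\<^sub>R \<omega>) \<omega>) \<le>
            norm (f ((p + r *\<^sub>R \<omega>) + h k *\<^sub>R \<omega>) - f (p + r *\<^sub>R \<omega>)) + norm (h k *\<^sub>R dir_deriv (p + r *\<^sub>R \<omega>) \<omega>)"
          unfolding scaleR_add_left add.assoc by (rule norm_triangle_ineq4)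
        also have "\<dots> \<le> L' * norm (h k *\<^sub>R \<omega>) + \<bar>h k\<bar> * (L * norm \<omega>)"
          using L(2)[of "p + r *\<^sub>R \<omega>" \<omega>] by (intro add_mono L'(2)) (auto intro!: mult_left_mono)
        also have "\<dots> = (L' + L) * \<bar>h k\<bar>" using elim by (simp add: algebra_simps)
        finally show ?case using hk
          by (simp add: e_def divide_inverse_commute[symmetric] pos_divide_le_eq)
      qed
    qed simp_all
    then have "(\<lambda>k. norm (\<integral>\<omega>. e k \<omega> \<partial>sphere_measure)) \<longlonglongrightarrow> 0"
      by (simp add: tendsto_norm_zero_iff)
    moreover have "norm (\<integral>\<omega>. e k \<omega> \<partial>sphere_measure) = norm (sphere_int p (r + h k) - sphere_int p r - h k *\<^sub>R sphere_int_deriv p r) / norm (h k)" for k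
    proof -
      have "(\<integral>\<omega>. e k \<omega> \<partial>sphere_measure) = (sphere_int p (r + h k) - sphere_int p r - h k *\<^sub>R sphere_int_deriv p r) /\<^sub>R norm (h k)"
        by (simp add: e_def sphere_int_def sphere_int_deriv_def integrable_f_sphere integrable_dir_deriv_sphere)
      then show ?thesis by (simp add: divide_inverse_commute)
    qed
    ultimately show "(\<lambda>k. norm (sphere_int p (r + h k) - sphere_int p r - h k *\<^sub>R sphere_int_deriv p r) / norm (h k)) \<longlonglongrightarrow> 0" by simp
  qed
  then show ?thesis
    by (simp add: has_vector_derivative_def has_derivative_at bounded_linear_scaleR_left)
qed

lemma sphere_int_lipschitz: obtains L where "L \<ge> 0" "\<And>p r r'. norm (sphere_int p r - sphere_int p r') \<le> L * \<bar>r - r'\<bar>"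
proof -
  obtain L where L: "L \<ge> 0" "\<And>p v. norm (f (p + v) - f p) \<le> L * norm v" by (rule f_lipschitz) (rule that)
  let ?m = "measure (sphere_measure :: 'a measure) UNIV"
  have "norm (sphere_int p r - sphere_int p r') \<le> (L * ?m) * \<bar>r - r'\<bar>" for p r r'
  proof -
    have "norm (sphere_int p r - sphere_int p r') = norm (\<integral>\<omega>. f (p + r *\<^sub>R \<omega>) - f (p + r' *\<^sub>R \<omega>) \<partial>sphere_measure)"
      by (simp add: sphere_int_def integrable_f_sphere)
    also have "\<dots> \<le> (\<integral>\<omega>. norm (f (p + r *\<^sub>R \<omega>) - f (p + r' *\<^sub>R \<omega>)) \<partial>sphere_measure)"
      by (rule integral_norm_bound)
    also have "\<dots> \<le> (\<integral>\<omega>. L * \<bar>r - r'\<bar> \<partial>(sphere_measure :: 'a measure))"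
    proof (rule integral_mono_AE)
      show "integrable sphere_measure (\<lambda>\<omega>. norm (f (p + r *\<^sub>R \<omega>) - f (p + r' *\<^sub>R \<omega>)))"
        by (intro integrable_norm Bochner_Integration.integrable_diff integrable_f_sphere)
      show "AE \<omega> in sphere_measure. norm (f (p + r *\<^sub>R \<omega>) - f (p + r' *\<^sub>R \<omega>)) \<le> L * \<bar>r - r'\<bar>"
        using AE_sphere_measure_norm
      proof eventually_elim
        case (elim \<omega>)
        have "p + r' *\<^sub>R \<omega> + (r - r') *\<^sub>R \<omega> = p + r *\<^sub>R \<omega>" by (simp add: scaleR_diff_left)
        from L(2)[of "p + r' *\<^sub>R \<omega>" "(r - r') *\<^sub>R \<omega>", unfolded this] elim show ?case by simp
      qed
    qed simp
    finally show ?thesis by (simp add: mult_ac)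
  qed
  with L(1) show ?thesis using that[of "L * ?m"] by simp
qed

text \<open>Such a sphere encloses the whole support, so \<open>f\<close> vanishes on it.\<close>

lemma sphere_int_eq_0:
  assumes "r > norm p + \<rho>"
  shows "sphere_int p r = 0"
proof -
  have r: "r \<ge> 0" using assms \<rho>_nonneg norm_ge_zero[of p] by linarith
  have "sphere_int p r = (\<integral>\<omega>. 0 \<partial>(sphere_measure :: 'a measure))" unfolding sphere_int_def
  proof (rule integral_cong_AE)
    show "AE \<omega> in sphere_measure. f (p + r *\<^sub>R \<omega>) = 0"
      using AE_sphere_measure_norm
    proof eventually_elim
      case (elim \<omega>)
      have "r = norm (r *\<^sub>R \<omega>)" using elim r by simp
      also have "\<dots> \<le> norm (p + r *\<^sub>R \<omega>) + norm p" using norm_triangle_ineq4[of "p + r *\<^sub>R \<omega>" p] by simp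
      finally show ?case using assms by (intro support) simp
    qed
  qed simp_all
  then show ?thesis by simp
qed

text \<open>Thickening the sphere of radius \<open>r\<close> to a shell of width \<open>1\<close> turns the area of its part inside the
  support into a volume bounded independently of \<open>p\<close> and \<open>r\<close>.\<close>

lemma measure_sphere_in_support_le:
  fixes p :: 'a
  assumes r: "r > 0"
  shows "r ^ (DIM('a) - 1) * measure sphere_measure {\<omega>. norm (p + r *\<^sub>R \<omega>) \<le> \<rho>} \<le> measure lborel (cball (0::'a) (\<rho> + 1))"
proof -
  define A where "A = {\<omega>. norm (p + r *\<^sub>R \<omega>) \<le> \<rho>}"
  have [measurable]: "A \<in> sets borel" unfolding A_def by measurable
  define h where "h = (\<lambda>x::'a. indicator (cball 0 (\<rho> + 1)) (p + x) :: ennreal)"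
  have [measurable]: "(\<lambda>x. indicator (cball 0 (\<rho> + 1)) x :: ennreal) \<in> borel_measurable (borel :: 'a measure)"
    by (intro borel_measurable_indicator) simp
  have [measurable]: "h \<in> borel_measurable borel" unfolding h_def by measurable
  \<comment> \<open>The interval \<open>{r..r + 1}\<close> has length 1, so integrating the constant
    over it changes nothing. On it \<open>s ^ (DIM('a) - 1)\<close> is at least
    \<open>r ^ (DIM('a) - 1)\<close>, and points of the sphere move by at most 1, hence the radius
    \<open>\<rho> + 1\<close>.\<close>
  have "ennreal (r ^ (DIM('a) - 1)) * emeasure sphere_measure A =
      (\<integral>\<^sup>+s. (ennreal (r ^ (DIM('a) - 1)) * emeasure sphere_measure A) * indicator {r..r + 1} s \<partial>lborel)"
    using r by (subst nn_integral_cmult_indicator) auto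
  also have "\<dots> \<le> (\<integral>\<^sup>+s. ennreal (s ^ (DIM('a) - 1)) * indicator {0<..} s * (\<integral>\<^sup>+\<omega>. h (s *\<^sub>R \<omega>) \<partial>sphere_measure) \<partial>lborel)"
  proof (rule nn_integral_mono)
    fix s :: real
    have "ennreal (r ^ (DIM('a) - 1)) * emeasure sphere_measure A \<le>
        ennreal (s ^ (DIM('a) - 1)) * (\<integral>\<^sup>+\<omega>. h (s *\<^sub>R \<omega>) \<partial>sphere_measure)" if s: "s \<in> {r..r + 1}"
    proof (rule mult_mono)
      show "ennreal (r ^ (DIM('a) - 1)) \<le> ennreal (s ^ (DIM('a) - 1))"
        using r s by (intro ennreal_leI power_mono) auto
      have "emeasure sphere_measure A = (\<integral>\<^sup>+\<omega>. indicator A \<omega> \<partial>sphere_measure)" by simp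
      also have "\<dots> \<le> (\<integral>\<^sup>+\<omega>. h (s *\<^sub>R \<omega>) \<partial>sphere_measure)"
      proof (rule nn_integral_mono_AE)
        show "AE \<omega> in sphere_measure. indicator A \<omega> \<le> h (s *\<^sub>R \<omega>)"
          using AE_sphere_measure_norm
        proof eventually_elim
          case (elim \<omega>)
          have "norm (p + s *\<^sub>R \<omega>) \<le> norm (p + r *\<^sub>R \<omega>) + norm ((s - r) *\<^sub>R \<omega>)"
            using norm_triangle_ineq[of "p + r *\<^sub>R \<omega>" "(s - r) *\<^sub>R \<omega>"] by (simp add: algebra_simps)
          also have "norm ((s - r) *\<^sub>R \<omega>) \<le> 1" using elim s by simp
          finally show ?case by (auto simp: A_def h_def indicator_def)
        qed
      qed
      finally show "emeasure sphere_measure A \<le> (\<integral>\<^sup>+\<omega>. h (s *\<^sub>R \<omega>) \<partial>sphere_measure)" .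
    qed auto
    then show "(ennreal (r ^ (DIM('a) - 1)) * emeasure sphere_measure A) * indicator {r..r + 1} s \<le>
      ennreal (s ^ (DIM('a) - 1)) * indicator {0<..} s * (\<integral>\<^sup>+\<omega>. h (s *\<^sub>R \<omega>) \<partial>sphere_measure)"
      using r by (auto simp: indicator_def)
  qed
  also have "\<dots> = (\<integral>\<^sup>+x. h x \<partial>lborel)" by (rule nn_integral_polar[symmetric]) simp
  also have "\<dots> = (\<integral>\<^sup>+x. indicator (cball 0 (\<rho> + 1)) x \<partial>(lborel :: 'a measure))"
    unfolding h_def by (rule nn_integral_lborel_translate) simp
  also have "\<dots> = emeasure lborel (cball (0::'a) (\<rho> + 1))" by simp
  finally have "enn2real (ennreal (r ^ (DIM('a) - 1)) * emeasure sphere_measure A) \<le> enn2real (emeasure lborel (cball (0::'a) (\<rho> + 1)))"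
    using emeasure_lborel_cball_finite by (intro enn2real_mono) (auto simp: top.not_eq_extremum)
  then show ?thesis using r by (simp add: A_def measure_def enn2real_mult)
qed

text \<open>The integrand is bounded and lives on the part of the sphere inside the support. For
  \<open>r \<le> 1\<close> the total area bounds that part; for larger \<open>r\<close> the shell
  estimate gives the decay.\<close>

lemma sphere_int_deriv_bound: obtains C where "C \<ge> 0" "\<And>p r. 0 < r \<Longrightarrow> norm (sphere_int_deriv p r) \<le> C / (1 + r) ^ (DIM('a) - 1)"
proof -
  obtain L where L: "L \<ge> 0" "\<And>p v. norm (dir_deriv p v) \<le> L * norm v" by (rule dir_deriv_bounded) (rule that)
  let ?n = "DIM('a) - 1"
  let ?A = "\<lambda>p r. {\<omega>::'a. norm (p + r *\<^sub>R \<omega>) \<le> \<rho>}"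
  define m where "m = measure (sphere_measure :: 'a measure) UNIV"
  define v1 where "v1 = measure lborel (cball (0::'a) (\<rho> + 1))"
  have le: "norm (sphere_int_deriv p r) \<le> L * measure sphere_measure (?A p r)" for p r
  proof -
    have [measurable]: "?A p r \<in> sets borel" by measurable
    have "norm (sphere_int_deriv p r) \<le> (\<integral>\<omega>. norm (dir_deriv (p + r *\<^sub>R \<omega>) \<omega>) \<partial>sphere_measure)"
      unfolding sphere_int_deriv_def by (rule integral_norm_bound)
    also have "\<dots> \<le> (\<integral>\<omega>. L * indicator (?A p r) \<omega> \<partial>(sphere_measure :: 'a measure))"
    proof (rule integral_mono_AE)
      show "AE \<omega> in sphere_measure. norm (dir_deriv (p + r *\<^sub>R \<omega>) \<omega>) \<le> L * indicator (?A p r) \<omega>"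
        using AE_sphere_measure_norm
      proof eventually_elim
        case (elim \<omega>)
        show ?case using L(2)[of "p + r *\<^sub>R \<omega>" \<omega>] elim dir_deriv_support[of "p + r *\<^sub>R \<omega>" \<omega>] by (auto simp: indicator_def)
      qed
    qed (auto intro!: integrable_norm integrable_dir_deriv_sphere integrable_real_indicator simp: less_top[symmetric])
    finally show ?thesis by simp
  qed
  \<comment> \<open>\<open>m\<close> serves \<open>r \<le> 1\<close> and \<open>v1\<close> serves
    \<open>r > 1\<close>; the power of 2 comes from \<open>1 + r \<le> 2\<close> and
    \<open>1 + r \<le> 2 * r\<close> respectively.\<close>
  define C where "C = 2 ^ ?n * (L * (m + v1))"
  have "norm (sphere_int_deriv p r) \<le> C / (1 + r) ^ ?n" if r: "r > 0" for p r
  proof (cases "r \<le> 1")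
    case True
    have "measure sphere_measure (?A p r) \<le> m"
      unfolding m_def by (rule sphere_measure.finite_measure_mono) auto
    then have "norm (sphere_int_deriv p r) \<le> L * m" using le[of p r] L(1) by (meson mult_left_mono order_trans)
    then have "norm (sphere_int_deriv p r) * (1 + r) ^ ?n \<le> L * m * 2 ^ ?n"
      using r True L(1) by (intro mult_mono power_mono) (auto simp: m_def)
    also have "\<dots> \<le> C" using L(1) by (simp add: C_def v1_def algebra_simps)
    finally show ?thesis using r by (simp add: pos_le_divide_eq)
  next
    case False
    have "norm (sphere_int_deriv p r) * (1 + r) ^ ?n \<le> (L * measure sphere_measure (?A p r)) * (2 * r) ^ ?n"
      using r False L(1) by (intro mult_mono power_mono le) auto
    also have "\<dots> = 2 ^ ?n * L * (r ^ ?n * measure sphere_measure (?A p r))"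
      by (simp add: power_mult_distrib)
    also have "\<dots> \<le> 2 ^ ?n * L * v1"
      unfolding v1_def using L(1) by (intro mult_left_mono measure_sphere_in_support_le r) auto
    also have "\<dots> \<le> C" using L(1) by (simp add: C_def m_def algebra_simps)
    finally show ?thesis using r by (simp add: pos_le_divide_eq)
  qed
  moreover have "C \<ge> 0" using L(1) by (simp add: C_def m_def v1_def)
  ultimately show ?thesis using that by blast
qed

text \<open>The derivative at \<open>q\<close>, in the direction \<open>b\<close>, of the
  radialization of \<open>f\<close> about \<open>p\<close>. At the centre \<open>q = p\<close> the
  division by zero makes it 0.\<close>

definition sphere_int_grad :: "'a \<Rightarrow> 'a \<Rightarrow> 'a \<Rightarrow> complex" where
  "sphere_int_grad b p q = (((q - p) \<bullet> b) / norm (q - p)) *\<^sub>R sphere_int_deriv p (norm (q - p))"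

lemma sphere_int_grad_measurable [measurable (raw)]:
  assumes [measurable]: "u \<in> M \<rightarrow>\<^sub>M borel" "v \<in> M \<rightarrow>\<^sub>M borel"
  shows "(\<lambda>x. sphere_int_grad b (u x) (v x)) \<in> borel_measurable M"
  unfolding sphere_int_grad_def by measurable

lemma sphere_int_norm_has_vector_derivative:
  assumes "q \<noteq> p"
  shows "((\<lambda>t. sphere_int p (norm (q + t *\<^sub>R b - p))) has_vector_derivative sphere_int_grad b p q) (at 0)"
proof -
  have "((\<lambda>t. q + t *\<^sub>R b - p) has_derivative (\<lambda>h. h *\<^sub>R b)) (at 0)"
    by (auto intro!: derivative_eq_intros)
  moreover have "(norm has_derivative (\<lambda>h. h \<bullet> sgn (q - p))) (at (q + 0 *\<^sub>R b - p))"
    using has_derivative_norm[of "q - p"] assms by (simp add: inner_commute)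
  ultimately have "((\<lambda>t. norm (q + t *\<^sub>R b - p)) has_derivative (\<lambda>h. (h *\<^sub>R b) \<bullet> sgn (q - p))) (at 0)"
    by (rule has_derivative_compose)
  then have "((\<lambda>t. norm (q + t *\<^sub>R b - p)) has_vector_derivative ((q - p) \<bullet> b) / norm (q - p)) (at 0)"
    by (simp add: has_vector_derivative_def sgn_div_norm inner_commute divide_inverse mult_ac)
  from vector_diff_chain_at[OF this, of "sphere_int p" "sphere_int_deriv p (norm (q - p))"] sphere_int_has_vector_derivative[of p "norm (q - p)"]
  show ?thesis by (simp add: o_def sphere_int_grad_def)
qed

text \<open>The phase has two sources: translating \<open>f\<close> by the centre gives
  \<open>cis (p \<bullet> (norm \<zeta> *\<^sub>R \<theta>))\<close>, and moving the radialization
  from the origin to \<open>p\<close> gives \<open>cis (- (p \<bullet> \<zeta>))\<close>.\<close>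

lemma
  fixes b p \<zeta> :: 'a
  assumes b: "norm b = 1"
  shows integrable_sphere_int_grad: "integrable lborel (sphere_int_grad b p)"
    and fourier_sphere_int_grad: "fourier (sphere_int_grad b p) \<zeta> = \<i> * of_real (\<zeta> \<bullet> b) *
      (\<integral>\<theta>. cis (p \<bullet> (norm \<zeta> *\<^sub>R \<theta> - \<zeta>)) * fourier f (norm \<zeta> *\<^sub>R \<theta>) \<partial>sphere_measure)"
proof -
  define u where "u = (\<lambda>q. sphere_int p (norm (q - p)))"
  have [measurable]: "u \<in> borel_measurable borel" unfolding u_def by measurable
  have fp: "integrable lborel (\<lambda>q. f (p + q))" by (rule integrable_lborel_translate[OF f_integrable])
  have A: "integrable lborel (\<lambda>q::'a. sphere_int p (norm q))"
    using integrable_radialization[OF fp] by (simp add: sphere_int_def)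
  have u: "integrable lborel u"
    using integrable_lborel_translate[OF A, of "- p"] by (simp add: u_def)
  obtain L where L: "L \<ge> 0" "\<And>p r r'. norm (sphere_int p r - sphere_int p r') \<le> L * \<bar>r - r'\<bar>" by (rule sphere_int_lipschitz) (rule that)
  \<comment> \<open>Beyond radius \<open>norm p + \<rho> + 1\<close> both \<open>q\<close> and
    \<open>q + t *\<^sub>R b\<close> lie where \<open>u\<close> vanishes, since a step of length at
    most 1 cannot lead back; inside, the Lipschitz constant of \<open>sphere_int\<close> bounds the
    increment.\<close>
  define E where "E = (\<lambda>q. L * indicator (cball p (norm p + \<rho> + 1)) q)"
  have E: "integrable lborel E"
    unfolding E_def using emeasure_lborel_cball_finite
    by (intro integrable_mult_right integrable_real_indicator) auto
  have bound: "norm (u (q + t *\<^sub>R b) - u q) \<le> t * E q" if t: "0 \<le> t" "t \<le> 1" for q t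
  proof -
    have d: "\<bar>norm (q + t *\<^sub>R b - p) - norm (q - p)\<bar> \<le> t"
      using norm_triangle_ineq3[of "q + t *\<^sub>R b - p" "q - p"] t b by simp
    show ?thesis
    proof (cases "q \<in> cball p (norm p + \<rho> + 1)")
      case True
      have "norm (u (q + t *\<^sub>R b) - u q) \<le> L * \<bar>norm (q + t *\<^sub>R b - p) - norm (q - p)\<bar>"
        unfolding u_def by (rule L(2))
      also have "\<dots> \<le> L * t" by (rule mult_left_mono[OF d L(1)])
      finally show ?thesis using True by (simp add: E_def mult.commute)
    next
      case False
      then have "norm (q - p) > norm p + \<rho> + 1" by (simp add: dist_norm norm_minus_commute)
      with d t have "norm (q - p) > norm p + \<rho>" "norm (q + t *\<^sub>R b - p) > norm p + \<rho>" by linarith+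
      then show ?thesis using False by (simp add: u_def sphere_int_eq_0 E_def)
    qed
  qed
  have deriv: "AE q in lborel. ((\<lambda>t. u (q + t *\<^sub>R b)) has_vector_derivative sphere_int_grad b p q) (at 0)"
  proof -
    have "AE q in lborel. q \<noteq> p" by (rule AE_lborel_singleton)
    then show ?thesis unfolding u_def by eventually_elim (rule sphere_int_norm_has_vector_derivative)
  qed
  have Gm: "sphere_int_grad b p \<in> borel_measurable borel" by measurable
  show "integrable lborel (sphere_int_grad b p)"
    by (rule integrable_directional_derivative[OF u Gm E bound deriv])
  have "fourier (sphere_int_grad b p) \<zeta> = \<i> * of_real (\<zeta> \<bullet> b) * fourier u \<zeta>"
    by (rule fourier_directional_derivative[OF u Gm E bound deriv])
  also have "fourier u \<zeta> = cis (- (p \<bullet> \<zeta>)) * fourier (\<lambda>q. sphere_int p (norm q)) \<zeta>"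
    using fourier_translate[of "\<lambda>q. sphere_int p (norm q)" "- p" \<zeta>] by (simp add: u_def)
  also have "fourier (\<lambda>q. sphere_int p (norm q)) \<zeta> = (\<integral>\<theta>. fourier (\<lambda>q. f (p + q)) (norm \<zeta> *\<^sub>R \<theta>) \<partial>sphere_measure)"
    using fourier_radialization[OF fp, of \<zeta>] by (simp add: sphere_int_def)
  also have "\<dots> = (\<integral>\<theta>. cis (p \<bullet> (norm \<zeta> *\<^sub>R \<theta>)) * fourier f (norm \<zeta> *\<^sub>R \<theta>) \<partial>sphere_measure)"
    by (simp add: fourier_translate[OF f_measurable, of p, unfolded add.commute[of _ p]])
  also have "cis (- (p \<bullet> \<zeta>)) * \<dots> = (\<integral>\<theta>. cis (- (p \<bullet> \<zeta>)) * (cis (p \<bullet> (norm \<zeta> *\<^sub>R \<theta>)) * fourier f (norm \<zeta> *\<^sub>R \<theta>)) \<partial>sphere_measure)"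
    by (rule integral_mult_right_zero[symmetric])
  also have "\<dots> = (\<integral>\<theta>. cis (p \<bullet> (norm \<zeta> *\<^sub>R \<theta> - \<zeta>)) * fourier f (norm \<zeta> *\<^sub>R \<theta>) \<partial>sphere_measure)"
    by (simp add: mult.assoc[symmetric] cis_mult inner_diff_right)
  finally show "fourier (sphere_int_grad b p) \<zeta> = \<i> * of_real (\<zeta> \<bullet> b) *
      (\<integral>\<theta>. cis (p \<bullet> (norm \<zeta> *\<^sub>R \<theta> - \<zeta>)) * fourier f (norm \<zeta> *\<^sub>R \<theta>) \<partial>sphere_measure)" .
qed

text \<open>The factor \<open>y / r\<close> with \<open>y = \<bar>(q - p) \<bullet> b\<bar>\<close>
  raises the order of decay from \<open>DIM('a) - 1\<close> to \<open>DIM('a)\<close>, which exceeds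
  the dimension n of the z-space. Since \<open>y \<le> r\<close>, it is at most
  \<open>2 * (1 + y) / (1 + r)\<close>, also for small \<open>r\<close>. The vector \<open>w\<close>
  allows the decay to be stated in the x-component only.\<close>

lemma sphere_int_grad_bound: obtains C where "C \<ge> 0"
  "\<And>b p q w. norm w \<le> norm (q - p) \<Longrightarrow> norm b = 1 \<Longrightarrow>
     norm (sphere_int_grad b p q) \<le> C * (1 + \<bar>(q - p) \<bullet> b\<bar>) / (1 + norm (w :: 'w::real_normed_vector)) ^ DIM('a)"
proof -
  obtain C where C: "C \<ge> 0" "\<And>p r. 0 < r \<Longrightarrow> norm (sphere_int_deriv p r) \<le> C / (1 + r) ^ (DIM('a) - 1)" by (rule sphere_int_deriv_bound) (rule that)
  have "norm (sphere_int_grad b p q) \<le> (2 * C) * (1 + \<bar>(q - p) \<bullet> b\<bar>) / (1 + norm w) ^ DIM('a)"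
    if w: "norm w \<le> norm (q - p)" and b: "norm b = 1" for b p q and w :: 'w
  proof (cases "q = p")
    case True
    then show ?thesis using C by (simp add: sphere_int_grad_def)
  next
    case False
    define r where "r = norm (q - p)"
    define y where "y = \<bar>(q - p) \<bullet> b\<bar>"
    have r: "r > 0" using False by (simp add: r_def)
    have y: "0 \<le> y" "y \<le> r" using Cauchy_Schwarz_ineq2[of "q - p" b] b by (simp_all add: y_def r_def)
    have "y * (1 + r) \<le> 2 * (1 + y) * r"
    proof (cases "r \<le> 1")
      case True
      have "y * (1 + r) \<le> r * 2" using y True r by (intro mult_mono) auto
      also have "\<dots> \<le> 2 * (1 + y) * r" using y r by simp
      finally show ?thesis .
    next
      case False
      have "y * (1 + r) \<le> y * (2 * r)" using y False by (intro mult_left_mono) auto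
      also have "\<dots> \<le> 2 * (1 + y) * r" using y r by (simp add: algebra_simps)
      finally show ?thesis .
    qed
    then have "y / r \<le> 2 * (1 + y) / (1 + r)" using r by (simp add: divide_simps)
    have "norm (sphere_int_grad b p q) = y / r * norm (sphere_int_deriv p r)"
      by (simp add: sphere_int_grad_def y_def r_def)
    also have "\<dots> \<le> 2 * (1 + y) / (1 + r) * (C / (1 + r) ^ (DIM('a) - 1))"
      using \<open>y / r \<le> _\<close> r y C by (intro mult_mono) auto
    also have "\<dots> = (2 * C) * (1 + y) / (1 + r) ^ DIM('a)"
      by (simp add: power_eq_if)
    also have "\<dots> \<le> (2 * C) * (1 + y) / (1 + norm w) ^ DIM('a)"
      using w y C(1) by (intro divide_left_mono power_mono mult_pos_pos zero_less_power) (auto simp: r_def add_pos_nonneg)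
    finally show ?thesis by (simp add: y_def)
  qed
  then show ?thesis using that[of "2 * C"] C(1) by simp
qed

end

section \<open>The substitution \<open>s = sqrt (a\<^sup>2 + \<eta>\<^sup>2)\<close> and the reflection in \<open>y\<close>\<close>

lemma radial_measure_eq_density: "radial_measure N = density lborel (\<lambda>s. ennreal (s ^ (N - 1) * indicator {0<..} s))"
  unfolding radial_measure_def by (rule density_cong) (auto simp: indicator_def)

lemma integral_radial_measure:
  fixes h :: "real \<Rightarrow> 'b::{banach, second_countable_topology}"
  assumes [measurable]: "h \<in> borel_measurable borel"
  shows "(\<integral>s. h s \<partial>radial_measure N) = (\<integral>s. (s ^ (N - 1) * indicator {0<..} s) *\<^sub>R h s \<partial>lborel)"
  unfolding radial_measure_eq_density by (subst integral_density) (auto simp: indicator_def)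

text \<open>On \<open>{0..k}\<close> the derivative \<open>\<eta> / g \<eta>\<close> cancels the
  factor \<open>s = g \<eta>\<close> and leaves \<open>\<eta>\<close>; monotone convergence in
  \<open>k\<close> exhausts the half-line. \<open>a > 0\<close> keeps the square root differentiable
  at 0.\<close>

lemma nn_integral_substitution_sqrt:
  fixes a :: real and h :: "real \<Rightarrow> ennreal"
  assumes a: "a > 0" and [measurable]: "h \<in> borel_measurable borel"
  shows "(\<integral>\<^sup>+s. (ennreal s * indicator {a<..} s) * h s \<partial>lborel) =
    (\<integral>\<^sup>+\<eta>. (ennreal \<eta> * indicator {0<..} \<eta>) * h (sqrt (a\<^sup>2 + \<eta>\<^sup>2)) \<partial>lborel)"
proof -
  define g where "g = (\<lambda>\<eta>. sqrt (a\<^sup>2 + \<eta>\<^sup>2))"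
  have [measurable]: "g \<in> borel_measurable borel" unfolding g_def by measurable
  have pos: "a\<^sup>2 + \<eta>\<^sup>2 > 0" for \<eta> using a by (simp add: add_pos_nonneg)
  have g_mono: "g k \<le> g l" if "0 \<le> k" "k \<le> l" for k l using that by (simp add: g_def power_mono)
  have sub: "(\<integral>\<^sup>+s. (ennreal s * h s) * indicator {a..g k} s \<partial>lborel) =
      (\<integral>\<^sup>+\<eta>. (ennreal \<eta> * h (g \<eta>)) * indicator {0..k} \<eta> \<partial>lborel)" if k: "k > 0" for k :: real
  proof -
    have ga: "g 0 = a" using a by (simp add: g_def)
    have "(\<integral>\<^sup>+s. (ennreal s * h s) * indicator {g 0..g k} s \<partial>lborel) =
        (\<integral>\<^sup>+\<eta>. (ennreal (g \<eta>) * h (g \<eta>)) * ennreal (\<eta> / g \<eta>) * indicator {0..k} \<eta> \<partial>lborel)"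
    proof (rule nn_integral_substitution_aux)
      show "(g has_real_derivative \<eta> / g \<eta>) (at \<eta>)" if "\<eta> \<in> {0..k}" for \<eta>
        unfolding g_def using pos[of \<eta>] by (auto intro!: derivative_eq_intros simp: field_simps)
      show "continuous_on {0..k} (\<lambda>\<eta>. \<eta> / g \<eta>)"
        unfolding g_def using pos by (intro continuous_intros) (metis less_irrefl real_sqrt_eq_zero_cancel_iff)
      show "0 \<le> \<eta> / g \<eta>" if "\<eta> \<in> {0..k}" for \<eta>
        using that by (simp add: g_def)
    qed (use k in auto)
    also have "\<dots> = (\<integral>\<^sup>+\<eta>. (ennreal \<eta> * h (g \<eta>)) * indicator {0..k} \<eta> \<partial>lborel)"
    proof (rule nn_integral_cong)
      fix \<eta> :: real
      have "g \<eta> > 0" using pos[of \<eta>] by (simp add: g_def)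
      then have "ennreal (g \<eta>) * ennreal (\<eta> / g \<eta>) = ennreal \<eta>"
        by (simp add: ennreal_mult'[symmetric])
      then show "(ennreal (g \<eta>) * h (g \<eta>)) * ennreal (\<eta> / g \<eta>) * indicator {0..k} \<eta> = (ennreal \<eta> * h (g \<eta>)) * indicator {0..k} \<eta>"
        by (metis (no_types, lifting) mult.assoc mult.commute)
    qed
    finally show ?thesis unfolding ga .
  qed
  have SUP: "(\<integral>\<^sup>+s. H s * indicator (\<Union>k. A k) s \<partial>lborel) = (SUP k. \<integral>\<^sup>+s. H s * indicator (A k) s \<partial>lborel)"
    if [measurable]: "H \<in> borel_measurable borel" "\<And>k. A k \<in> sets borel" and "incseq A" for H and A :: "nat \<Rightarrow> real set"
  proof -
    have "(SUP k. H s * indicator (A k) s) = H s * indicator (\<Union>k. A k) s" for s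
    proof (rule SUP_eqI)
      fix y assume y: "\<And>k. k \<in> UNIV \<Longrightarrow> H s * indicator (A k) s \<le> y"
      show "H s * indicator (\<Union>k. A k) s \<le> y"
      proof (cases "s \<in> (\<Union>k. A k)")
        case True
        then obtain k where "s \<in> A k" by blast
        then show ?thesis using y[of k] True by simp
      qed simp
    qed (auto simp: indicator_def)
    then show ?thesis
      using \<open>incseq A\<close> by (subst nn_integral_monotone_convergence_SUP[symmetric])
        (auto simp: incseq_def le_fun_def indicator_def intro!: mult_left_mono split: if_splits)
  qed
  have "(\<Union>k. {a..g (real (Suc k))}) = {a..}"
  proof safe
    fix s assume "s \<ge> a"
    obtain k where k: "s < real k" using reals_Archimedean2 by blast
    have "real (Suc k) \<le> g (real (Suc k))" unfolding g_def by (intro real_le_rsqrt) simp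
    with k \<open>s \<ge> a\<close> show "s \<in> (\<Union>k. {a..g (real (Suc k))})" by (intro UN_I[of k]) auto
  qed auto
  moreover have "incseq (\<lambda>k. {a..g (real (Suc k))})"
    using g_mono by (auto simp: incseq_def intro: order_trans)
  ultimately have 1: "(\<integral>\<^sup>+s. (ennreal s * h s) * indicator {a..} s \<partial>lborel) =
      (SUP k. \<integral>\<^sup>+s. (ennreal s * h s) * indicator {a..g (real (Suc k))} s \<partial>lborel)"
    using SUP[of "\<lambda>s. ennreal s * h s" "\<lambda>k. {a..g (real (Suc k))}"] by simp
  have "(\<Union>k. {0..real (Suc k)}) = {0..}"
  proof safe
    fix s :: real assume "s \<ge> 0"
    obtain k where k: "s < real k" using reals_Archimedean2 by blast
    with \<open>s \<ge> 0\<close> show "s \<in> (\<Union>k. {0..real (Suc k)})" by (intro UN_I[of k]) auto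
  qed auto
  moreover have "incseq (\<lambda>k. {0..real (Suc k)})" by (auto simp: incseq_def)
  ultimately have 2: "(\<integral>\<^sup>+\<eta>. (ennreal \<eta> * h (g \<eta>)) * indicator {0..} \<eta> \<partial>lborel) =
      (SUP k. \<integral>\<^sup>+\<eta>. (ennreal \<eta> * h (g \<eta>)) * indicator {0..real (Suc k)} \<eta> \<partial>lborel)"
    using SUP[of "\<lambda>\<eta>. ennreal \<eta> * h (g \<eta>)" "\<lambda>k. {0..real (Suc k)}"] by simp
  have "(\<integral>\<^sup>+s. (ennreal s * indicator {a<..} s) * h s \<partial>lborel) = (\<integral>\<^sup>+s. (ennreal s * h s) * indicator {a..} s \<partial>lborel)"
    by (rule nn_integral_cong_AE, use AE_lborel_singleton[of a] in eventually_elim) (auto simp: indicator_def)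
  also have "\<dots> = (\<integral>\<^sup>+\<eta>. (ennreal \<eta> * h (g \<eta>)) * indicator {0..} \<eta> \<partial>lborel)"
    unfolding 1 2 by (simp only: sub of_nat_0_less_iff zero_less_Suc)
  also have "\<dots> = (\<integral>\<^sup>+\<eta>. (ennreal \<eta> * indicator {0<..} \<eta>) * h (g \<eta>) \<partial>lborel)"
    by (rule nn_integral_cong_AE, use AE_lborel_singleton[of 0] in eventually_elim) (auto simp: indicator_def)
  finally show ?thesis unfolding g_def .
qed

text \<open>Applied to indicators, the nonnegative version says that the measure with density
  \<open>s\<close> on \<open>{a<..}\<close> is the image of the one with density
  \<open>\<eta>\<close> on \<open>{0<..}\<close>; complex integrands follow by change of
  variables.\<close>

lemma integral_substitution_sqrt:
  fixes a :: real and k :: "real \<Rightarrow> complex"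
  assumes a: "a > 0" and [measurable]: "k \<in> borel_measurable borel"
  shows "(\<integral>\<eta>. (\<eta> * indicator {0<..} \<eta>) *\<^sub>R k (sqrt (a\<^sup>2 + \<eta>\<^sup>2)) \<partial>lborel) =
    (\<integral>s. (s * indicator {a<..} s) *\<^sub>R k s \<partial>lborel)"
proof -
  define A where "A = density lborel (\<lambda>\<eta>::real. ennreal (\<eta> * indicator {0<..} \<eta>))"
  define B where "B = density lborel (\<lambda>s. ennreal (s * indicator {a<..} s))"
  have ind: "ennreal (x * indicator {c<..} x) = ennreal x * indicator {c<..} x" for x c :: real
    by (simp add: indicator_def)
  have [measurable_cong]: "sets A = sets borel" by (simp add: A_def)
  have "B = distr A borel (\<lambda>\<eta>. sqrt (a\<^sup>2 + \<eta>\<^sup>2))"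
  proof (rule measure_eqI)
    fix X assume "X \<in> sets B"
    then have [measurable]: "X \<in> sets borel" by (simp add: B_def)
    have "emeasure B X = (\<integral>\<^sup>+s. (ennreal s * indicator {a<..} s) * indicator X s \<partial>lborel)"
      by (simp add: B_def emeasure_density ind)
    also have "\<dots> = (\<integral>\<^sup>+\<eta>. (ennreal \<eta> * indicator {0<..} \<eta>) * indicator X (sqrt (a\<^sup>2 + \<eta>\<^sup>2)) \<partial>lborel)"
      by (rule nn_integral_substitution_sqrt[OF a]) simp
    also have "\<dots> = (\<integral>\<^sup>+\<eta>. indicator X (sqrt (a\<^sup>2 + \<eta>\<^sup>2)) \<partial>A)"
      unfolding A_def by (subst nn_integral_density) (simp_all add: ind)
    also have "\<dots> = (\<integral>\<^sup>+s. indicator X s \<partial>distr A borel (\<lambda>\<eta>. sqrt (a\<^sup>2 + \<eta>\<^sup>2)))"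
      by (subst nn_integral_distr) auto
    also have "\<dots> = emeasure (distr A borel (\<lambda>\<eta>. sqrt (a\<^sup>2 + \<eta>\<^sup>2))) X" by simp
    finally show "emeasure B X = emeasure (distr A borel (\<lambda>\<eta>. sqrt (a\<^sup>2 + \<eta>\<^sup>2))) X" .
  qed (simp add: B_def)
  then have "(\<integral>s. k s \<partial>B) = (\<integral>\<eta>. k (sqrt (a\<^sup>2 + \<eta>\<^sup>2)) \<partial>A)"
    by (simp add: integral_distr)
  moreover have "(\<integral>s. k s \<partial>B) = (\<integral>s. (s * indicator {a<..} s) *\<^sub>R k s \<partial>lborel)"
    unfolding B_def using a by (subst integral_density) (auto simp: indicator_def)
  moreover have "(\<integral>\<eta>. k (sqrt (a\<^sup>2 + \<eta>\<^sup>2)) \<partial>A) = (\<integral>\<eta>. (\<eta> * indicator {0<..} \<eta>) *\<^sub>R k (sqrt (a\<^sup>2 + \<eta>\<^sup>2)) \<partial>lborel)"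
    unfolding A_def by (subst integral_density) (auto simp: indicator_def)
  ultimately show ?thesis by simp
qed

text \<open>The negative half-line is reflected onto the positive one. As the factor
  \<open>\<eta>\<close> is odd and the argument of \<open>K\<close> is even, the two halves combine
  to the difference of the values of \<open>g\<close>.\<close>

lemma integral_fold_sqrt:
  fixes g K :: "real \<Rightarrow> complex"
  assumes a: "a > 0" and [measurable]: "g \<in> borel_measurable borel" "K \<in> borel_measurable borel"
    and int: "integrable lborel (\<lambda>\<eta>. of_real \<eta> * g \<eta> * K (sqrt (a\<^sup>2 + \<eta>\<^sup>2)))"
  shows "(\<integral>\<eta>. of_real \<eta> * g \<eta> * K (sqrt (a\<^sup>2 + \<eta>\<^sup>2)) \<partial>lborel) =
    (\<integral>s. (s * indicator {a<..} s) *\<^sub>R ((g (sqrt (s\<^sup>2 - a\<^sup>2)) - g (- sqrt (s\<^sup>2 - a\<^sup>2))) * K s) \<partial>lborel)"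
proof -
  define F where "F = (\<lambda>\<eta>. of_real \<eta> * g \<eta> * K (sqrt (a\<^sup>2 + \<eta>\<^sup>2)))"
  have F: "integrable lborel F" using int by (simp add: F_def)
  then have [measurable]: "F \<in> borel_measurable borel" by auto
  have Fp: "integrable lborel (\<lambda>\<eta>. indicator {0<..} \<eta> *\<^sub>R F \<eta>)"
    by (intro integrable_mult_indicator F) simp
  have Fn: "integrable lborel (\<lambda>\<eta>. indicator {..<0} \<eta> *\<^sub>R F \<eta>)"
    by (intro integrable_mult_indicator F) simp
  have neg: "(\<integral>\<eta>. indicator {..<0} \<eta> *\<^sub>R F \<eta> \<partial>lborel) = (\<integral>\<eta>. indicator {0<..} \<eta> *\<^sub>R F (- \<eta>) \<partial>lborel)"
  proof -
    have "(\<integral>\<eta>. indicator {..<0} \<eta> *\<^sub>R F \<eta> \<partial>lborel) = (\<bar>-1\<bar> ^ DIM(real)) *\<^sub>R (\<integral>\<eta>. indicator {..<0} ((-1) *\<^sub>R \<eta>) *\<^sub>R F ((-1) *\<^sub>R \<eta>) \<partial>lborel)"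
      by (rule integral_lborel_scale) auto
    then show ?thesis by (simp add: indicator_def)
  qed
  have Fn': "integrable lborel (\<lambda>\<eta>. indicator {0<..} \<eta> *\<^sub>R F (- \<eta>))"
  proof -
    have "integrable (distr lborel borel uminus) (\<lambda>\<eta>. indicator {..<0} \<eta> *\<^sub>R F \<eta>)"
      using Fn by (simp add: lborel_distr_uminus)
    then show ?thesis by (subst (asm) integrable_distr_eq) (auto simp: indicator_def)
  qed
  have "(\<integral>\<eta>. F \<eta> \<partial>lborel) = (\<integral>\<eta>. indicator {0<..} \<eta> *\<^sub>R F \<eta> + indicator {..<0} \<eta> *\<^sub>R F \<eta> \<partial>lborel)"
    by (rule integral_cong_AE) (use AE_lborel_singleton[of "0::real"] in \<open>auto elim!: eventually_mono simp: indicator_def\<close>)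
  also have "\<dots> = (\<integral>\<eta>. indicator {0<..} \<eta> *\<^sub>R F \<eta> \<partial>lborel) + (\<integral>\<eta>. indicator {0<..} \<eta> *\<^sub>R F (- \<eta>) \<partial>lborel)"
    using Fp Fn neg by simp
  also have "\<dots> = (\<integral>\<eta>. indicator {0<..} \<eta> *\<^sub>R F \<eta> + indicator {0<..} \<eta> *\<^sub>R F (- \<eta>) \<partial>lborel)"
    using Fp Fn' by simp
  also have "\<dots> = (\<integral>\<eta>. (\<eta> * indicator {0<..} \<eta>) *\<^sub>R (\<lambda>s. (g (sqrt (s\<^sup>2 - a\<^sup>2)) - g (- sqrt (s\<^sup>2 - a\<^sup>2))) * K s) (sqrt (a\<^sup>2 + \<eta>\<^sup>2)) \<partial>lborel)"
    by (intro Bochner_Integration.integral_cong refl)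
       (auto simp: F_def indicator_def scaleR_conv_of_real algebra_simps)
  also have "\<dots> = (\<integral>s. (s * indicator {a<..} s) *\<^sub>R ((g (sqrt (s\<^sup>2 - a\<^sup>2)) - g (- sqrt (s\<^sup>2 - a\<^sup>2))) * K s) \<partial>lborel)"
    by (rule integral_substitution_sqrt[OF a]) measurable
  finally show ?thesis by (simp add: F_def)
qed

section \<open>The reflection of the last coordinate\<close>

lemma lborel_distr_isometry:
  fixes T :: "'a::euclidean_space \<Rightarrow> 'a"
  assumes T: "linear T" "\<And>x. norm (T x) = norm x" "\<And>x. T (T x) = x"
  shows "distr lborel borel T = lborel"
proof (rule measure_eqI)
  have [measurable]: "T \<in> borel_measurable borel"
    using T(1) by (intro borel_measurable_continuous_onI linear_continuous_on) (simp add: linear_conv_bounded_linear)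
  fix A assume "A \<in> sets (distr lborel borel T)"
  then have [measurable]: "A \<in> sets borel" by simp
  have "emeasure (distr lborel borel T) A = (\<integral>\<^sup>+x. indicator A x \<partial>distr lborel borel T)" by simp
  also have "\<dots> = (\<integral>\<^sup>+x. indicator A (T x) \<partial>lborel)" by (subst nn_integral_distr) auto
  also have "\<dots> = (\<integral>\<^sup>+x. indicator A x \<partial>lborel)" by (rule nn_integral_lborel_isometry[OF T]) simp
  finally show "emeasure (distr lborel borel T) A = emeasure lborel A" by simp
qed simp

definition flip :: "'a::euclidean_space \<times> real \<Rightarrow> 'a \<times> real" where
  "flip = (\<lambda>(x, y). (x, - y))"

lemma flip_simps [simp]: "flip (x, y) = (x, - y)" "flip (flip p) = p" "norm (flip p) = norm (p :: 'a::euclidean_space \<times> real)"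
  "flip p \<bullet> q = p \<bullet> flip q"
  by (simp_all add: flip_def split_beta norm_prod_def inner_prod_def)

lemma lborel_distr_flip: "distr lborel borel flip = (lborel :: ('a::euclidean_space \<times> real) measure)"
proof (rule lborel_distr_isometry)
  show "linear (flip :: 'a \<times> real \<Rightarrow> 'a \<times> real)" by (auto intro!: linearI simp: flip_def split_beta)
qed simp_all

lemma flip_measurable [measurable]: "flip \<in> borel_measurable borel"
  unfolding flip_def split_beta by (intro borel_measurable_continuous_onI continuous_intros)

lemma integral_flip:
  fixes F :: "'a::euclidean_space \<times> real \<Rightarrow> complex"
  assumes [measurable]: "F \<in> borel_measurable borel"
  shows "(\<integral>p. F (flip p) \<partial>lborel) = (\<integral>p. F p \<partial>lborel)"
proof -
  have "(\<integral>p. F p \<partial>lborel) = (\<integral>p. F p \<partial>distr lborel borel flip)" by (simp add: lborel_distr_flip)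
  also have "\<dots> = (\<integral>p. F (flip p) \<partial>lborel)" by (subst integral_distr) auto
  finally show ?thesis ..
qed

lemma integrable_flip:
  fixes F :: "'a::euclidean_space \<times> real \<Rightarrow> complex"
  assumes "integrable lborel F"
  shows "integrable lborel (\<lambda>p. F (flip p))"
proof -
  have [measurable]: "F \<in> borel_measurable borel" using assms by auto
  have "integrable (distr lborel borel flip) F" using assms by (simp add: lborel_distr_flip)
  then show ?thesis by (subst (asm) integrable_distr_eq) auto
qed

lemma fourier_flip:
  fixes F :: "'a::euclidean_space \<times> real \<Rightarrow> complex"
  assumes [measurable]: "F \<in> borel_measurable borel"
  shows "fourier F (flip \<zeta>) = fourier (\<lambda>p. F (flip p)) \<zeta>"
  unfolding fourier_def
  using integral_flip[of "\<lambda>x. cis (- (x \<bullet> flip \<zeta>)) * F x"] by simp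

text \<open>The Hilbert multiplier vanishes on the hyperplane \<open>\<eta> = 0\<close>, so the last
  identity between transforms is obtained only off this null set.\<close>

lemma AE_snd_nonzero: "AE p in (lborel :: ('a::euclidean_space \<times> real) measure). snd p \<noteq> 0"
proof -
  have "AE p in (lborel :: 'a measure) \<Otimes>\<^sub>M (lborel :: real measure). snd p \<noteq> 0"
  proof (rule lborel_pair.AE_pair_measure)
    show "AE x in (lborel :: 'a measure). AE y in (lborel :: real measure). snd (x, y) \<noteq> 0"
      using AE_lborel_singleton[of "0::real"] by simp
  qed measurable
  then show ?thesis unfolding lborel_prod .
qed

section \<open>The Fourier transform of the backprojection\<close>

lemma
  fixes u :: "'c \<Rightarrow> 'a::euclidean_space \<times> 'b::euclidean_space"
  assumes u: "u \<in> M \<rightarrow>\<^sub>M borel"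
  shows borel_measurable_fst [measurable (raw)]: "(\<lambda>x. fst (u x)) \<in> M \<rightarrow>\<^sub>M borel"
    and borel_measurable_snd [measurable (raw)]: "(\<lambda>x. snd (u x)) \<in> M \<rightarrow>\<^sub>M borel"
  by (rule measurable_compose[OF u], intro borel_measurable_continuous_onI continuous_intros)+

lemma schwartz_measurable:
  fixes \<phi> :: "'a::euclidean_space \<Rightarrow> complex"
  shows "\<phi> \<in> schwartz \<Longrightarrow> \<phi> \<in> borel_measurable borel"
  using smooth_measurable[OF schwartz_smooth, of \<phi> "[]"] by simp

lemma schwartz_isCont:
  fixes \<phi> :: "'a::euclidean_space \<Rightarrow> complex"
  shows "\<phi> \<in> schwartz \<Longrightarrow> isCont \<phi> x"
  using smooth_continuous_on[OF schwartz_smooth, of \<phi> "[]" UNIV] by (simp add: continuous_on_eq_continuous_at)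

text \<open>The additional power of decay pays for a factor of linear growth; such factors arise
  from the backprojection and from \<open>snd \<zeta>\<close> in its transform.\<close>

lemma integrable_weighted_decay:
  fixes F :: "'a::euclidean_space \<Rightarrow> complex"
  assumes [measurable]: "F \<in> borel_measurable borel" and F: "\<And>x. norm (F x) \<le> C / (1 + norm x) ^ (DIM('a) + 2)"
  shows "integrable lborel (\<lambda>x. (1 + norm x) * norm (F x))"
proof (rule integrable_of_norm_le[OF integrable_decay[of C]])
  fix x :: 'a
  have pos: "1 + norm x > 0" by (simp add: add_pos_nonneg)
  have "norm ((1 + norm x) * norm (F x)) = (1 + norm x) * norm (F x)"
    using pos by (simp add: abs_mult)
  also have "\<dots> \<le> (1 + norm x) * (C / (1 + norm x) ^ (DIM('a) + 2))"
    using F[of x] pos by (intro mult_left_mono) auto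
  also have "\<dots> = C / (1 + norm x) ^ (DIM('a) + 1)" using pos by simp
  finally show "norm ((1 + norm x) * norm (F x)) \<le> C / (1 + norm x) ^ (DIM('a) + 1)" .
qed measurable

locale even_test_function = test_function f \<rho> for f :: "'b::euclidean_space \<times> real \<Rightarrow> complex" and \<rho> +
  assumes even: "f (x, - y) = f (x, y)"
begin

abbreviation "\<sigma> \<equiv> sphere_measure :: ('b \<times> real) measure"
abbreviation "P \<equiv> radial_measure DIM('b \<times> real) \<Otimes>\<^sub>M \<sigma>"
text \<open>Up to the sphere area, \<open>grad z\<close> is the integrand of the backprojection: the
  centre is \<open>(z, 0)\<close> and the direction is that of \<open>y\<close>.\<close>

abbreviation "grad \<equiv> (\<lambda>z. sphere_int_grad (0, 1) (z, 0))"

lemma fourier_f_bounded: obtains B where "B \<ge> 0" "\<And>\<zeta>. norm (fourier f \<zeta>) \<le> B"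
  using norm_fourier_le[OF f_integrable] by (metis norm_ge_zero order_trans)

text \<open>Projection to the x-component does not increase norms, so the decay can be expressed by
  \<open>z - x\<close> alone, with an exponent one above the dimension of the z-space. The form
  \<open>- x + z\<close> matches the translation lemmas.\<close>

lemma grad_bound: obtains C where "C \<ge> 0"
  "\<And>x y z. norm (grad z (x, y)) \<le> C * (1 + \<bar>y\<bar>) / (1 + norm (- x + z)) ^ (DIM('b) + 1)"
proof -
  obtain C where C: "C \<ge> 0" "\<And>b p q w. norm w \<le> norm (q - p) \<Longrightarrow> norm b = 1 \<Longrightarrow>
     norm (sphere_int_grad b p q) \<le> C * (1 + \<bar>(q - p) \<bullet> b\<bar>) / (1 + norm (w :: 'b)) ^ DIM('b \<times> real)"
    by (rule sphere_int_grad_bound) (rule that)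
  have "norm (grad z (x, y)) \<le> C * (1 + \<bar>y\<bar>) / (1 + norm (- x + z)) ^ (DIM('b) + 1)" for x y z
  proof -
    have "norm (- x + z) \<le> norm ((x, y) - (z, 0))"
      using norm_fst_le[of "x - z" y] by (simp add: norm_minus_commute)
    from C(2)[OF this, of "(0, 1)"] show ?thesis by simp
  qed
  with C(1) show ?thesis using that by blast
qed

lemma
  shows integrable_grad: "integrable lborel (\<lambda>z. grad z p)"
    and grad_integral_bound: "\<exists>C\<ge>0. \<forall>p. (\<integral>z. norm (grad z p) \<partial>lborel) \<le> C * (1 + norm p)"
proof -
  obtain C where C: "C \<ge> 0" "\<And>x y z. norm (grad z (x, y)) \<le> C * (1 + \<bar>y\<bar>) / (1 + norm (- x + z)) ^ (DIM('b) + 1)"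
    by (rule grad_bound) (rule that)
  define I where "I = (\<integral>z. 1 / (1 + norm z) ^ (DIM('b) + 1) \<partial>(lborel :: 'b measure))"
  have dom: "integrable lborel (\<lambda>z::'b. (C * (1 + \<bar>y\<bar>)) / (1 + norm (- x + z)) ^ (DIM('b) + 1))" for x :: 'b and y :: real
    by (rule integrable_lborel_translate[OF integrable_decay])
  have int: "integrable lborel (\<lambda>z. grad z (x, y))" for x y
    by (rule integrable_of_norm_le[OF dom[of y x] _ C(2)]) measurable
  then show "integrable lborel (\<lambda>z. grad z p)" by (cases p) simp
  have "(\<integral>z. norm (grad z p) \<partial>lborel) \<le> (C * I) * (1 + norm p)" for p
  proof -
    obtain x y where p: "p = (x, y)" by (cases p)
    have "(\<integral>z. norm (grad z (x, y)) \<partial>lborel) \<le> (\<integral>z. (C * (1 + \<bar>y\<bar>)) / (1 + norm (- x + z)) ^ (DIM('b) + 1) \<partial>lborel)"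
      by (intro Bochner_Integration.integral_mono integrable_norm int dom C(2))
    also have "\<dots> = (\<integral>z. (C * (1 + \<bar>y\<bar>)) / (1 + norm z) ^ (DIM('b) + 1) \<partial>(lborel :: 'b measure))"
      by (rule integral_lborel_translate[where F = "\<lambda>z::'b. (C * (1 + \<bar>y\<bar>)) / (1 + norm z) ^ (DIM('b) + 1)"]) measurable
    also have "\<dots> = (\<integral>z. (C * (1 + \<bar>y\<bar>)) * (1 / (1 + norm z) ^ (DIM('b) + 1)) \<partial>(lborel :: 'b measure))"
      by simp
    also have "\<dots> = (C * (1 + \<bar>y\<bar>)) * I" unfolding I_def by (rule integral_mult_right_zero)
    also have "\<dots> = (C * I) * (1 + \<bar>y\<bar>)" by simp
    also have "\<dots> \<le> (C * I) * (1 + norm p)"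
      using norm_snd_le[of y x] C(1) by (intro mult_left_mono) (auto simp: p I_def)
    finally show ?thesis by (simp add: p)
  qed
  moreover have "C * I \<ge> 0" using C(1) by (simp add: I_def)
  ultimately show "\<exists>C\<ge>0. \<forall>p. (\<integral>z. norm (grad z p) \<partial>lborel) \<le> C * (1 + norm p)" by blast
qed

text \<open>Up to the sign of \<open>\<eta>\<close> and a constant this is the transform of the
  backprojection. A singularity of order \<open>n - 1\<close> is integrable in dimension
  \<open>n + 1\<close>, and the decay of \<open>fourier f\<close> settles infinity; the exponent
  \<open>m\<close> equals 3.\<close>

lemma integrable_fourier_f_weight:
  "integrable lborel (\<lambda>\<zeta>. (1 / norm \<zeta> ^ (DIM('b) - 1)) *\<^sub>R fourier f \<zeta>)"
proof -
  define m where "m = DIM('b \<times> real) + 1 - (DIM('b) - 1)"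
  obtain C where C: "C \<ge> 0" "\<And>\<zeta>. norm (fourier f \<zeta>) \<le> C / (1 + norm \<zeta>) ^ m"
    by (rule fourier_schwartz_decay[OF schwartz]) (rule that)
  have "integrable lborel (\<lambda>\<zeta>::'b \<times> real. C * (1 / (norm \<zeta> ^ (DIM('b) - 1) * (1 + norm \<zeta>) ^ m)))"
    unfolding m_def by (intro integrable_mult_right integrable_norm_power_decay) simp
  then show ?thesis
  proof (rule integrable_of_norm_le)
    fix \<zeta> :: "'b \<times> real"
    have "norm ((1 / norm \<zeta> ^ (DIM('b) - 1)) *\<^sub>R fourier f \<zeta>) = (1 / norm \<zeta> ^ (DIM('b) - 1)) * norm (fourier f \<zeta>)"
      by (simp add: abs_of_nonneg)
    also have "\<dots> \<le> (1 / norm \<zeta> ^ (DIM('b) - 1)) * (C / (1 + norm \<zeta>) ^ m)"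
      by (intro mult_left_mono C(2)) simp
    finally show "norm ((1 / norm \<zeta> ^ (DIM('b) - 1)) *\<^sub>R fourier f \<zeta>) \<le>
        C * (1 / (norm \<zeta> ^ (DIM('b) - 1) * (1 + norm \<zeta>) ^ m))" by simp
  qed measurable
qed

section \<open>The transform of the backprojection tested against a fixed Schwartz function\<close>

context
  fixes \<phi> :: "'b \<times> real \<Rightarrow> complex"
  assumes \<phi>: "\<phi> \<in> schwartz"
begin

definition pairing :: "'b \<Rightarrow> complex" where
  "pairing z = (\<integral>p. grad z p * fourier \<phi> p \<partial>lborel)"

text \<open>The part of \<open>fourier (grad z) \<zeta> * \<phi> \<zeta>\<close> that is independent
  of \<open>z\<close>; the centre enters only through a phase multiplying it.\<close>

definition fourier_kernel :: "'b \<times> real \<Rightarrow> 'b \<times> real \<Rightarrow> complex" where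
  "fourier_kernel \<zeta> \<theta> = \<i> * of_real (snd \<zeta>) * \<phi> \<zeta> * fourier f (norm \<zeta> *\<^sub>R \<theta>)"

text \<open>The odd part of \<open>\<phi>\<close> in \<open>\<eta>\<close> on the sphere of radius \<open>s\<close>; truncation by \<open>max 0\<close> extends it
  continuously by 0 to \<open>norm \<xi> \<ge> s\<close>.\<close>

definition fold_odd :: "real \<Rightarrow> 'b \<Rightarrow> complex" where
  "fold_odd s \<xi> = \<phi> (\<xi>, sqrt (max 0 (s\<^sup>2 - (norm \<xi>)\<^sup>2))) - \<phi> (\<xi>, - sqrt (max 0 (s\<^sup>2 - (norm \<xi>)\<^sup>2)))"

lemmas \<phi>_measurable [measurable] = schwartz_measurable[OF \<phi>]

lemma \<phi>_integrable: "integrable lborel \<phi>"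
  using schwartz_integrable[OF \<phi>, of "[]"] by simp

lemma fold_odd_measurable [measurable (raw)]:
  assumes [measurable]: "u \<in> borel_measurable M" "v \<in> M \<rightarrow>\<^sub>M borel"
  shows "(\<lambda>x. fold_odd (u x) (v x)) \<in> borel_measurable M"
  unfolding fold_odd_def by measurable

lemma fourier_kernel_measurable [measurable (raw)]:
  assumes [measurable]: "u \<in> M \<rightarrow>\<^sub>M borel" "v \<in> M \<rightarrow>\<^sub>M borel"
  shows "(\<lambda>x. fourier_kernel (u x) (v x)) \<in> borel_measurable M"
  unfolding fourier_kernel_def by measurable

text \<open>Fubini is justified by iterated integrals: the integral of
  \<open>norm (grad z p)\<close> over \<open>z\<close> grows at most linearly in \<open>p\<close>,
  and \<open>fourier \<phi>\<close> decays rapidly. Integrability of \<open>pairing\<close> is what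
  later permits the removal of the cutoff.\<close>

lemma
  shows integral_backprojection_fourier:
      "(\<integral>p. (\<integral>z. grad z p \<partial>lborel) * fourier \<phi> p \<partial>lborel) = (\<integral>z. pairing z \<partial>lborel)"
    and pairing_integrable: "integrable lborel pairing"
proof -
  obtain C where C: "C \<ge> 0" "\<And>p. (\<integral>z. norm (grad z p) \<partial>lborel) \<le> C * (1 + norm p)"
    using grad_integral_bound by blast
  obtain K where K: "K \<ge> 0" "\<And>p. norm (fourier \<phi> p) \<le> K / (1 + norm p) ^ (DIM('b \<times> real) + 2)"
    by (rule fourier_schwartz_decay[OF \<phi>]) (rule that)
  have int: "integrable (lborel \<Otimes>\<^sub>M lborel) (\<lambda>(p, z). grad z p * fourier \<phi> p)"
  proof (rule lborel_pair.Fubini_integrable)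
    show "integrable lborel (\<lambda>p. \<integral>z. norm (case (p, z) of (p, z) \<Rightarrow> grad z p * fourier \<phi> p) \<partial>lborel)"
    proof (rule integrable_of_norm_le[OF integrable_mult_right[OF integrable_weighted_decay[OF _ K(2)], of C]])
      fix p :: "'b \<times> real"
      have "(\<integral>z. norm (grad z p * fourier \<phi> p) \<partial>lborel) = (\<integral>z. norm (grad z p) \<partial>lborel) * norm (fourier \<phi> p)"
        by (simp add: norm_mult)
      also have "\<dots> \<le> C * (1 + norm p) * norm (fourier \<phi> p)"
        by (intro mult_right_mono C(2)) simp
      finally show "norm (\<integral>z. norm (case (p, z) of (p, z) \<Rightarrow> grad z p * fourier \<phi> p) \<partial>lborel) \<le>
          C * ((1 + norm p) * norm (fourier \<phi> p))"
        by (simp add: mult.assoc integral_nonneg_AE)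
    qed measurable
    show "AE p in lborel. integrable lborel (\<lambda>z. case (p, z) of (p, z) \<Rightarrow> grad z p * fourier \<phi> p)"
      by (auto intro!: integrable_mult_left integrable_grad)
  qed measurable
  show "integrable lborel pairing"
    using lborel_pair.integrable_snd[OF int] by (simp add: pairing_def[abs_def])
  have "(\<integral>p. (\<integral>z. grad z p \<partial>lborel) * fourier \<phi> p \<partial>lborel) = (\<integral>p. (\<integral>z. grad z p * fourier \<phi> p \<partial>lborel) \<partial>lborel)"
    by simp
  also have "\<dots> = (\<integral>z. pairing z \<partial>lborel)"
    unfolding pairing_def by (rule lborel_pair.Fubini_integral[OF int, symmetric])
  finally show "(\<integral>p. (\<integral>z. grad z p \<partial>lborel) * fourier \<phi> p \<partial>lborel) = (\<integral>z. pairing z \<partial>lborel)" .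
qed

lemma \<phi>_weighted_integrable: "integrable lborel (\<lambda>\<zeta>. (1 + norm \<zeta>) * norm (\<phi> \<zeta>))"
proof -
  obtain K where "K \<ge> 0" "\<And>p. norm (iter_deriv [] \<phi> p) \<le> K / (1 + norm p) ^ (DIM('b \<times> real) + 2)"
    by (rule schwartz_decay[OF \<phi>, of "[]" "DIM('b \<times> real) + 2"]) (simp, rule that)
  then show ?thesis by (intro integrable_weighted_decay[of _ K]) auto
qed

lemma fourier_kernel_bound:
  obtains B where "B \<ge> 0" "\<And>\<zeta> \<theta>. norm (fourier_kernel \<zeta> \<theta>) \<le> B * ((1 + norm \<zeta>) * norm (\<phi> \<zeta>))"
proof -
  obtain B where B: "B \<ge> 0" "\<And>\<zeta>. norm (fourier f \<zeta>) \<le> B" by (rule fourier_f_bounded) (rule that)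
  have "norm (fourier_kernel \<zeta> \<theta>) \<le> B * ((1 + norm \<zeta>) * norm (\<phi> \<zeta>))" for \<zeta> \<theta>
  proof -
    have "\<bar>snd \<zeta>\<bar> \<le> 1 + norm \<zeta>" using norm_snd_le[of "snd \<zeta>" "fst \<zeta>"] by simp
    then have "\<bar>snd \<zeta>\<bar> * norm (\<phi> \<zeta>) * norm (fourier f (norm \<zeta> *\<^sub>R \<theta>)) \<le> (1 + norm \<zeta>) * norm (\<phi> \<zeta>) * B"
      by (intro mult_mono B(2)) auto
    then show ?thesis by (simp add: fourier_kernel_def norm_mult mult_ac)
  qed
  with B(1) show ?thesis using that by blast
qed

interpretation Q: pair_sigma_finite "lborel :: ('b \<times> real) measure" \<sigma> ..

interpretation ZQ: pair_sigma_finite "lborel :: 'b measure" "(lborel :: ('b \<times> real) measure) \<Otimes>\<^sub>M \<sigma>" ..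

lemma fourier_kernel_integrable: "integrable (lborel \<Otimes>\<^sub>M \<sigma>) (\<lambda>(\<zeta>, \<theta>). fourier_kernel \<zeta> \<theta>)"
proof -
  obtain B where B: "B \<ge> 0" "\<And>\<zeta> \<theta>. norm (fourier_kernel \<zeta> \<theta>) \<le> B * ((1 + norm \<zeta>) * norm (\<phi> \<zeta>))" by (rule fourier_kernel_bound) (rule that)
  show ?thesis
    by (rule Q.integrable_pair_bound[OF integrable_mult_right[OF \<phi>_weighted_integrable, of B], where g = "\<lambda>_. 1"])
       (use B in \<open>auto simp: abs_mult\<close>)
qed

lemma integrable_fourier_kernel_mult:
  assumes [measurable]: "c \<in> borel_measurable (borel \<Otimes>\<^sub>M borel)" and c: "\<And>\<zeta> \<theta>. norm (c (\<zeta>, \<theta>)) \<le> B"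
  shows "integrable (lborel \<Otimes>\<^sub>M \<sigma>) (\<lambda>(\<zeta>, \<theta>). fourier_kernel \<zeta> \<theta> * c (\<zeta>, \<theta>))"
proof (rule integrable_of_norm_le[OF integrable_mult_right[OF integrable_norm[OF fourier_kernel_integrable], of B]])
  have [measurable]: "c \<in> borel_measurable (lborel \<Otimes>\<^sub>M \<sigma>)"
    using assms(1) by (simp cong: measurable_cong_sets)
  show "(\<lambda>(\<zeta>, \<theta>). fourier_kernel \<zeta> \<theta> * c (\<zeta>, \<theta>)) \<in> borel_measurable (lborel \<Otimes>\<^sub>M \<sigma>)"
    by (simp add: split_beta')
  fix p :: "('b \<times> real) \<times> ('b \<times> real)"
  obtain \<zeta> \<theta> where p: "p = (\<zeta>, \<theta>)" by (cases p)
  have "norm (fourier_kernel \<zeta> \<theta> * c (\<zeta>, \<theta>)) \<le> norm (fourier_kernel \<zeta> \<theta>) * B"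
    unfolding norm_mult by (intro mult_left_mono c) simp
  then show "norm (case p of (\<zeta>, \<theta>) \<Rightarrow> fourier_kernel \<zeta> \<theta> * c (\<zeta>, \<theta>)) \<le> B * norm (case p of (\<zeta>, \<theta>) \<Rightarrow> fourier_kernel \<zeta> \<theta>)"
    by (simp add: p mult.commute)
qed

text \<open>For fixed \<open>z\<close> the function \<open>grad z\<close> is integrable, so the
  multiplication formula moves the transform from \<open>\<phi>\<close> onto it. In the resulting
  integral \<open>z\<close> occurs only in a phase of modulus 1.\<close>

lemma pairing_eq: "pairing z = (\<integral>(\<zeta>, \<theta>). fourier_kernel \<zeta> \<theta> * cis (z \<bullet> (norm \<zeta> *\<^sub>R fst \<theta> - fst \<zeta>)) \<partial>(lborel \<Otimes>\<^sub>M \<sigma>))"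
proof -
  have int: "integrable (lborel \<Otimes>\<^sub>M \<sigma>) (\<lambda>(\<zeta>, \<theta>). fourier_kernel \<zeta> \<theta> * cis (z \<bullet> (norm \<zeta> *\<^sub>R fst \<theta> - fst \<zeta>)))"
    using integrable_fourier_kernel_mult[of "\<lambda>(\<zeta>, \<theta>). cis (z \<bullet> (norm \<zeta> *\<^sub>R fst \<theta> - fst \<zeta>))" 1] by (simp add: norm_mult)
  have b: "norm (0 :: 'b, 1 :: real) = 1" by simp
  have "pairing z = (\<integral>\<zeta>. fourier (grad z) \<zeta> * \<phi> \<zeta> \<partial>lborel)"
    unfolding pairing_def by (rule fourier_multiplication_formula[OF integrable_sphere_int_grad[OF b] \<phi>_integrable])
  also have "\<dots> = (\<integral>\<zeta>. (\<integral>\<theta>. fourier_kernel \<zeta> \<theta> * cis (z \<bullet> (norm \<zeta> *\<^sub>R fst \<theta> - fst \<zeta>)) \<partial>\<sigma>) \<partial>lborel)"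
  proof (rule Bochner_Integration.integral_cong[OF refl])
    fix \<zeta> :: "'b \<times> real"
    have "fourier (grad z) \<zeta> * \<phi> \<zeta> = (\<i> * of_real (snd \<zeta>) * \<phi> \<zeta>) *
        (\<integral>\<theta>. cis (z \<bullet> (norm \<zeta> *\<^sub>R fst \<theta> - fst \<zeta>)) * fourier f (norm \<zeta> *\<^sub>R \<theta>) \<partial>\<sigma>)"
      unfolding fourier_sphere_int_grad[OF b] by (simp add: inner_prod_def)
    also have "\<dots> = (\<integral>\<theta>. (\<i> * of_real (snd \<zeta>) * \<phi> \<zeta>) * (cis (z \<bullet> (norm \<zeta> *\<^sub>R fst \<theta> - fst \<zeta>)) * fourier f (norm \<zeta> *\<^sub>R \<theta>)) \<partial>\<sigma>)"
      by (rule integral_mult_right_zero[symmetric])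
    finally show "fourier (grad z) \<zeta> * \<phi> \<zeta> = (\<integral>\<theta>. fourier_kernel \<zeta> \<theta> * cis (z \<bullet> (norm \<zeta> *\<^sub>R fst \<theta> - fst \<zeta>)) \<partial>\<sigma>)"
      by (simp add: fourier_kernel_def mult_ac)
  qed
  also have "\<dots> = (\<integral>(\<zeta>, \<theta>). fourier_kernel \<zeta> \<theta> * cis (z \<bullet> (norm \<zeta> *\<^sub>R fst \<theta> - fst \<zeta>)) \<partial>(lborel \<Otimes>\<^sub>M \<sigma>))"
    using Q.integral_fst'[OF int] by simp
  finally show ?thesis .
qed

text \<open>With the Gaussian weight the triple integral converges absolutely, so \<open>z\<close>
  may be integrated first; the phase then becomes the Gaussian kernel.\<close>

lemma integral_gauss_pairing:
  assumes \<epsilon>: "\<epsilon> > 0"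
  shows "(\<integral>z. of_real (exp (- (\<epsilon> * norm z)\<^sup>2 / 2)) * pairing z \<partial>lborel) =
    (\<integral>(\<zeta>, \<theta>). fourier_kernel \<zeta> \<theta> * of_real (gauss_kernel \<epsilon> (norm \<zeta> *\<^sub>R fst \<theta> - fst \<zeta>)) \<partial>(lborel \<Otimes>\<^sub>M \<sigma>))"
proof -
  define e where "e = (\<lambda>z::'b. exp (- (\<epsilon> * norm z)\<^sup>2 / 2))"
  have [measurable]: "e \<in> borel_measurable borel" unfolding e_def by measurable
  have e: "integrable lborel e" unfolding e_def by (rule integrable_gauss_scaled[OF \<epsilon>])
  define k where "k = (\<lambda>z q. of_real (e z) * (fourier_kernel (fst q) (snd q) * cis (z \<bullet> (norm (fst q) *\<^sub>R fst (snd q) - fst (fst q)))))"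
  have "integrable (lborel \<Otimes>\<^sub>M (lborel \<Otimes>\<^sub>M \<sigma>)) (\<lambda>(z, q). k z q)"
  proof (rule ZQ.integrable_pair_bound[OF e integrable_norm[OF fourier_kernel_integrable]])
    show "(\<lambda>(z, q). k z q) \<in> borel_measurable (lborel \<Otimes>\<^sub>M (lborel \<Otimes>\<^sub>M \<sigma>))"
      unfolding k_def by measurable
  qed (auto simp: k_def norm_mult split_beta')
  then have "(\<integral>q. (\<integral>z. k z q \<partial>lborel) \<partial>(lborel \<Otimes>\<^sub>M \<sigma>)) = (\<integral>z. (\<integral>q. k z q \<partial>(lborel \<Otimes>\<^sub>M \<sigma>)) \<partial>lborel)"
    by (rule ZQ.Fubini_integral)
  moreover have "(\<integral>q. k z q \<partial>(lborel \<Otimes>\<^sub>M \<sigma>)) = of_real (e z) * pairing z" for z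
    unfolding pairing_eq k_def split_beta' by (rule integral_mult_right_zero)
  moreover have "(\<integral>z. k z q \<partial>lborel) = fourier_kernel (fst q) (snd q) * of_real (gauss_kernel \<epsilon> (norm (fst q) *\<^sub>R fst (snd q) - fst (fst q)))" for q
    unfolding integral_gauss_kernel_cis[OF \<epsilon>, symmetric] k_def e_def
    by (subst integral_mult_right_zero[symmetric]) (simp only: mult_ac)
  ultimately show ?thesis by (simp add: e_def split_beta')
qed


text \<open>The convolution of \<open>fold_odd s\<close> with the Gaussian kernel, evaluated at
  \<open>s *\<^sub>R fst \<theta>\<close>, the point at which the Dirac mass will sit.\<close>

definition fold_gauss :: "real \<Rightarrow> real \<Rightarrow> 'b \<times> real \<Rightarrow> complex" where
  "fold_gauss \<epsilon> s \<theta> = (\<integral>\<xi>. fold_odd s \<xi> * of_real (gauss_kernel \<epsilon> (s *\<^sub>R fst \<theta> - \<xi>)) \<partial>lborel)"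

lemma fold_gauss_measurable [measurable (raw)]:
  assumes [measurable]: "u \<in> borel_measurable M" "v \<in> M \<rightarrow>\<^sub>M borel"
  shows "(\<lambda>x. fold_gauss \<epsilon> (u x) (v x)) \<in> borel_measurable M"
  unfolding fold_gauss_def by measurable

lemma fold_odd_decay:
  obtains C where "C \<ge> 0" "\<And>s \<xi>. norm (fold_odd s \<xi>) \<le> C / (1 + norm \<xi>) ^ m"
proof -
  obtain C where C: "C \<ge> 0" "\<And>p. norm (iter_deriv [] \<phi> p) \<le> C / (1 + norm p) ^ m"
    by (rule schwartz_decay[OF \<phi>, of "[]" m]) (simp, rule that)
  have le: "norm (\<phi> (\<xi>, y)) \<le> C / (1 + norm \<xi>) ^ m" for \<xi> y
  proof -
    have "norm (\<phi> (\<xi>, y)) \<le> C / (1 + norm (\<xi>, y)) ^ m" using C(2)[of "(\<xi>, y)"] by simp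
    also have "\<dots> \<le> C / (1 + norm \<xi>) ^ m"
      using C(1) norm_fst_le[of \<xi> y] by (intro divide_left_mono power_mono mult_pos_pos zero_less_power) (auto simp: add_pos_nonneg)
    finally show ?thesis .
  qed
  have "norm (fold_odd s \<xi>) \<le> (2 * C) / (1 + norm \<xi>) ^ m" for s \<xi>
    unfolding fold_odd_def using norm_triangle_ineq4 le[of \<xi>]
    by (smt (verit) add_divide_distrib)
  with C(1) show ?thesis using that[of "2 * C"] by simp
qed

lemma fold_odd_bounded: obtains B where "B \<ge> 0" "\<And>s \<xi>. norm (fold_odd s \<xi>) \<le> B"
  using fold_odd_decay[of 0] by auto

lemma isCont_fold_odd: "isCont (fold_odd s) \<xi>"
proof -
  have c: "continuous_on UNIV \<phi>"
    using schwartz_isCont[OF \<phi>] by (simp add: continuous_on_eq_continuous_at)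
  have "continuous_on UNIV (fold_odd s)"
    unfolding fold_odd_def
    by (intro continuous_on_diff continuous_on_compose2[OF c] continuous_intros) auto
  then show ?thesis by (simp add: continuous_on_eq_continuous_at)
qed

lemma fold_gauss_bound:
  obtains B where "B \<ge> 0" "\<And>\<epsilon> s \<theta>. \<epsilon> > 0 \<Longrightarrow> norm (fold_gauss \<epsilon> s \<theta>) \<le> B"
proof -
  obtain B where B: "B \<ge> 0" "\<And>s \<xi>. norm (fold_odd s \<xi>) \<le> B" by (rule fold_odd_bounded) (rule that)
  have "norm (fold_gauss \<epsilon> s \<theta>) \<le> B * (2 * pi) ^ DIM('b)" if "\<epsilon> > 0" for \<epsilon> s \<theta>
    unfolding fold_gauss_def by (rule norm_integral_times_gauss_kernel_le[OF _ B(2) that]) measurable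
  with B(1) show ?thesis using that[of "B * (2 * pi) ^ DIM('b)"] by simp
qed

lemma fold_gauss_LIMSEQ: "(\<lambda>k. fold_gauss (inverse (real (Suc k))) s \<theta>) \<longlonglongrightarrow> of_real ((2 * pi) ^ DIM('b)) * fold_odd s (s *\<^sub>R fst \<theta>)"
proof -
  obtain B where B: "B \<ge> 0" "\<And>s \<xi>. norm (fold_odd s \<xi>) \<le> B" by (rule fold_odd_bounded) (rule that)
  show ?thesis unfolding fold_gauss_def
    by (rule gauss_kernel_approx_identity[OF _ B(2) isCont_fold_odd]) measurable
qed

text \<open>For a fixed unit vector \<open>\<theta>\<close> and fixed \<open>\<xi>\<close>,
  everything except \<open>\<eta> * \<phi> (\<xi>, \<eta>)\<close> depends on \<open>\<eta>\<close>
  only through \<open>s = norm (\<xi>, \<eta>)\<close>, so the \<open>\<eta>\<close>-integral folds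
  into an \<open>s\<close>-integral. Exchanging \<open>\<xi>\<close> and \<open>s\<close> then
  collects the convolution.\<close>

lemma integral_fourier_kernel_slice:
  assumes \<theta>: "norm \<theta> = 1" and \<epsilon>: "\<epsilon> > 0"
  shows "(\<integral>\<zeta>. fourier_kernel \<zeta> \<theta> * of_real (gauss_kernel \<epsilon> (norm \<zeta> *\<^sub>R fst \<theta> - fst \<zeta>)) \<partial>lborel) =
    (\<integral>s. (s * indicator {0<..} s) *\<^sub>R (\<i> * fourier f (s *\<^sub>R \<theta>) * fold_gauss \<epsilon> s \<theta>) \<partial>lborel)"
proof -
  define c where "c = (sqrt (2 * pi) / \<epsilon>) ^ DIM('b)"
  have c: "c \<ge> 0" using \<epsilon> by (simp add: c_def)
  have gk: "\<bar>gauss_kernel \<epsilon> v\<bar> \<le> c" for v :: 'b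
    using gauss_kernel_le[OF \<epsilon>, of v] gauss_kernel_nonneg[OF \<epsilon>, of v] by (simp add: c_def)
  define F where "F = (\<lambda>\<zeta>. fourier_kernel \<zeta> \<theta> * of_real (gauss_kernel \<epsilon> (norm \<zeta> *\<^sub>R fst \<theta> - fst \<zeta>)))"
  have [measurable]: "F \<in> borel_measurable borel" unfolding F_def by measurable
  obtain B where B: "B \<ge> 0" "\<And>\<zeta> \<theta>. norm (fourier_kernel \<zeta> \<theta>) \<le> B * ((1 + norm \<zeta>) * norm (\<phi> \<zeta>))"
    by (rule fourier_kernel_bound) (rule that)
  have "integrable lborel F"
  proof (rule integrable_of_norm_le[OF integrable_mult_right[OF \<phi>_weighted_integrable, of "B * c"]])
    fix \<zeta> :: "'b \<times> real"
    have "norm (F \<zeta>) \<le> B * ((1 + norm \<zeta>) * norm (\<phi> \<zeta>)) * c"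
      unfolding F_def norm_mult using B gk by (intro mult_mono) auto
    then show "norm (F \<zeta>) \<le> B * c * ((1 + norm \<zeta>) * norm (\<phi> \<zeta>))" by (simp only: mult_ac)
  qed measurable
  then have F: "integrable (lborel \<Otimes>\<^sub>M lborel) F" unfolding lborel_prod .
  define K where "K = (\<lambda>\<xi> s. \<i> * fourier f (s *\<^sub>R \<theta>) * of_real (gauss_kernel \<epsilon> (s *\<^sub>R fst \<theta> - \<xi>)))"
  \<comment> \<open>The range of \<open>s\<close> is made independent of \<open>\<xi>\<close>, ready
    for the exchange: \<open>fold_odd s \<xi>\<close> vanishes for
    \<open>0 < s \<le> norm \<xi>\<close>, so \<open>{norm \<xi><..}\<close> can be widened to
    \<open>{0<..}\<close>.\<close>
  define k where "k = (\<lambda>\<xi> s. (s * indicator {0<..} s) *\<^sub>R (fold_odd s \<xi> * K \<xi> s))"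
  \<comment> \<open>Two null sets are left out: the \<open>\<xi>\<close> whose slice of
    \<open>F\<close> is not integrable, and \<open>\<xi> = 0\<close>, where the substitution
    degenerates.\<close>
  have inner: "AE \<xi> in lborel. (\<integral>\<eta>. F (\<xi>, \<eta>) \<partial>lborel) = (\<integral>s. k \<xi> s \<partial>lborel)"
    using lborel_pair.AE_integrable_fst'[OF F] AE_lborel_singleton[of 0]
  proof eventually_elim
    case (elim \<xi>)
    have a: "norm \<xi> > 0" using elim(2) by simp
    have F_eq: "F (\<xi>, \<eta>) = of_real \<eta> * \<phi> (\<xi>, \<eta>) * K \<xi> (sqrt ((norm \<xi>)\<^sup>2 + \<eta>\<^sup>2))" for \<eta>
      by (simp add: F_def fourier_kernel_def K_def norm_Pair)
    have [measurable]: "K \<xi> \<in> borel_measurable borel" unfolding K_def by measurable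
    have "(\<integral>\<eta>. F (\<xi>, \<eta>) \<partial>lborel) =
        (\<integral>s. (s * indicator {norm \<xi><..} s) *\<^sub>R ((\<phi> (\<xi>, sqrt (s\<^sup>2 - (norm \<xi>)\<^sup>2)) - \<phi> (\<xi>, - sqrt (s\<^sup>2 - (norm \<xi>)\<^sup>2))) * K \<xi> s) \<partial>lborel)"
      unfolding F_eq
      by (rule integral_fold_sqrt[OF a, of "\<lambda>\<eta>. \<phi> (\<xi>, \<eta>)", OF _ _ elim(1)[unfolded F_eq]]) measurable
    also have "\<dots> = (\<integral>s. k \<xi> s \<partial>lborel)"
    proof (rule Bochner_Integration.integral_cong[OF refl])
      fix s :: real
      consider "s \<le> 0" | "0 < s" "s \<le> norm \<xi>" | "norm \<xi> < s" "0 < s" using a by linarith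
      then show "(s * indicator {norm \<xi><..} s) *\<^sub>R ((\<phi> (\<xi>, sqrt (s\<^sup>2 - (norm \<xi>)\<^sup>2)) - \<phi> (\<xi>, - sqrt (s\<^sup>2 - (norm \<xi>)\<^sup>2))) * K \<xi> s) = k \<xi> s"
      proof cases
        case 1
        then have "\<not> norm \<xi> < s" using a by linarith
        then show ?thesis using 1 by (simp add: k_def)
      next
        case 2
        then have "s\<^sup>2 \<le> (norm \<xi>)\<^sup>2" by (intro power_mono) auto
        then show ?thesis using 2 by (simp add: k_def fold_odd_def max_def)
      next
        case 3
        then have "(norm \<xi>)\<^sup>2 \<le> s\<^sup>2" by (intro power_mono) auto
        then show ?thesis using 3 by (simp add: k_def fold_odd_def max_def)
      qed
    qed
    finally show ?case .
  qed
  have k: "integrable (lborel \<Otimes>\<^sub>M lborel) (\<lambda>(\<xi>, s). k \<xi> s)"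
  proof -
    obtain C where C: "C \<ge> 0" "\<And>s \<xi>. norm (fold_odd s \<xi>) \<le> C / (1 + norm \<xi>) ^ (DIM('b) + 1)"
      by (rule fold_odd_decay) (rule that)
    \<comment> \<open>Of the three powers one absorbs the factor \<open>s\<close>; the other two
      make the bound integrable over \<open>s\<close>.\<close>
    obtain C' where C': "C' \<ge> 0" "\<And>\<zeta>. norm (fourier f \<zeta>) \<le> C' / (1 + norm \<zeta>) ^ 3"
      by (rule fourier_schwartz_decay[OF schwartz]) (rule that)
    show ?thesis
    proof (rule lborel_pair.integrable_pair_bound[OF integrable_decay[of "C * c"] integrable_decay[of C']])
      show "AE \<xi> in lborel. AE s in lborel. norm (k \<xi> s) \<le>
        \<bar>C * c / (1 + norm (\<xi> :: 'b)) ^ (DIM('b) + 1)\<bar> * \<bar>C' / (1 + norm (s :: real)) ^ (DIM(real) + 1)\<bar>"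
      proof (intro AE_I2)
        fix \<xi> :: 'b and s :: real
        have 1: "\<bar>s * indicator {0<..} s\<bar> * norm (fourier f (s *\<^sub>R \<theta>)) \<le> C' / (1 + norm s) ^ (DIM(real) + 1)"
        proof (cases "s > 0")
          case True
          have "s * norm (fourier f (s *\<^sub>R \<theta>)) \<le> (1 + s) * (C' / (1 + s) ^ 3)"
            using C'(2)[of "s *\<^sub>R \<theta>"] \<theta> True by (intro mult_mono) auto
          also have "\<dots> = C' / (1 + s) ^ 2" using True by (simp add: power3_eq_cube power2_eq_square)
          finally show ?thesis using True by (simp add: power2_eq_square)
        qed (use C' in simp)
        have "norm (k \<xi> s) = (norm (fold_odd s \<xi>) * \<bar>gauss_kernel \<epsilon> (s *\<^sub>R fst \<theta> - \<xi>)\<bar>) * (\<bar>s * indicator {0<..} s\<bar> * norm (fourier f (s *\<^sub>R \<theta>)))"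
          by (simp add: k_def K_def norm_mult abs_mult)
        also have "\<dots> \<le> (C / (1 + norm \<xi>) ^ (DIM('b) + 1) * c) * (C' / (1 + norm s) ^ (DIM(real) + 1))"
          using C(1) c by (intro mult_mono C(2) gk 1 mult_nonneg_nonneg) (auto simp: add_nonneg_nonneg)
        also have "\<dots> \<le> \<bar>C * c / (1 + norm \<xi>) ^ (DIM('b) + 1)\<bar> * \<bar>C' / (1 + norm s) ^ (DIM(real) + 1)\<bar>"
          unfolding abs_mult[symmetric] by (rule order_trans[OF _ abs_ge_self]) simp
        finally show "norm (k \<xi> s) \<le> \<bar>C * c / (1 + norm \<xi>) ^ (DIM('b) + 1)\<bar> * \<bar>C' / (1 + norm s) ^ (DIM(real) + 1)\<bar>" .
      qed
    qed (unfold k_def K_def, measurable)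
  qed
  have "(\<integral>\<zeta>. F \<zeta> \<partial>lborel) = (\<integral>\<zeta>. F \<zeta> \<partial>(lborel \<Otimes>\<^sub>M lborel))" unfolding lborel_prod ..
  also have "\<dots> = (\<integral>\<xi>. (\<integral>\<eta>. F (\<xi>, \<eta>) \<partial>lborel) \<partial>lborel)"
    by (rule lborel_pair.integral_fst'[OF F, symmetric])
  also have "\<dots> = (\<integral>\<xi>. (\<integral>s. k \<xi> s \<partial>lborel) \<partial>lborel)"
    by (rule integral_cong_AE[OF _ _ inner]) (simp_all add: k_def K_def)
  also have "\<dots> = (\<integral>s. (\<integral>\<xi>. k \<xi> s \<partial>lborel) \<partial>lborel)"
    by (rule lborel_pair.Fubini_integral[OF k, symmetric])
  also have "\<dots> = (\<integral>s. (s * indicator {0<..} s) *\<^sub>R (\<i> * fourier f (s *\<^sub>R \<theta>) * fold_gauss \<epsilon> s \<theta>) \<partial>lborel)"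
  proof (rule Bochner_Integration.integral_cong[OF refl])
    fix s :: real
    have "(\<integral>\<xi>. k \<xi> s \<partial>lborel) = (\<integral>\<xi>. (of_real (s * indicator {0<..} s) * (\<i> * fourier f (s *\<^sub>R \<theta>))) *
        (fold_odd s \<xi> * of_real (gauss_kernel \<epsilon> (s *\<^sub>R fst \<theta> - \<xi>))) \<partial>lborel)"
      by (simp add: k_def K_def scaleR_conv_of_real mult_ac)
    also have "\<dots> = (of_real (s * indicator {0<..} s) * (\<i> * fourier f (s *\<^sub>R \<theta>))) * fold_gauss \<epsilon> s \<theta>"
      unfolding fold_gauss_def by (rule integral_mult_right_zero)
    finally show "(\<integral>\<xi>. k \<xi> s \<partial>lborel) = (s * indicator {0<..} s) *\<^sub>R (\<i> * fourier f (s *\<^sub>R \<theta>) * fold_gauss \<epsilon> s \<theta>)"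
      by (simp add: scaleR_conv_of_real mult.assoc)
  qed
  finally show ?thesis unfolding F_def .
qed

text \<open>Division by \<open>s ^ (n - 1)\<close> turns the weight \<open>s\<close> left by the
  substitution into the weight \<open>s ^ n\<close> of the radial measure in dimension
  \<open>n + 1\<close>.\<close>

definition polar_integrand :: "real \<Rightarrow> real \<times> ('b \<times> real) \<Rightarrow> complex" where
  "polar_integrand \<epsilon> = (\<lambda>(s, \<theta>). (1 / s ^ (DIM('b) - 1)) *\<^sub>R (\<i> * fourier f (s *\<^sub>R \<theta>) * fold_gauss \<epsilon> s \<theta>))"

lemma polar_integrand_measurable [measurable]: "polar_integrand \<epsilon> \<in> borel_measurable (borel \<Otimes>\<^sub>M borel)"
  unfolding polar_integrand_def by measurable

text \<open>The majorant is independent of \<open>\<epsilon>\<close>: the integrable singular weight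
  times \<open>fourier f\<close>, multiplied by the uniform bound of
  \<open>fold_gauss\<close>.\<close>

lemma polar_integrand_dominated:
  obtains w where "integrable P w" "\<And>\<epsilon>. \<epsilon> > 0 \<Longrightarrow> AE p in P. norm (polar_integrand \<epsilon> p) \<le> w p"
proof -
  obtain B where B: "B \<ge> 0" "\<And>\<epsilon> s \<theta>. \<epsilon> > 0 \<Longrightarrow> norm (fold_gauss \<epsilon> s \<theta>) \<le> B" by (rule fold_gauss_bound) (rule that)
  define M where "M = (\<lambda>\<zeta>. (1 / norm \<zeta> ^ (DIM('b) - 1)) *\<^sub>R fourier f \<zeta>)"
  have [measurable]: "M \<in> borel_measurable borel" unfolding M_def by measurable
  have M: "integrable P (\<lambda>(s, \<theta>). M (s *\<^sub>R \<theta>))"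
    using integrable_fourier_f_weight by (subst integrable_polar_iff[symmetric]) (simp_all add: M_def)
  show ?thesis
  proof
    show "integrable P (\<lambda>p. B * norm (case p of (s, \<theta>) \<Rightarrow> M (s *\<^sub>R \<theta>)))"
      by (intro integrable_mult_right integrable_norm M)
    show "AE p in P. norm (polar_integrand \<epsilon> p) \<le> B * norm (case p of (s, \<theta>) \<Rightarrow> M (s *\<^sub>R \<theta>))" if \<epsilon>: "\<epsilon> > 0" for \<epsilon>
    proof (rule polar_pair.AE_pair_measure)
      show "AE s in radial_measure DIM('b \<times> real). AE \<theta> in \<sigma>.
          norm (polar_integrand \<epsilon> (s, \<theta>)) \<le> B * norm (case (s, \<theta>) of (s, \<theta>) \<Rightarrow> M (s *\<^sub>R \<theta>))"
        using AE_radial_measure_pos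
      proof eventually_elim
        case (elim s)
        show ?case using AE_sphere_measure_norm
        proof eventually_elim
          case (elim \<theta>)
          have "norm (polar_integrand \<epsilon> (s, \<theta>)) = norm (M (s *\<^sub>R \<theta>)) * norm (fold_gauss \<epsilon> s \<theta>)"
            using elim \<open>0 < s\<close> by (simp add: polar_integrand_def M_def norm_mult)
          also have "\<dots> \<le> norm (M (s *\<^sub>R \<theta>)) * B"
            by (intro mult_left_mono B(2)[OF \<epsilon>]) simp
          finally show ?case by (simp add: mult.commute)
        qed
      qed
    qed measurable
  qed
qed

lemma polar_integrand_integrable: "\<epsilon> > 0 \<Longrightarrow> integrable P (polar_integrand \<epsilon>)"
proof -
  assume \<epsilon>: "\<epsilon> > 0"
  obtain w where w: "integrable P w" "\<And>\<epsilon>. \<epsilon> > 0 \<Longrightarrow> AE p in P. norm (polar_integrand \<epsilon> p) \<le> w p" by (rule polar_integrand_dominated) (rule that)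
  show "integrable P (polar_integrand \<epsilon>)"
    by (rule Bochner_Integration.integrable_bound[OF w(1)]) (measurable, use w(2)[OF \<epsilon>] in \<open>auto elim!: eventually_mono\<close>)
qed

text \<open>The original frequency has been integrated out. Its norm \<open>s\<close> and the
  direction \<open>\<theta>\<close> of the sphere integral, so far unrelated, become the polar
  coordinates of a new frequency \<open>s *\<^sub>R \<theta>\<close>.\<close>

lemma integral_gauss_pairing_polar:
  assumes \<epsilon>: "\<epsilon> > 0"
  shows "(\<integral>z. of_real (exp (- (\<epsilon> * norm z)\<^sup>2 / 2)) * pairing z \<partial>lborel) = (\<integral>p. polar_integrand \<epsilon> p \<partial>P)"
proof -
  let ?k = "\<lambda>\<zeta> \<theta>. fourier_kernel \<zeta> \<theta> * of_real (gauss_kernel \<epsilon> (norm \<zeta> *\<^sub>R fst \<theta> - fst \<zeta>))"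
  have int: "integrable (lborel \<Otimes>\<^sub>M \<sigma>) (\<lambda>(\<zeta>, \<theta>). ?k \<zeta> \<theta>)"
  proof -
    have "norm (complex_of_real (gauss_kernel \<epsilon> v)) \<le> (sqrt (2 * pi) / \<epsilon>) ^ DIM('b)" for v :: 'b
      using gauss_kernel_le[OF \<epsilon>, of v] gauss_kernel_nonneg[OF \<epsilon>, of v] by simp
    then show ?thesis
      using integrable_fourier_kernel_mult[of "\<lambda>(\<zeta>, \<theta>). of_real (gauss_kernel \<epsilon> (norm \<zeta> *\<^sub>R fst \<theta> - fst \<zeta>))"
        "(sqrt (2 * pi) / \<epsilon>) ^ DIM('b)"] by simp
  qed
  have "(\<integral>z. of_real (exp (- (\<epsilon> * norm z)\<^sup>2 / 2)) * pairing z \<partial>lborel) = (\<integral>(\<zeta>, \<theta>). ?k \<zeta> \<theta> \<partial>(lborel \<Otimes>\<^sub>M \<sigma>))"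
    by (rule integral_gauss_pairing[OF \<epsilon>])
  also have "\<dots> = (\<integral>\<theta>. (\<integral>\<zeta>. ?k \<zeta> \<theta> \<partial>lborel) \<partial>\<sigma>)"
    by (rule Q.integral_snd[OF int, symmetric])
  also have "\<dots> = (\<integral>\<theta>. (\<integral>s. polar_integrand \<epsilon> (s, \<theta>) \<partial>radial_measure DIM('b \<times> real)) \<partial>\<sigma>)"
  proof (rule integral_cong_AE)
    show "AE \<theta> in \<sigma>. (\<integral>\<zeta>. ?k \<zeta> \<theta> \<partial>lborel) = (\<integral>s. polar_integrand \<epsilon> (s, \<theta>) \<partial>radial_measure DIM('b \<times> real))"
      using AE_sphere_measure_norm
    proof eventually_elim
      case (elim \<theta>)
      have "(\<integral>s. polar_integrand \<epsilon> (s, \<theta>) \<partial>radial_measure DIM('b \<times> real)) =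
          (\<integral>s. (s ^ (DIM('b \<times> real) - 1) * indicator {0<..} s) *\<^sub>R polar_integrand \<epsilon> (s, \<theta>) \<partial>lborel)"
        by (rule integral_radial_measure) measurable
      also have "\<dots> = (\<integral>s. (s * indicator {0<..} s) *\<^sub>R (\<i> * fourier f (s *\<^sub>R \<theta>) * fold_gauss \<epsilon> s \<theta>) \<partial>lborel)"
      proof (rule Bochner_Integration.integral_cong[OF refl])
        fix s :: real
        have "s ^ DIM('b) * (1 / s ^ (DIM('b) - 1)) = s" if "s > 0"
        proof -
          have "s ^ DIM('b) = s ^ (DIM('b) - 1) * s" by (rule power_minus_mult[symmetric]) simp
          then show ?thesis using that by simp
        qed
        then show "(s ^ (DIM('b \<times> real) - 1) * indicator {0<..} s) *\<^sub>R polar_integrand \<epsilon> (s, \<theta>) =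
            (s * indicator {0<..} s) *\<^sub>R (\<i> * fourier f (s *\<^sub>R \<theta>) * fold_gauss \<epsilon> s \<theta>)"
          by (auto simp: polar_integrand_def indicator_def simp del: times_divide_eq_right)
      qed
      also have "\<dots> = (\<integral>\<zeta>. ?k \<zeta> \<theta> \<partial>lborel)"
        by (rule integral_fourier_kernel_slice[OF elim \<epsilon>, symmetric])
      finally show ?case ..
    qed
  qed measurable
  also have "\<dots> = (\<integral>p. polar_integrand \<epsilon> p \<partial>P)"
    using polar_pair.integral_snd[where f = "\<lambda>s \<theta>. polar_integrand \<epsilon> (s, \<theta>)"] polar_integrand_integrable[OF \<epsilon>] by simp
  finally show ?thesis .
qed

text \<open>The limit of \<open>polar_integrand\<close> as the cutoff is removed, read as a function
  of the point \<open>\<zeta> = s *\<^sub>R \<theta>\<close>.\<close>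

definition limit_integrand :: "'b \<times> real \<Rightarrow> complex" where
  "limit_integrand \<zeta> = (1 / norm \<zeta> ^ (DIM('b) - 1)) *\<^sub>R (\<i> * fourier f \<zeta> * (of_real ((2 * pi) ^ DIM('b)) *
     (\<phi> (fst \<zeta>, \<bar>snd \<zeta>\<bar>) - \<phi> (fst \<zeta>, - \<bar>snd \<zeta>\<bar>))))"

lemma limit_integrand_measurable [measurable]: "limit_integrand \<in> borel_measurable borel"
  unfolding limit_integrand_def by measurable

text \<open>Both sides are limits of the cut-off integral of \<open>pairing\<close>: once directly,
  once in its polar form.\<close>

lemma integral_pairing_eq: "(\<integral>z. pairing z \<partial>lborel) = (\<integral>\<zeta>. limit_integrand \<zeta> \<partial>lborel)"
proof (rule LIMSEQ_unique)
  define \<epsilon> where "\<epsilon> = (\<lambda>k. inverse (real (Suc k)))"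
  have \<epsilon>: "\<epsilon> k > 0" for k by (simp add: \<epsilon>_def)
  show "(\<lambda>k. \<integral>z. of_real (exp (- (\<epsilon> k * norm z)\<^sup>2 / 2)) * pairing z \<partial>lborel) \<longlonglongrightarrow> (\<integral>z. pairing z \<partial>lborel)"
    unfolding \<epsilon>_def by (rule gauss_cutoff_LIMSEQ[OF pairing_integrable])
  have [measurable]: "(\<lambda>(s, \<theta>). limit_integrand (s *\<^sub>R \<theta>)) \<in> borel_measurable P" by measurable
  obtain w where w: "integrable P w" "\<And>\<epsilon>. \<epsilon> > 0 \<Longrightarrow> AE p in P. norm (polar_integrand \<epsilon> p) \<le> w p" by (rule polar_integrand_dominated) (rule that)
  have "(\<lambda>k. \<integral>p. polar_integrand (\<epsilon> k) p \<partial>P) \<longlonglongrightarrow> (\<integral>(s, \<theta>). limit_integrand (s *\<^sub>R \<theta>) \<partial>P)"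
  proof (rule integral_dominated_convergence[OF _ _ w(1)])
    show "AE p in P. (\<lambda>k. polar_integrand (\<epsilon> k) p) \<longlonglongrightarrow> (case p of (s, \<theta>) \<Rightarrow> limit_integrand (s *\<^sub>R \<theta>))"
    proof -
      have "AE p in P. fst p > 0"
        by (rule polar_pair.AE_pair_measure) (measurable, use AE_radial_measure_pos in eventually_elim, simp)
      moreover have "AE p in P. norm (snd p) = 1"
        by (rule polar_pair.AE_pair_measure) (measurable, use AE_sphere_measure_norm[where 'a = "'b \<times> real"] in simp)
      ultimately show ?thesis
      proof eventually_elim
        case (elim p)
        obtain s \<theta> where p: "p = (s, \<theta>)" by (cases p)
        have s: "s > 0" and \<theta>: "norm \<theta> = 1" using elim by (simp_all add: p)
        have "(norm (fst \<theta>))\<^sup>2 + (snd \<theta>)\<^sup>2 = 1" using \<theta> by (simp add: norm_prod_def)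
        \<comment> \<open>On the unit sphere the radicand is the square of
          \<open>s * snd \<theta>\<close>, so the fold evaluates \<open>\<phi>\<close> exactly at
          \<open>s *\<^sub>R \<theta>\<close> and at its reflection.\<close>
        then have "s\<^sup>2 - (norm (s *\<^sub>R fst \<theta>))\<^sup>2 = (s * snd \<theta>)\<^sup>2"
          by (simp add: power_mult_distrib algebra_simps distrib_left[symmetric])
        then have fold_odd: "fold_odd s (s *\<^sub>R fst \<theta>) = \<phi> (s *\<^sub>R fst \<theta>, \<bar>s * snd \<theta>\<bar>) - \<phi> (s *\<^sub>R fst \<theta>, - \<bar>s * snd \<theta>\<bar>)"
          unfolding fold_odd_def by (simp only: max_absorb2 zero_le_power2 real_sqrt_abs)
        have "(\<lambda>k. polar_integrand (\<epsilon> k) (s, \<theta>)) \<longlonglongrightarrow> (1 / s ^ (DIM('b) - 1)) *\<^sub>R (\<i> * fourier f (s *\<^sub>R \<theta>) *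
            (of_real ((2 * pi) ^ DIM('b)) * fold_odd s (s *\<^sub>R fst \<theta>)))"
          unfolding polar_integrand_def \<epsilon>_def prod.case by (intro tendsto_intros fold_gauss_LIMSEQ)
        also have "(1 / s ^ (DIM('b) - 1)) *\<^sub>R (\<i> * fourier f (s *\<^sub>R \<theta>) *
            (of_real ((2 * pi) ^ DIM('b)) * fold_odd s (s *\<^sub>R fst \<theta>))) = limit_integrand (s *\<^sub>R \<theta>)"
          using s \<theta> unfolding fold_odd by (simp add: limit_integrand_def)
        finally show ?case by (simp add: p)
      qed
    qed
    show "AE p in P. norm (polar_integrand (\<epsilon> k) p) \<le> w p" for k by (rule w(2)[OF \<epsilon>])
  qed measurable
  also have "(\<integral>(s, \<theta>). limit_integrand (s *\<^sub>R \<theta>) \<partial>P) = (\<integral>\<zeta>. limit_integrand \<zeta> \<partial>lborel)"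
    by (subst lborel_polar, subst integral_distr) (auto simp: split_beta')
  finally show "(\<lambda>k. \<integral>z. of_real (exp (- (\<epsilon> k * norm z)\<^sup>2 / 2)) * pairing z \<partial>lborel) \<longlonglongrightarrow> (\<integral>\<zeta>. limit_integrand \<zeta> \<partial>lborel)"
    by (simp only: integral_gauss_pairing_polar[OF \<epsilon>])
qed

text \<open>The difference in \<open>limit_integrand\<close> equals \<open>sgn \<eta>\<close> times
  \<open>\<phi> \<zeta> - \<phi> (flip \<zeta>)\<close>. Evenness of \<open>f\<close> makes
  \<open>fourier f\<close> invariant under \<open>flip\<close>, while \<open>sgn \<eta>\<close>
  changes sign, so both terms contribute the same integral; hence the factor 2.\<close>

lemma integral_limit_integrand:
  "(\<integral>\<zeta>. limit_integrand \<zeta> \<partial>lborel) = 2 * \<i> * of_real ((2 * pi) ^ DIM('b)) *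
    (\<integral>\<zeta>. of_real (sgn (snd \<zeta>)) * ((1 / norm \<zeta> ^ (DIM('b) - 1)) *\<^sub>R fourier f \<zeta>) * \<phi> \<zeta> \<partial>lborel)"
proof -
  define Y where "Y = (\<lambda>\<zeta>. of_real (sgn (snd \<zeta>)) * ((1 / norm \<zeta> ^ (DIM('b) - 1)) *\<^sub>R fourier f \<zeta>) * \<phi> \<zeta>)"
  have [measurable]: "(\<lambda>\<zeta>::'b \<times> real. sgn (snd \<zeta>)) \<in> borel_measurable borel" by measurable
  have [measurable]: "Y \<in> borel_measurable borel" unfolding Y_def by measurable
  obtain B where B: "B \<ge> 0" "\<And>p. norm (iter_deriv [] \<phi> p) \<le> B / (1 + norm p) ^ 0"
    by (rule schwartz_decay[OF \<phi>, of "[]" 0]) (simp, rule that)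
  have Y: "integrable lborel Y"
  proof (rule integrable_of_norm_le[OF integrable_mult_right[OF integrable_norm[OF integrable_fourier_f_weight], of B]])
    fix \<zeta> :: "'b \<times> real"
    define m where "m = norm ((1 / norm \<zeta> ^ (DIM('b) - 1)) *\<^sub>R fourier f \<zeta>)"
    have "norm (Y \<zeta>) = norm (complex_of_real (sgn (snd \<zeta>))) * m * norm (\<phi> \<zeta>)"
      unfolding Y_def norm_mult m_def ..
    also have "\<dots> \<le> 1 * m * B"
      using B by (intro mult_mono) (auto simp: m_def sgn_if)
    finally show "norm (Y \<zeta>) \<le> B * m" by (simp add: mult.commute)
  qed measurable
  have "fourier f (flip \<zeta>) = fourier f \<zeta>" for \<zeta>
  proof -
    have "f (flip p) = f p" for p by (cases p) (simp add: even)
    then show ?thesis using fourier_flip[of f \<zeta>] by simp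
  qed
  then have Y_flip: "Y (flip \<zeta>) = - (of_real (sgn (snd \<zeta>)) * ((1 / norm \<zeta> ^ (DIM('b) - 1)) *\<^sub>R fourier f \<zeta>) * \<phi> (flip \<zeta>))" for \<zeta>
  proof -
    have "snd (flip \<zeta>) = - snd \<zeta>" by (simp add: flip_def split_beta)
    then show ?thesis using \<open>fourier f (flip \<zeta>) = fourier f \<zeta>\<close> by (simp add: Y_def sgn_minus)
  qed
  have "limit_integrand \<zeta> = \<i> * of_real ((2 * pi) ^ DIM('b)) * (Y \<zeta> + Y (flip \<zeta>))" for \<zeta>
  proof -
    obtain x y where \<zeta>: "\<zeta> = (x, y)" by (cases \<zeta>)
    consider "y = 0" | "y > 0" | "y < 0" by linarith
    then show ?thesis
      by cases (simp_all add: Y_flip, simp_all add: \<zeta> limit_integrand_def Y_def scaleR_conv_of_real algebra_simps)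
  qed
  then have "(\<integral>\<zeta>. limit_integrand \<zeta> \<partial>lborel) = (\<integral>\<zeta>. \<i> * of_real ((2 * pi) ^ DIM('b)) * (Y \<zeta> + Y (flip \<zeta>)) \<partial>lborel)" by simp
  also have "\<dots> = \<i> * of_real ((2 * pi) ^ DIM('b)) * (\<integral>\<zeta>. Y \<zeta> + Y (flip \<zeta>) \<partial>lborel)" by (rule integral_mult_right_zero)
  also have "(\<integral>\<zeta>. Y \<zeta> + Y (flip \<zeta>) \<partial>lborel) = 2 * (\<integral>\<zeta>. Y \<zeta> \<partial>lborel)"
    using Y integrable_flip[OF Y] by (simp add: integral_flip)
  finally show ?thesis by (simp add: Y_def mult_ac)
qed

lemmas integral_backprojection_fourier_eq =
  integral_backprojection_fourier[unfolded integral_pairing_eq integral_limit_integrand]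

end

end

section \<open>The inversion formula\<close>

lemma tempered_function_integrable_fun:
  fixes F :: "'a::euclidean_space \<Rightarrow> complex"
  assumes "integrable lborel F"
  shows "tempered_function F"
  unfolding tempered_function_def using assms by (auto intro!: exI[of _ 0])

text \<open>It supplies the intermediate distribution between the two multipliers as a bounded
  function, the inverse Fourier integral of \<open>h\<close>. The identity of transforms follows
  from Fubini and the inversion formula for the Schwartz function.\<close>

lemma inverse_fourier_distribution:
  fixes h :: "'a::euclidean_space \<Rightarrow> complex"
  assumes h: "integrable lborel h"
  obtains u where "tempered_function u"
    "\<And>\<phi>. \<phi> \<in> schwartz \<Longrightarrow> fourier_distr (distr_of_fun u) \<phi> = distr_of_fun h \<phi>"
proof
  have [measurable]: "h \<in> borel_measurable borel" using h by auto
  define d where "d = complex_of_real ((2 * pi) ^ DIM('a))"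
  have d: "d \<noteq> 0" by (simp add: d_def)
  define u where "u = (\<lambda>p. (\<integral>\<zeta>. cis (p \<bullet> \<zeta>) * h \<zeta> \<partial>lborel) / d)"
  have [measurable]: "u \<in> borel_measurable borel" unfolding u_def by measurable
  show "tempered_function u"
  proof (rule tempered_functionI)
    show "norm (u p) \<le> ((\<integral>\<zeta>. norm (h \<zeta>) \<partial>lborel) / norm d) * (1 + norm p) ^ 0" for p
    proof -
      have "norm (\<integral>\<zeta>. cis (p \<bullet> \<zeta>) * h \<zeta> \<partial>lborel) \<le> (\<integral>\<zeta>. norm (h \<zeta>) \<partial>lborel)"
        by (rule order_trans[OF integral_norm_bound]) (simp add: norm_mult)
      then show ?thesis unfolding u_def norm_divide by (simp add: divide_right_mono)
    qed
  qed measurable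
  fix \<phi> :: "'a \<Rightarrow> complex" assume \<phi>: "\<phi> \<in> schwartz"
  note \<phi>' = integrable_fourier_schwartz[OF \<phi>]
  have [measurable]: "\<phi> \<in> borel_measurable borel" by (rule schwartz_measurable[OF \<phi>])
  obtain B where B: "B \<ge> 0" "\<And>x. norm (iter_deriv [] \<phi> x) \<le> B / (1 + norm x) ^ 0"
    by (rule schwartz_decay[OF \<phi>, of "[]" 0]) (simp, rule that)
  have "integrable (lborel \<Otimes>\<^sub>M lborel) (\<lambda>(p, \<zeta>). cis (p \<bullet> \<zeta>) * h \<zeta> * fourier \<phi> p)"
    by (rule lborel_pair.integrable_pair_bound[OF integrable_norm[OF \<phi>'] integrable_norm[OF h]]) (auto simp: norm_mult)
  then have "(\<integral>\<zeta>. (\<integral>p. cis (p \<bullet> \<zeta>) * h \<zeta> * fourier \<phi> p \<partial>lborel) \<partial>lborel) =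
      (\<integral>p. (\<integral>\<zeta>. cis (p \<bullet> \<zeta>) * h \<zeta> * fourier \<phi> p \<partial>lborel) \<partial>lborel)"
    by (rule lborel_pair.Fubini_integral)
  moreover have "(\<integral>\<zeta>. cis (p \<bullet> \<zeta>) * h \<zeta> * fourier \<phi> p \<partial>lborel) = d * (u p * fourier \<phi> p)" for p
    using d by (simp add: u_def)
  moreover have "(\<integral>p. cis (p \<bullet> \<zeta>) * h \<zeta> * fourier \<phi> p \<partial>lborel) = d * (h \<zeta> * \<phi> \<zeta>)" for \<zeta>
  proof -
    have "(\<integral>p. cis (p \<bullet> \<zeta>) * fourier \<phi> p \<partial>lborel) = d * \<phi> \<zeta>"
      unfolding d_def using B(2) schwartz_integrable[OF \<phi>, of "[]"]
      by (intro fourier_inversion[OF _ _ schwartz_isCont[OF \<phi>] \<phi>', of B]) simp_all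
    moreover have "(\<integral>p. cis (p \<bullet> \<zeta>) * h \<zeta> * fourier \<phi> p \<partial>lborel) = h \<zeta> * (\<integral>p. cis (p \<bullet> \<zeta>) * fourier \<phi> p \<partial>lborel)"
      by (subst integral_mult_right_zero[symmetric]) (simp only: mult_ac)
    ultimately show ?thesis by simp
  qed
  ultimately have "d * (\<integral>\<zeta>. h \<zeta> * \<phi> \<zeta> \<partial>lborel) = d * (\<integral>p. u p * fourier \<phi> p \<partial>lborel)"
    by (simp only: integral_mult_right_zero)
  then show "fourier_distr (distr_of_fun u) \<phi> = distr_of_fun h \<phi>"
    using d by (simp add: fourier_distr_def distr_of_fun_def)
qed

lemma has_vector_derivative_shift:
  assumes "((\<lambda>t. h (y + t)) has_vector_derivative dir_deriv) (at 0)"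
  shows "(h has_vector_derivative dir_deriv) (at (y::real))"
  using assms by (simp add: has_vector_derivative_def has_derivative_at)

lemma spherical_mean_eq_sphere_int:
  fixes f :: "(real ^ 'n) \<times> real \<Rightarrow> complex"
  assumes "test_function f \<rho>"
  shows "spherical_mean f x r = test_function.sphere_int f (x, 0) r / of_real (sphere_area TYPE((real ^ 'n) \<times> real))"
proof -
  have "(x, 0) + r *\<^sub>R \<omega> = (x + r *\<^sub>R fst \<omega>, r * snd \<omega>)" for \<omega> :: "(real ^ 'n) \<times> real"
    by (simp add: prod_eq_iff)
  then show ?thesis by (simp add: spherical_mean_def test_function.sphere_int_def[OF assms] split_beta')
qed

text \<open>The square root in the backprojection is the distance from \<open>(x, t)\<close> to the
  centre \<open>(z, 0)\<close>. It is nonnegative, so the values of \<open>g\<close> at nonnegative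
  radii determine the integrand.\<close>

lemma backprojection_deriv_eq:
  fixes f :: "(real ^ 'n) \<times> real \<Rightarrow> complex"
  assumes f: "even_test_function f \<rho>" and g: "\<And>x r. 0 \<le> r \<Longrightarrow> g x r = spherical_mean f x r"
  shows "backprojection_deriv g p =
    (\<integral>z. test_function.sphere_int_grad f (0, 1) (z, 0) p \<partial>lborel) / of_real (sphere_area TYPE((real ^ 'n) \<times> real))"
proof -
  interpret even_test_function f \<rho> by (rule f)
  define A where "A = complex_of_real (sphere_area TYPE((real ^ 'n) \<times> real))"
  obtain x y where p: "p = (x, y)" by (cases p)
  have sphere_int: "g z r = sphere_int (z, 0) r / A" if "0 \<le> r" for z r
    using spherical_mean_eq_sphere_int[OF test_function_axioms] g[OF that] by (simp add: A_def)
  define v where "v = (\<lambda>z. vector_derivative (\<lambda>t. g z (sqrt ((norm (x - z))\<^sup>2 + t\<^sup>2))) (at y))"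
  have v: "v z = grad z (x, y) / A" if "z \<noteq> x" for z
  proof -
    have "((\<lambda>t. sphere_int (z, 0) (norm ((x, y) + t *\<^sub>R (0, 1) - (z, 0)))) has_vector_derivative grad z (x, y)) (at 0)"
      by (rule sphere_int_norm_has_vector_derivative) (use that in auto)
    then have "((\<lambda>t. sphere_int (z, 0) (sqrt ((norm (x - z))\<^sup>2 + t\<^sup>2))) has_vector_derivative grad z (x, y)) (at y)"
      by - (rule has_vector_derivative_shift, simp add: norm_Pair)
    then have "((\<lambda>t. g z (sqrt ((norm (x - z))\<^sup>2 + t\<^sup>2))) has_vector_derivative grad z (x, y) / A) (at y)"
      by (simp add: sphere_int has_vector_derivative_divide)
    then show ?thesis unfolding v_def by (rule vector_derivative_at)
  qed
  \<comment> \<open>At \<open>z = x\<close> the value of \<open>vector_derivative\<close> is left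
    undetermined. Naming it \<open>c\<close> exhibits \<open>v\<close> as a measurable function
    altered at one point.\<close>
  have v_if: "v = (\<lambda>z. if z = x then c else grad z (x, y) / A)" if "c = v x" for c
    by (rule ext) (simp add: v that)
  have [measurable]: "v \<in> borel_measurable borel"
    by (subst v_if[OF refl]) measurable
  have "(\<integral>z. v z \<partial>lborel) = (\<integral>z. grad z (x, y) / A \<partial>lborel)"
    by (rule integral_cong_AE) (measurable, use AE_lborel_singleton[of x] v in \<open>auto elim!: eventually_mono\<close>)
  then show ?thesis by (simp add: backprojection_deriv_def p v_def A_def)
qed

lemma even_test_function_of_test_functions:
  assumes "f \<in> even_test_functions"
  obtains \<rho> where "even_test_function f \<rho>"
proof -
  have K: "compact (closure {p. f p \<noteq> 0})" and sm: "smooth f" and ev: "f (x, - y) = f (x, y)" for x y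
    using assms by (auto simp: even_test_functions_def)
  obtain \<rho> where \<rho>: "\<And>p. p \<in> closure {p. f p \<noteq> 0} \<Longrightarrow> norm p \<le> \<rho>"
    using compact_imp_bounded[OF K] by (auto simp: bounded_iff)
  \<comment> \<open>The absolute value covers an empty support, for which the bound may be
    negative.\<close>
  have "even_test_function f \<bar>\<rho>\<bar>"
  proof
    show "f p = 0" if "\<bar>\<rho>\<bar> < norm p" for p
    proof (rule ccontr)
      assume "f p \<noteq> 0"
      then have "p \<in> closure {p. f p \<noteq> 0}" by (intro subsetD[OF closure_subset]) simp
      from \<rho>[OF this] that show False by simp
    qed
  qed (auto intro: smooth_compact_support_schwartz sm K ev)
  then show ?thesis by (rule that)
qed

theorem theorem2p3p6:
  fixes f :: "(real ^ 'n) \<times> real \<Rightarrow> complex"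
    and g :: "real ^ 'n \<Rightarrow> real \<Rightarrow> complex"
    and c :: real
  assumes f: "f \<in> even_test_functions"
    and g: "\<And>x r. 0 \<le> r \<Longrightarrow> g x r = spherical_mean f x r"
    and c: "c = 1 / (2 * pi) ^ CARD('n) * (sphere_area TYPE((real ^ 'n) \<times> real) / 2)"
  shows "tempered_function (backprojection_deriv g) \<and>
    (\<exists>U V. has_multiplier_image laplacian_power_multiplier
             (distr_of_fun (backprojection_deriv g)) U \<and>
           has_multiplier_image hilbert_y_multiplier U V \<and>
           (\<forall>\<phi>\<in>schwartz. distr_of_fun f \<phi> = of_real c * V \<phi>))"
proof -
  obtain \<rho> where "even_test_function f \<rho>" by (rule even_test_function_of_test_functions[OF f])
  then interpret even_test_function f \<rho> .
  define A where "A = sphere_area TYPE((real ^ 'n) \<times> real)"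
  have A: "A > 0" unfolding A_def by (rule sphere_area_pos)
  then have c0: "c > 0" by (simp add: c A_def)
  let ?R = "backprojection_deriv g"
  have R: "?R p = (\<integral>z. grad z p \<partial>lborel) / of_real A" for p
    unfolding A_def by (rule backprojection_deriv_eq[OF even_test_function_axioms g])
  have [measurable]: "?R \<in> borel_measurable borel" unfolding R[abs_def] by measurable
  have tempered_R: "tempered_function ?R"
  proof -
    obtain C where C: "C \<ge> 0" "\<And>p. (\<integral>z. norm (grad z p) \<partial>lborel) \<le> C * (1 + norm p)"
      using grad_integral_bound by blast
    show ?thesis
    proof (rule tempered_functionI)
      show "norm (?R p) \<le> (C / A) * (1 + norm p) ^ 1" for p
      proof -
        have "norm (\<integral>z. grad z p \<partial>lborel) \<le> C * (1 + norm p)"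
          by (rule order_trans[OF integral_norm_bound C(2)])
        then show ?thesis using A unfolding R norm_divide by (simp add: divide_right_mono)
      qed
    qed measurable
  qed
  define F where "F = (\<lambda>\<zeta>. \<i> / of_real c * (of_real (sgn (snd \<zeta>)) * ((1 / norm \<zeta> ^ (CARD('n) - 1)) *\<^sub>R fourier f \<zeta>)))"
  define mF where "mF = (\<lambda>\<zeta>. \<i> / of_real c * (of_real (sgn (snd \<zeta>)) * fourier f \<zeta>))"
  have [measurable]: "(\<lambda>\<zeta>::(real ^ 'n) \<times> real. sgn (snd \<zeta>)) \<in> borel_measurable borel" by measurable
  have sgn_mult: "integrable lborel (\<lambda>\<zeta>::(real ^ 'n) \<times> real. of_real (sgn (snd \<zeta>)) * k \<zeta>)" if "integrable lborel k" for k :: "_ \<Rightarrow> complex"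
    by (rule Bochner_Integration.integrable_bound[OF that]) (use that in \<open>auto simp: norm_mult sgn_if\<close>)
  have tempered_F: "tempered_function F"
    unfolding F_def using integrable_fourier_f_weight
    by (intro tempered_function_integrable_fun integrable_mult_right sgn_mult) simp
  have mF: "integrable lborel mF"
    unfolding mF_def by (intro integrable_mult_right sgn_mult integrable_fourier_schwartz schwartz)
  \<comment> \<open>The identity holds at every point, including the origin: where
    \<open>snd \<zeta> = 0\<close> the sign makes both sides 0, and elsewhere the power of the norm
    cancels.\<close>
  have laplacian: "laplacian_power_multiplier \<zeta> * F \<zeta> = mF \<zeta>" for \<zeta> :: "(real ^ 'n) \<times> real"
  proof (cases "snd \<zeta> = 0")
    case False
    have "laplacian_power_multiplier \<zeta> = of_real (norm \<zeta> ^ (CARD('n) - 1))"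
      by (simp add: laplacian_power_multiplier_def split_beta' norm_prod_def)
    moreover have "norm \<zeta> \<noteq> 0" using False by auto
    ultimately show ?thesis by (simp add: F_def mF_def scaleR_conv_of_real)
  qed (simp add: F_def mF_def)
  have fourier_R: "fourier_distr (distr_of_fun ?R) \<phi> = distr_of_fun F \<phi>" if \<phi>: "\<phi> \<in> schwartz" for \<phi>
  proof -
    define I where "I = (\<integral>\<zeta>. of_real (sgn (snd \<zeta>)) * ((1 / norm \<zeta> ^ (DIM(real ^ 'n) - 1)) *\<^sub>R fourier f \<zeta>) * \<phi> \<zeta> \<partial>lborel)"
    have "fourier_distr (distr_of_fun ?R) \<phi> = (\<integral>p. (\<integral>z. grad z p \<partial>lborel) * fourier \<phi> p / of_real A \<partial>lborel)"
      by (simp add: fourier_distr_def distr_of_fun_def R)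
    also have "\<dots> = (\<integral>p. (\<integral>z. grad z p \<partial>lborel) * fourier \<phi> p \<partial>lborel) / of_real A"
      by (rule integral_divide_zero)
    also have "\<dots> = (2 * \<i> * of_real ((2 * pi) ^ CARD('n)) * I) / of_real A"
      unfolding I_def integral_backprojection_fourier_eq[OF \<phi>] by simp
    \<comment> \<open>The constant \<open>c\<close> is chosen so that
      \<open>2 * (2 * pi) ^ n / A = 1 / c\<close>.\<close>
    also have "\<dots> = \<i> / of_real c * I"
      unfolding c A_def[symmetric] using A by (simp add: field_simps)
    also have "\<dots> = distr_of_fun F \<phi>"
      unfolding I_def distr_of_fun_def F_def
      by (subst integral_mult_right_zero[symmetric]) (simp add: mult_ac)
    finally show ?thesis .
  qed
  obtain u where u: "tempered_function u" "\<And>\<phi>. \<phi> \<in> schwartz \<Longrightarrow> fourier_distr (distr_of_fun u) \<phi> = distr_of_fun mF \<phi>"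
    by (rule inverse_fourier_distribution[OF mF]) (rule that)
  have "has_multiplier_image laplacian_power_multiplier (distr_of_fun ?R) (distr_of_fun u)"
    unfolding has_multiplier_image_def
    by (intro conjI exI[of _ F] ballI tempered_distribution_distr_of_fun tempered_R u tempered_F fourier_R)
       (simp_all only: laplacian u(2) tempered_function_integrable_fun[OF mF])
  moreover have "has_multiplier_image hilbert_y_multiplier (distr_of_fun u) (distr_of_fun (\<lambda>p. f p / of_real c))"
  proof -
    have fc: "integrable lborel (\<lambda>p. f p / of_real c)" using f_integrable by simp
    \<comment> \<open>The two imaginary units multiply to 1 and the square of the sign is 1 off the
      hyperplane \<open>\<eta> = 0\<close>.\<close>
    have hilbert: "AE \<zeta> in lborel. hilbert_y_multiplier \<zeta> * mF \<zeta> = fourier f \<zeta> / of_real c"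
      using AE_snd_nonzero
    proof eventually_elim
      case (elim \<zeta>)
      then show ?case
        by (cases "snd \<zeta> > 0") (simp_all add: hilbert_y_multiplier_def mF_def split_beta')
    qed
    have [measurable]: "(hilbert_y_multiplier :: (real ^ 'n) \<times> real \<Rightarrow> complex) \<in> borel_measurable borel"
      unfolding hilbert_y_multiplier_def split_beta' by measurable
    have [measurable]: "mF \<in> borel_measurable borel" using mF by auto
    have "integrable lborel (\<lambda>\<zeta>. fourier f \<zeta> / of_real c)"
      using integrable_fourier_schwartz[OF schwartz] by simp
    then have hm: "integrable lborel (\<lambda>\<zeta>. hilbert_y_multiplier \<zeta> * mF \<zeta>)"
      by (subst integrable_cong_AE[OF _ _ hilbert]) auto
    \<comment> \<open>The final image is \<open>f / c\<close> itself: the multiplication formula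
      identifies its distributional transform with \<open>fourier f / c\<close>.\<close>
    have V: "fourier_distr (distr_of_fun (\<lambda>p. f p / of_real c)) \<phi> = distr_of_fun (\<lambda>\<zeta>. hilbert_y_multiplier \<zeta> * mF \<zeta>) \<phi>"
      if \<phi>: "\<phi> \<in> schwartz" for \<phi>
    proof -
      have [measurable]: "\<phi> \<in> borel_measurable borel" by (rule schwartz_measurable[OF \<phi>])
      have "fourier_distr (distr_of_fun (\<lambda>p. f p / of_real c)) \<phi> = (\<integral>p. f p * fourier \<phi> p / of_real c \<partial>lborel)"
        by (simp add: fourier_distr_def distr_of_fun_def)
      also have "\<dots> = (\<integral>p. f p * fourier \<phi> p \<partial>lborel) / of_real c"
        by (rule integral_divide_zero)
      also have "\<dots> = (\<integral>\<zeta>. fourier f \<zeta> * \<phi> \<zeta> \<partial>lborel) / of_real c"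
        by (simp only: fourier_multiplication_formula[OF f_integrable \<phi>_integrable[OF \<phi>]])
      also have "\<dots> = (\<integral>\<zeta>. fourier f \<zeta> * \<phi> \<zeta> / of_real c \<partial>lborel)"
        by (rule integral_divide_zero[symmetric])
      also have "\<dots> = distr_of_fun (\<lambda>\<zeta>. hilbert_y_multiplier \<zeta> * mF \<zeta>) \<phi>"
        unfolding distr_of_fun_def
        by (rule integral_cong_AE) (measurable, rule eventually_mono[OF hilbert], simp)
      finally show ?thesis .
    qed
    show ?thesis
      unfolding has_multiplier_image_def
      by (intro conjI exI[of _ mF] ballI tempered_distribution_distr_of_fun tempered_function_integrable_fun u fc mF hm V)
  qed
  moreover have "distr_of_fun f \<phi> = of_real c * distr_of_fun (\<lambda>p. f p / of_real c) \<phi>" for \<phi>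
    using c0 by (simp add: distr_of_fun_def)
  ultimately show ?thesis using tempered_R by blast
qed

end
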